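(* On 7-dimensional non-abelian real nilpotent Lie algebras $\mathfrak{g}$ with a closed $\mathrm{G}_2$-structure there is no relation between $\dim\mathcal{M}^{\mathrm{c}}(\mathfrak{g})$ and $b_3(\mathfrak{g})$. More precisely: (i) if $\mathfrak{g}$ is a 7-dimensional non-abelian decomposable nilpotent Lie algebra admitting a closed $\mathrm{G}_2$-structure, then $\dim\mathcal{M}^{\mathrm{c}}(\mathfrak{g})<b_3(\mathfrak{g})$; (ii) there exist 7-dimensional indecomposable nilpotent Lie algebras $\mathfrak{g}$ admitting a closed $\mathrm{G}_2$-structure with $\dim\mathcal{M}^{\mathrm{c}}(\mathfrak{g})<b_3(\mathfrak{g})$, and there exist 7-dimensional indecomposable nilpotent Lie algebras $\mathfrak{g}$ admitting a closed $\mathrm{G}_2$-structure with $\dim\mathcal{M}^{\mathrm{c}}(\mathfrak{g})>b_3(\mathfrak{g})$.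
   Context: A Lie algebra is decomposable if it is a direct sum of two non-trivial Lie algebras, and indecomposable otherwise. $\mathrm{d}$ denotes the Chevalley–Eilenberg differential on $\Lambda^\bullet\mathfrak{g}^*$, and $b_3(\mathfrak{g})=\dim H^3(\mathfrak{g})$ is the third Betti number, i.e. the dimension of the third Lie algebra cohomology with trivial real coefficients. A $\mathrm{G}_2$-structure on a 7-dimensional real Lie algebra $\mathfrak{g}$ is a 3-form $\varphi\in\Lambda^3\mathfrak{g}^*$ for which there is a basis $\{\eta^1,\dots,\eta^7\}$ of $\mathfrak{g}^*$ with $\varphi=\eta^{127}+\eta^{347}+\eta^{567}+\eta^{135}-\eta^{236}-\eta^{146}-\eta^{245}$, where $\eta^{ijk}=\eta^i\wedge\eta^j\wedge\eta^k$. It is closed if $\mathrm{d}\varphi=0$. Set $V^{\mathrm{c}}(\mathfrak{g})=\{\varphi\in\Lambda^3\mathfrak{g}^*\mid\varphi\text{ is a }\mathrm{G}_2\text{-structure and }\mathrm{d}\varphi=0\}$, an open subset of the space $Z^3(\mathfrak{g}^* )$ of closed 3-forms, so that (when it is non-empty) $\dim V^{\mathrm{c}}(\mathfrak{g})=\dim Z^3(\mathfrak{g}^* )$. The group $\mathrm{Aut}(\mathfrak{g})$ of Lie algebra automorphisms acts naturally on $V^{\mathrm{c}}(\mathfrak{g})$; let $\mathcal{O}(\varphi)\cong\mathrm{Aut}(\mathfrak{g})/\mathrm{Aut}(\mathfrak{g})_\varphi$ be the orbit of $\varphi$, where $\mathrm{Aut}(\mathfrak{g})_\varphi$ is the stabilizer.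 The moduli space of closed $\mathrm{G}_2$-structures on $\mathfrak{g}$ is $\mathcal{M}^{\mathrm{c}}(\mathfrak{g})=V^{\mathrm{c}}(\mathfrak{g})/\mathrm{Aut}(\mathfrak{g})$, and its dimension is defined as $$\dim\mathcal{M}^{\mathrm{c}}(\mathfrak{g})=\dim V^{\mathrm{c}}(\mathfrak{g})-\dim\mathcal{O}(\varphi)=\dim V^{\mathrm{c}}(\mathfrak{g})-\bigl(\dim\mathrm{Aut}(\mathfrak{g})-\dim\mathrm{Aut}(\mathfrak{g})_\varphi\bigr),$$ where $\varphi\in V^{\mathrm{c}}(\mathfrak{g})$ is chosen so that $\mathcal{O}(\varphi)$ has maximal dimension among all orbits (equivalently, the stabilizer of $\varphi$ has minimal dimension). *)

theory Defs
  imports "HOL-Analysis.Analysis"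
begin

section \<open>Real Lie algebras\<close>

text \<open>
  A Lie algebra is a bracket on a whole type of class \<open>euclidean_space\<close>.  Its inner product is
  never referred to; it only provides the finite dimension and the standard vector space topology.
\<close>

definition lie_algebra :: "('a::euclidean_space \<Rightarrow> 'a \<Rightarrow> 'a) \<Rightarrow> bool" where
  "lie_algebra br \<longleftrightarrow>
     bilinear br \<and> (\<forall>x. br x x = 0) \<and>
     (\<forall>x y z. br x (br y z) + br y (br z x) + br z (br x y) = 0)"

definition abelian :: "('a::euclidean_space \<Rightarrow> 'a \<Rightarrow> 'a) \<Rightarrow> bool" where
  "abelian br \<longleftrightarrow> (\<forall>x y. br x y = 0)"

fun lower_central :: "('a::euclidean_space \<Rightarrow> 'a \<Rightarrow> 'a) \<Rightarrow> nat \<Rightarrow> 'a set" where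
  "lower_central br 0 = UNIV"
| "lower_central br (Suc n) = span {br x y | x y. y \<in> lower_central br n}"

definition nilpotent :: "('a::euclidean_space \<Rightarrow> 'a \<Rightarrow> 'a) \<Rightarrow> bool" where
  "nilpotent br \<longleftrightarrow> (\<exists>n. lower_central br n = {0})"

text \<open>Internal direct sum of two nonzero Lie subalgebras that commute with each other.\<close>

definition decomposable :: "('a::euclidean_space \<Rightarrow> 'a \<Rightarrow> 'a) \<Rightarrow> bool" where
  "decomposable br \<longleftrightarrow>
     (\<exists>h k. subspace h \<and> subspace k \<and> h \<noteq> {0} \<and> k \<noteq> {0} \<and>
        h \<inter> k = {0} \<and> {x + y | x y. x \<in> h \<and> y \<in> k} = UNIV \<and>
        (\<forall>x\<in>h. \<forall>y\<in>h. br x y \<in> h) \<and> (\<forall>x\<in>k. \<forall>y\<in>k. br x y \<in> k) \<and>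
        (\<forall>x\<in>h. \<forall>y\<in>k. br x y = 0))"

section \<open>Forms and Lie algebra cohomology\<close>

type_synonym 'a bilin = "'a \<Rightarrow>\<^sub>L 'a \<Rightarrow>\<^sub>L real"
type_synonym 'a trilin = "'a \<Rightarrow>\<^sub>L 'a \<Rightarrow>\<^sub>L 'a \<Rightarrow>\<^sub>L real"

definition forms2 :: "'a::euclidean_space bilin set" where
  "forms2 = {\<omega> :: 'a bilin. \<forall>x. \<omega> x x = 0}"

definition forms3 :: "'a::euclidean_space trilin set" where
  "forms3 = {\<phi> :: 'a trilin. \<forall>x y. \<phi> x x y = 0 \<and> \<phi> x y x = 0 \<and> \<phi> y x x = 0}"

text \<open>
  The Chevalley-Eilenberg differential with trivial coefficients,
  \<open>d\<omega>(x\<^sub>0,\<dots>,x\<^sub>k) = \<Sum>i<j. (-1)^(i+j) \<omega>([x\<^sub>i,x\<^sub>j], x\<^sub>0,\<dots>,x\<^sub>k with x\<^sub>i and x\<^sub>j omitted)\<close>,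
  written out for \<open>k = 2\<close> and \<open>k = 3\<close>.
\<close>

definition d2 :: "('a::euclidean_space \<Rightarrow> 'a \<Rightarrow> 'a) \<Rightarrow> 'a bilin \<Rightarrow> 'a \<Rightarrow> 'a \<Rightarrow> 'a \<Rightarrow> real" where
  "d2 br \<omega> x y z = - \<omega> (br x y) z + \<omega> (br x z) y - \<omega> (br y z) x"

definition d3 ::
  "('a::euclidean_space \<Rightarrow> 'a \<Rightarrow> 'a) \<Rightarrow> 'a trilin \<Rightarrow> 'a \<Rightarrow> 'a \<Rightarrow> 'a \<Rightarrow> 'a \<Rightarrow> real" where
  "d3 br \<phi> x y z w =
     - \<phi> (br x y) z w + \<phi> (br x z) y w - \<phi> (br x w) y z
     - \<phi> (br y z) x w + \<phi> (br y w) x z - \<phi> (br z w) x y"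

definition closed_forms3 :: "('a::euclidean_space \<Rightarrow> 'a \<Rightarrow> 'a) \<Rightarrow> 'a trilin set" where
  "closed_forms3 br = {\<phi> \<in> forms3. \<forall>x y z w. d3 br \<phi> x y z w = 0}"

definition exact_forms3 :: "('a::euclidean_space \<Rightarrow> 'a \<Rightarrow> 'a) \<Rightarrow> 'a trilin set" where
  "exact_forms3 br = {\<phi> \<in> forms3. \<exists>\<omega>\<in>forms2. \<forall>x y z. \<phi> x y z = d2 br \<omega> x y z}"

text \<open>
  \<open>dim H\<^sup>3 = dim (Z\<^sup>3 / B\<^sup>3)\<close>; the truncated subtraction is harmless since \<open>B\<^sup>3 \<subseteq> Z\<^sup>3\<close>.
\<close>

definition betti3 :: "('a::euclidean_space \<Rightarrow> 'a \<Rightarrow> 'a) \<Rightarrow> nat" where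
  "betti3 br = dim (closed_forms3 br) - dim (exact_forms3 br)"

section \<open>Closed G2-structures\<close>

definition dual_basis7 :: "(nat \<Rightarrow> 'a::euclidean_space \<Rightarrow>\<^sub>L real) \<Rightarrow> bool" where
  "dual_basis7 \<eta> \<longleftrightarrow>
     inj_on \<eta> {1..7} \<and> independent (\<eta> ` {1..7}) \<and> span (\<eta> ` {1..7}) = UNIV"

text \<open>The wedge product of three 1-forms, in the determinant normalisation.\<close>

definition wedge3 ::
  "('a::euclidean_space \<Rightarrow>\<^sub>L real) \<Rightarrow> ('a \<Rightarrow>\<^sub>L real) \<Rightarrow> ('a \<Rightarrow>\<^sub>L real) \<Rightarrow> 'a \<Rightarrow> 'a \<Rightarrow> 'a \<Rightarrow> real" where
  "wedge3 a b c x y z =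
     a x * (b y * c z - b z * c y) - a y * (b x * c z - b z * c x) + a z * (b x * c y - b y * c x)"

definition G2_structure :: "'a::euclidean_space trilin \<Rightarrow> bool" where
  "G2_structure \<phi> \<longleftrightarrow>
     \<phi> \<in> forms3 \<and>
     (\<exists>\<eta> :: nat \<Rightarrow> 'a \<Rightarrow>\<^sub>L real. dual_basis7 \<eta> \<and>
       (let e = (\<lambda>i j k. wedge3 (\<eta> i) (\<eta> j) (\<eta> k)) in
        \<forall>x y z. \<phi> x y z =
          e 1 2 7 x y z + e 3 4 7 x y z + e 5 6 7 x y z + e 1 3 5 x y z
          - e 2 3 6 x y z - e 1 4 6 x y z - e 2 4 5 x y z))"

definition closed_G2 :: "('a::euclidean_space \<Rightarrow> 'a \<Rightarrow> 'a) \<Rightarrow> 'a trilin set" where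
  "closed_G2 br = {\<phi> \<in> closed_forms3 br. G2_structure \<phi>}"

section \<open>The moduli space dimension\<close>

text \<open>
  The dimension of a nonempty topological manifold.  It is well defined by invariance of dimension
  and is applied below to nonempty open subsets of vector spaces and to closed subgroups of
  \<open>GL(\<gg>)\<close>, whose dimension as Lie groups it is.  These are sets of bounded linear maps and carry
  the topology of the operator norm.
\<close>

definition locally_Euclidean :: "nat \<Rightarrow> 'b::topological_space set \<Rightarrow> bool" where
  "locally_Euclidean n S \<longleftrightarrow>
     (\<forall>x\<in>S. \<exists>U. openin (top_of_set S) U \<and> x \<in> U \<and>
        top_of_set U homeomorphic_space Euclidean_space n)"

definition manifold_dim :: "'b::topological_space set \<Rightarrow> nat" where
  "manifold_dim S = (THE n. locally_Euclidean n S)"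

definition Aut :: "('a::euclidean_space \<Rightarrow> 'a \<Rightarrow> 'a) \<Rightarrow> ('a \<Rightarrow>\<^sub>L 'a) set" where
  "Aut br = {A :: 'a \<Rightarrow>\<^sub>L 'a. bij (blinfun_apply A) \<and> (\<forall>x y. A (br x y) = br (A x) (A y))}"

text \<open>
  The stabilizer with respect to the pull-back action; an automorphism fixes \<open>\<phi>\<close> under
  \<open>A\<^sup>*\<close> if and only if it does so under \<open>(A\<^sup>-\<^sup>1)\<^sup>*\<close>.
\<close>

definition stabilizer ::
  "('a::euclidean_space \<Rightarrow> 'a \<Rightarrow> 'a) \<Rightarrow> 'a trilin \<Rightarrow> ('a \<Rightarrow>\<^sub>L 'a) set" where
  "stabilizer br \<phi> = {A \<in> Aut br. \<forall>x y z. \<phi> (A x) (A y) (A z) = \<phi> x y z}"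

text \<open>The dimension of the orbit of \<open>\<phi>\<close> as the homogeneous space \<open>Aut(\<gg>) / Aut(\<gg>)\<^sub>\<phi>\<close>.\<close>

definition orbit_dim :: "('a::euclidean_space \<Rightarrow> 'a \<Rightarrow> 'a) \<Rightarrow> 'a trilin \<Rightarrow> int" where
  "orbit_dim br \<phi> = int (manifold_dim (Aut br)) - int (manifold_dim (stabilizer br \<phi>))"

text \<open>Only meaningful if there is a closed G2-structure, that is, if \<open>closed_G2 br \<noteq> {}\<close>.\<close>

definition moduli_dim :: "('a::euclidean_space \<Rightarrow> 'a \<Rightarrow> 'a) \<Rightarrow> int" where
  "moduli_dim br = int (manifold_dim (closed_G2 br)) - (MAX \<phi>\<in>closed_G2 br. orbit_dim br \<phi>)"

end

theory Submission
  imports Defs "HOL-Homology.Homology"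
begin

text \<open>
  \<open>Aut(\<gg>)\<close> and its stabilizers are closed linear groups, so their dimensions are those of the derivation algebra
  and of the derivations that annihilate \<open>\<phi>\<close>.  The \<open>GL(7)\<close>-orbit of a G2-structure is open, so \<open>V\<^sup>c(\<gg>)\<close> is
  open in \<open>Z\<^sup>3\<close>.  Since \<open>b\<^sub>3 = dim Z\<^sup>3 - dim B\<^sup>3\<close>, comparing \<open>dim M\<^sup>c(\<gg>)\<close> with \<open>b\<^sub>3\<close> amounts to comparing
  \<open>dim B\<^sup>3\<close> with the maximal dimension of an orbit of \<open>Aut(\<gg>)\<close>.

  If \<open>\<gg>\<close> is decomposable but not abelian, it has central vectors \<open>X, Y\<close> and a functional that vanishes on \<open>[\<gg>,\<gg>]\<close> and
  separates \<open>X\<close> from \<open>Y\<close>.  In a frame adapted to \<open>\<phi>\<close> and to these data, closedness, nilpotency and the Jacobi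
  identity make four frame vectors central.  This yields \<open>dim B\<^sup>3 \<le> 13\<close> and a 16-dimensional space of derivations
  into the centre that meets the annihilator of \<open>\<phi>\<close> in zero.  In particular the centre of a decomposable \<open>\<gg>\<close> has
  dimension at least 4, hence the two examples, whose centres are smaller, are indecomposable.  For \<open>br_n6\<close> there are
  15 derivations that act freely while \<open>dim B\<^sup>3 \<le> 14\<close>; for \<open>br_n9\<close> the derivations have dimension at most 12
  while \<open>dim B\<^sup>3 \<ge> 13\<close>.
\<close>

section \<open>Dimension of locally Euclidean sets\<close>

text \<open>Two nonabelian factors are impossible: evaluating \<open>d \<phi>\<close> on two vectors
  of one factor and, from the other, a central vector and a further vector shows that
  \<open>\<phi>(z, w, _)\<close> vanishes for central \<open>z\<close>, \<open>w\<close> in the two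
  commutators, which nondegeneracy of the cross product forbids. So one factor is abelian; it
  supplies \<open>X\<close>, the other one \<open>Y\<close>, and the functional vanishes on the
  nonabelian factor. For central \<open>X\<close>, \<open>Y\<close>, closedness says that the 1-form
  \<open>\<phi>(X, Y, _)\<close> kills all brackets; the separating functional kills them too and
  expresses one more component of a bracket by the others. The obstacle is the third frame vector,
  which at first is central only modulo \<open>X\<close> and \<open>Y\<close>. The constant
  \<open>c 4 7 5\<close> measures the failure, and a genuinely central vector has to be found before
  the frame is chosen a second time. Freeness is always read off from skewness: an endomorphism
  annihilating \<open>\<phi>\<close> is skew for the metric of \<open>\<phi>\<close>. The 16
  derivations are 4 central vectors times 4 functionals that kill brackets; the 13 is 4 times 3 plus
  1.\<close>

lemma Euclidean_space_local_dim_le: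
  assumes U: "openin (top_of_set S) U" "x \<in> U" "top_of_set U homeomorphic_space Euclidean_space m"
    and V: "openin (top_of_set S) V" "x \<in> V" "top_of_set V homeomorphic_space Euclidean_space n"
  shows "m \<le> n"
proof (rule ccontr)
  assume "\<not> m \<le> n"
  then have nm: "n \<le> m" "n < m" by auto
  obtain f f' where f: "homeomorphic_maps (top_of_set U) (Euclidean_space m) f f'"
    using U(3) by (auto simp: homeomorphic_space_def)
  obtain g g' where g: "homeomorphic_maps (top_of_set V) (Euclidean_space n) g g'"
    using V(3) by (auto simp: homeomorphic_space_def)
  have f'c: "continuous_map (Euclidean_space m) (top_of_set U) f'"
    and gc: "continuous_map (top_of_set V) (Euclidean_space n) g"
    using f g by (auto simp: homeomorphic_maps_def)
  have ff': "f' (f z) = z" if "z \<in> U" for z using f that by (auto simp: homeomorphic_maps_def)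
  have f'f: "f (f' z) = z" if "z \<in> topspace (Euclidean_space m)" for z
    using f that by (auto simp: homeomorphic_maps_def)
  have gg': "g' (g z) = z" if "z \<in> V" for z using g that by (auto simp: homeomorphic_maps_def)
  have fU: "f z \<in> topspace (Euclidean_space m)" if "z \<in> U" for z
    using f that by (auto simp: homeomorphic_maps_def continuous_map_def Pi_iff)
  define W where "W = {z \<in> topspace (Euclidean_space m). f' z \<in> U \<inter> V}"
  have "openin (top_of_set U) (U \<inter> V)"
    by (meson U(1) V(1) openin_Int openin_imp_subset openin_subset_trans inf_le1)
  then have W: "openin (Euclidean_space m) W"
    unfolding W_def using f'c by (rule openin_continuous_map_preimage[rotated])
  have "continuous_map (subtopology (Euclidean_space m) W) (top_of_set V) f'"
  proof -
    have "continuous_map (subtopology (Euclidean_space m) W) (top_of_set U) f'"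
      using f'c continuous_map_from_subtopology by blast
    then show ?thesis
      by (auto simp: continuous_map_in_subtopology W_def)
  qed
  then have h: "continuous_map (subtopology (Euclidean_space m) W) (Euclidean_space n) (g \<circ> f')"
    using gc continuous_map_compose by blast
  have inj: "inj_on (g \<circ> f') W"
    by (rule inj_on_inverseI[where g = "f \<circ> g'"]) (auto simp: W_def gg' f'f)
  \<comment> \<open>The smaller model space sits in the larger one as the functions vanishing from
    \<open>n\<close> on. The change of charts is thus an injective map from an open subset of
    m-space to m-space, and invariance of domain applies.\<close>
  have "Euclidean_space n = subtopology (Euclidean_space m) (topspace (Euclidean_space n))"
    by (metis Euclidean_space_def nm(1) inf.absorb_iff2 subset_Euclidean_space subtopology_subtopology topspace_Euclidean_space)
  then have "continuous_map (subtopology (Euclidean_space m) W) (Euclidean_space m) (g \<circ> f')"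
    using h by (metis continuous_map_in_subtopology)
  then have ope: "openin (Euclidean_space m) ((g \<circ> f') ` W)" (is "openin _ ?O")
    using invariance_of_domain_Euclidean_space W inj by blast
  have sub: "?O \<subseteq> topspace (Euclidean_space n)"
    using h W by (auto simp: continuous_map_def Pi_iff dest: openin_subset)
  have "f x \<in> W" using ff' fU U(2) V(2) by (auto simp: W_def)
  then obtain y where y: "y \<in> ?O" by blast
  \<comment> \<open>Moves coordinate \<open>n\<close>, which is 0 throughout the smaller model space
    but free in the larger one; an open image would contain a displaced point.\<close>
  define l where "l t = (\<lambda>i. if i < m then (y(n := t)) i else 0)" for t :: real
  have l: "continuous_map euclideanreal (Euclidean_space m) l"
    unfolding l_def by (subst continuous_map_componentwise_Euclidean_space) auto
  have y0: "y i = 0" if "i \<ge> n" for i using y sub that by (auto simp: topspace_Euclidean_space)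
  have "open {t. l t \<in> ?O}"
    using openin_continuous_map_preimage[OF l ope] by simp
  moreover have "l 0 = y" using y0 nm by (auto simp: l_def fun_eq_iff)
  ultimately obtain e where e: "e > 0" "ball 0 e \<subseteq> {t. l t \<in> ?O}"
    by (metis (mono_tags, lifting) mem_Collect_eq open_contains_ball y)
  then have "l (e/2) \<in> ?O" by (auto simp: subset_iff)
  then have "l (e/2) n = 0" using sub by (auto simp: topspace_Euclidean_space)
  then show False using nm e by (simp add: l_def)
qed

text \<open>Comparing charts at one point in both directions makes the definite description unique.
  A point is needed, since the empty set is locally Euclidean of every dimension.\<close>

lemma manifold_dim_eq:
  assumes "locally_Euclidean n S" "S \<noteq> {}"
  shows "manifold_dim S = n"
  unfolding manifold_dim_def
proof (rule the_equality)
  show "locally_Euclidean n S" by (rule assms(1))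
  fix m assume "locally_Euclidean m S"
  then show "m = n"
    using assms Euclidean_space_local_dim_le unfolding locally_Euclidean_def
    by (metis antisym ex_in_conv)
qed

text \<open>The radial stretching about \<open>a\<close> maps the ball onto the whole space shifted
  to the origin. It only rescales \<open>z - a\<close>, so it preserves \<open>V\<close>, as
  \<open>a\<close> lies in \<open>V\<close>.\<close>

lemma relative_ball_homeomorphic_Euclidean_space:
  fixes V :: "'e::euclidean_space set"
  assumes "subspace V" "r > 0" "a \<in> V"
  shows "top_of_set (ball a r \<inter> V) homeomorphic_space Euclidean_space (dim V)"
proof -
  define f where "f z = (1 / (1 - norm (z - a) / r)) *\<^sub>R (z - a)" for z :: 'e
  define g where "g w = a + (1 / (1 + norm w / r)) *\<^sub>R w" for w :: 'e
  have pos: "1 + norm w / r > 0" for w :: 'e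
    using assms(2) by (smt (verit) divide_nonneg_pos norm_ge_zero)
  have posb: "1 - norm (z - a) / r > 0" if "z \<in> ball a r" for z :: 'e
    using that assms(2) by (simp add: dist_norm norm_minus_commute)
  have ng: "norm (g w - a) = norm w / (1 + norm w / r)" for w
    using pos[of w] by (simp add: g_def)
  have "homeomorphism (ball a r \<inter> V) V f g"
  proof (rule homeomorphismI)
    show "continuous_on (ball a r \<inter> V) f"
      unfolding f_def using posb assms(2) by (intro continuous_intros) force+
    show "continuous_on V g"
      unfolding g_def using pos assms(2) by (intro continuous_intros) (auto simp: less_le)
    show "f ` (ball a r \<inter> V) \<subseteq> V"
      using assms by (auto simp: f_def intro!: subspace_scale subspace_diff)
    have "g w \<in> V" if "w \<in> V" for w
      unfolding g_def using assms that by (intro subspace_add subspace_scale)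
    moreover have "g w \<in> ball a r" for w
    proof -
      have "norm w / (1 + norm w / r) < r"
        using pos[of w] assms(2) by (simp add: divide_simps)
      then show ?thesis by (metis dist_commute dist_norm mem_ball ng)
    qed
    ultimately show "g ` V \<subseteq> ball a r \<inter> V" by auto
    show "g (f z) = z" if "z \<in> ball a r \<inter> V" for z
    proof -
      have p: "1 - norm (z - a) / r > 0" using posb that by blast
      have "norm (f z) = norm (z - a) / (1 - norm (z - a) / r)" using p by (simp add: f_def)
      then have "1 + norm (f z) / r = 1 / (1 - norm (z - a) / r)"
        using p assms(2) by (simp add: divide_simps) (simp add: field_simps)
      then have "g (f z) = a + (1 - norm (z - a) / r) *\<^sub>R f z" by (simp add: g_def)
      then show ?thesis using p assms(2) unfolding f_def by auto
    qed
    show "f (g w) = w" for w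
    proof -
      have "1 - norm (g w - a) / r = 1 / (1 + norm w / r)"
        unfolding ng using pos[of w] assms(2) by (simp add: divide_simps)
      then show ?thesis using pos[of w] unfolding f_def by (simp add: g_def)
    qed
  qed
  then have "(ball a r \<inter> V) homeomorphic V" by (auto simp: homeomorphic_def)
  then have "top_of_set (ball a r \<inter> V) homeomorphic_space top_of_set V" by simp
  then show ?thesis
    using homeomorphic_subspace_Euclidean_space_dim[OF assms(1)] homeomorphic_space_trans by blast
qed

section \<open>Linear coordinates on spaces of maps and forms\<close>

definition euclidean_iso :: "('b::real_normed_vector \<Rightarrow> 'e::euclidean_space) \<Rightarrow> bool" where
  "euclidean_iso c \<longleftrightarrow> bounded_linear c \<and> bij c \<and> bounded_linear (inv_into UNIV c)"

lemma dim_injective_linear_image: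
  fixes f :: "'b::real_vector \<Rightarrow> 'c::real_vector"
  assumes "linear f" "inj_on f (span V)"
  shows "dim (f ` V) = dim V"
proof -
  obtain B where B: "B \<subseteq> V" "independent B" "V \<subseteq> span B" "card B = dim V"
    using basis_exists by blast
  have inj: "inj_on f (span B)" using assms(2) B(1) by (meson inj_on_subset span_mono)
  show ?thesis
  proof (rule dim_unique)
    show "f ` B \<subseteq> f ` V" "f ` V \<subseteq> span (f ` B)"
      using B assms(1) by (auto simp: linear_span_image)
    show "independent (f ` B)"
      using assms(1) B(2) inj linear_independent_injective_image by blast
    show "card (f ` B) = dim V"
      using B inj by (metis card_image inj_on_subset span_superset)
  qed
qed

lemma euclidean_isoD:
  assumes "euclidean_iso c"
  shows "linear c" "inj c" "continuous_on A c" "continuous_on B (inv_into UNIV c)" "inv_into UNIV c (c x) = x" "c (inv_into UNIV c y) = y"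
    "linear (inv_into UNIV c)"
  using assms unfolding euclidean_iso_def
  by (auto intro: bounded_linear.linear bij_is_inj linear_continuous_on
      simp: bij_is_inj inv_f_f bij_is_surj surj_f_inv_f)

lemma dim_euclidean_iso:
  "euclidean_iso c \<Longrightarrow> dim (c ` V) = dim V"
  using dim_injective_linear_image euclidean_isoD(1,2) inj_on_subset by blast

lemma locally_Euclidean_openin_subspace:
  fixes c :: "'b::real_normed_vector \<Rightarrow> 'e::euclidean_space" and V :: "'b set"
  assumes c: "euclidean_iso c" and V: "subspace V" and S: "openin (top_of_set V) S"
  shows "locally_Euclidean (dim V) S"
  unfolding locally_Euclidean_def
proof
  fix x assume x: "x \<in> S"
  obtain T where T: "open T" "S = V \<inter> T" using S by (auto simp: openin_open)
  have "open (inv_into UNIV c -` T)"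
    using euclidean_isoD(4)[OF c, of UNIV] T(1) by (simp add: open_vimage)
  then obtain r where r: "r > 0" "ball (c x) r \<subseteq> inv_into UNIV c -` T"
    using x T(2) by (metis (no_types, lifting) IntE euclidean_isoD(5)[OF c] openE vimageI2)
  define U where "U = V \<inter> c -` ball (c x) r"
  have US: "U \<subseteq> S" using r(2) T(2) by (force simp: U_def subset_iff euclidean_isoD(5)[OF c])
  have "open (c -` ball (c x) r)"
    using euclidean_isoD(3)[OF c, of UNIV] by (simp add: open_vimage)
  then have "openin (top_of_set V) U" by (auto simp: U_def openin_open)
  then have op: "openin (top_of_set S) U"
    using US S by (meson openin_imp_subset openin_subset_trans)
  have sub: "subspace (c ` V)" using euclidean_isoD(1)[OF c] V by (rule linear_subspace_image)
  have "homeomorphism U (ball (c x) r \<inter> c ` V) c (inv_into UNIV c)"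
    by (rule homeomorphismI)
       (auto simp: U_def euclidean_isoD[OF c])
  then have "top_of_set U homeomorphic_space top_of_set (ball (c x) r \<inter> c ` V)"
    using homeomorphic_def by auto
  also have "\<dots> homeomorphic_space Euclidean_space (dim (c ` V))"
    using x T(2) by (intro relative_ball_homeomorphic_Euclidean_space[OF sub r(1)]) auto
  finally have "top_of_set U homeomorphic_space Euclidean_space (dim V)"
    by (simp add: dim_euclidean_iso[OF c])
  moreover have "x \<in> U" using x T(2) r(1) by (auto simp: U_def)
  ultimately show "\<exists>U. openin (top_of_set S) U \<and> x \<in> U \<and>
      top_of_set U homeomorphic_space Euclidean_space (dim V)"
    using op by blast
qed

text \<open>One index per basis vector of \<open>'a\<close>, so that
  \<open>'e ^ 'a basis_index\<close> is a Euclidean space fit to hold the values of a linear map on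
  the basis.\<close>

typedef (overloaded) 'a basis_index = "Basis :: 'a::euclidean_space set"
  using nonempty_Basis by blast

instance basis_index :: (euclidean_space) finite
proof
  have "(UNIV :: 'a basis_index set) = Abs_basis_index ` Basis"
    by (metis (no_types) Abs_basis_index_cases UNIV_eq_I image_eqI)
  then show "finite (UNIV :: 'a basis_index set)"
    using finite_imageI[OF finite_Basis] by (metis (full_types))
qed

abbreviation bas :: "'a::euclidean_space basis_index \<Rightarrow> 'a" where "bas \<equiv> Rep_basis_index"

lemma sum_bas: "(\<Sum>i\<in>UNIV. f (bas i)) = sum f Basis"
  by (rule sum.reindex_bij_betw)
     (metis bij_betw_def Rep_basis_index_inject type_definition.Rep_range
       type_definition_basis_index inj_on_def)

text \<open>A linear map is determined by its values on the basis, and these values can be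
  prescribed. Because \<open>d\<close> may itself be such a coordinate map, iteration yields
  coordinates on bilinear and trilinear forms.\<close>

lemma euclidean_iso_blinfun:
  fixes d :: "'b::real_normed_vector \<Rightarrow> 'e::euclidean_space"
  assumes d: "euclidean_iso d"
  shows "euclidean_iso (\<lambda>f :: 'a::euclidean_space \<Rightarrow>\<^sub>L 'b. (\<chi> i. d (f (bas i))) :: 'e ^ 'a basis_index)"
    (is "euclidean_iso ?c")
proof -
  have dl: "bounded_linear d" "bounded_linear (inv_into UNIV d)" using d by (auto simp: euclidean_iso_def)
  define g :: "'e ^ 'a basis_index \<Rightarrow> 'a \<Rightarrow>\<^sub>L 'b"
    where "g v = Blinfun (\<lambda>x. \<Sum>i\<in>UNIV. (x \<bullet> bas i) *\<^sub>R inv_into UNIV d (v $ i))" for v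
  have gv: "g v x = (\<Sum>i\<in>UNIV. (x \<bullet> bas i) *\<^sub>R inv_into UNIV d (v $ i))" for v x
    unfolding g_def by (subst bounded_linear_Blinfun_apply) (auto intro!: bounded_linear_intros)
  have "linear g"
    by (rule linearI; rule blinfun_eqI)
       (simp_all add: gv blinfun.bilinear_simps linear_add[OF euclidean_isoD(7)[OF d]]
         linear_scale[OF euclidean_isoD(7)[OF d]] scaleR_add_right sum.distrib scaleR_sum_right mult.commute)
  then have gl: "bounded_linear g" by (simp add: linear_conv_bounded_linear)
  have gc: "g (?c f) = f" for f
  proof (rule blinfun_eqI)
    fix x
    have "g (?c f) x = (\<Sum>i\<in>UNIV. (x \<bullet> bas i) *\<^sub>R f (bas i))"
      by (simp add: gv euclidean_isoD(5)[OF d])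
    also have "\<dots> = (\<Sum>b\<in>Basis. (x \<bullet> b) *\<^sub>R f b)" by (rule sum_bas)
    also have "\<dots> = f (\<Sum>b\<in>Basis. (x \<bullet> b) *\<^sub>R b)" by (simp add: blinfun.bilinear_simps)
    finally show "g (?c f) x = f x" by (simp add: euclidean_representation)
  qed
  have cg: "?c (g v) = v" for v
  proof -
    have "g v (bas j) = inv_into UNIV d (v $ j)" for j
    proof -
      have "bas j \<bullet> bas i = (if i = j then 1 else 0)" for i
        using Rep_basis_index[of i] Rep_basis_index[of j] Rep_basis_index_inject[of j i]
        by (simp add: inner_Basis)
      then show ?thesis by (simp add: gv if_distrib[of "\<lambda>u. u *\<^sub>R _"] cong: if_cong)
    qed
    then show ?thesis by (simp add: euclidean_isoD(6)[OF d])
  qed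
  have ev: "bounded_linear (\<lambda>f :: 'a \<Rightarrow>\<^sub>L 'b. d (f (bas i)))" for i
    using bounded_linear_compose[OF dl(1) blinfun.bounded_linear_left] .
  have "linear (\<lambda>x. axis i x :: 'e ^ 'a basis_index)" for i
    by (rule linearI) (simp_all add: axis_def vec_eq_iff)
  then have ax: "bounded_linear (\<lambda>x. axis i x :: 'e ^ 'a basis_index)" for i
    by (simp add: linear_conv_bounded_linear)
  have "bounded_linear (\<lambda>f :: 'a \<Rightarrow>\<^sub>L 'b. \<Sum>i\<in>UNIV. axis i (d (f (bas i))) :: 'e ^ 'a basis_index)"
    by (intro bounded_linear_sum) (rule bounded_linear_compose[OF ax ev])
  moreover have "?c = (\<lambda>f. \<Sum>i\<in>UNIV. axis i (d (f (bas i))))"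
  proof (rule ext, rule vec_eq_iff[THEN iffD2], rule allI)
    fix f :: "'a \<Rightarrow>\<^sub>L 'b" and j
    have "(\<Sum>i\<in>UNIV. axis i (d (f (bas i)))) $ j = (\<Sum>i\<in>UNIV. if j = i then d (f (bas i)) else 0)"
      by (simp only: sum_component axis_def vec_lambda_beta eq_commute)
    then show "?c f $ j = (\<Sum>i\<in>UNIV. axis i (d (f (bas i)))) $ j" by simp
  qed
  ultimately have "bounded_linear ?c" by simp
  moreover have "bij ?c" by (rule bijI') (metis gc, metis cg)
  moreover have "inv_into UNIV ?c = g" by (rule inv_equality) (simp_all add: gc cg)
  ultimately show ?thesis unfolding euclidean_iso_def using gl by simp
qed

lemma euclidean_iso_id: "euclidean_iso (\<lambda>x. x :: 'e::euclidean_space)"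
proof -
  have "inv_into UNIV (\<lambda>x. x :: 'e) = (\<lambda>x. x)" by (rule inv_equality) auto
  then show ?thesis by (simp add: euclidean_iso_def bounded_linear_ident bij_def)
qed

lemmas euclidean_iso_endomorphism = euclidean_iso_blinfun[OF euclidean_iso_id]
lemmas euclidean_iso_trilinear =
  euclidean_iso_blinfun[OF euclidean_iso_blinfun[OF euclidean_iso_blinfun[OF euclidean_iso_id]]]

section \<open>Closed subgroups of a Banach algebra\<close>

lemma norm_power_diff_le:
  fixes x y :: "'r::real_normed_algebra_1"
  assumes "norm x \<le> r" "norm y \<le> r"
  shows "norm (x ^ n - y ^ n) \<le> real n * r ^ (n - 1) * norm (x - y)"
proof (induction n)
  case (Suc n)
  have r: "r \<ge> 0" using assms(1) norm_ge_zero order_trans by blast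
  have "x ^ Suc n - y ^ Suc n = x * (x ^ n - y ^ n) + (x - y) * y ^ n" by (simp add: algebra_simps)
  then have "norm (x ^ Suc n - y ^ Suc n) \<le> norm x * norm (x ^ n - y ^ n) + norm (x - y) * norm (y ^ n)"
    by (metis norm_triangle_le add_mono norm_mult_ineq)
  also have "\<dots> \<le> r * (real n * r ^ (n - 1) * norm (x - y)) + norm (x - y) * r ^ n"
    using assms r Suc.IH
    by (intro add_mono mult_mono order.trans[OF norm_power_ineq power_mono]) auto
  also have "\<dots> = real (Suc n) * r ^ (Suc n - 1) * norm (x - y)"
    by (cases n) (simp_all add: algebra_simps)
  finally show ?case .
qed simp

text \<open>Power series are compared term by term; the bound on \<open>x ^ n - y ^ n\<close>
  cancels one factor of the factorial. On the ball of radius \<open>r\<close>, \<open>exp\<close>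
  differs from the identity by a map with Lipschitz constant \<open>exp r - 1\<close>, which is
  small for small \<open>r\<close>.\<close>

lemma norm_exp_diff_le:
  fixes x y :: "'r::{real_normed_algebra_1,banach}"
  assumes "norm x \<le> r" "norm y \<le> r"
  shows "norm (exp x - exp y - (x - y)) \<le> (exp r - 1) * norm (x - y)"
    and "norm (exp x - exp y) \<le> exp r * norm (x - y)"
proof -
  define f where "f n = (x ^ n - y ^ n) /\<^sub>R fact n" for n
  have "f sums (exp x - exp y)"
    using sums_diff[OF exp_converges exp_converges, of x y] by (simp add: f_def[abs_def] scaleR_diff_right)
  \<comment> \<open>The terms of index 0 and 1 contribute 0 and \<open>x - y\<close>.\<close>
  then have f: "(\<lambda>n. f (n + 2)) sums (exp x - exp y - (x - y))"
    by (subst sums_iff_shift) (simp add: f_def lessThan_Suc numeral_2_eq_2)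
  have "(\<lambda>n. r ^ n /\<^sub>R fact n) sums exp r" by (rule exp_converges)
  then have "(\<lambda>n. r ^ (n + 1) /\<^sub>R fact (n + 1)) sums (exp r - 1)"
    by (subst sums_iff_shift) simp
  then have g: "(\<lambda>n. (r ^ (n + 1) / fact (n + 1)) * norm (x - y)) sums ((exp r - 1) * norm (x - y))"
    by (intro sums_mult2) (simp add: divide_inverse mult.commute)
  have fg: "norm (f (n + 2)) \<le> (r ^ (n + 1) / fact (n + 1)) * norm (x - y)" for n
  proof -
    have "norm (f (n + 2)) = norm (x ^ (n + 2) - y ^ (n + 2)) / fact (n + 2)"
      by (simp add: f_def divide_inverse)
    also have "\<dots> \<le> (real (n + 2) * r ^ (n + 1) * norm (x - y)) / fact (n + 2)"
      using norm_power_diff_le[OF assms, of "n + 2"] by (intro divide_right_mono) auto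
    also have "(fact (n + 2) :: real) = real (n + 2) * fact (n + 1)" by simp
    also have "(real (n + 2) * r ^ (n + 1) * norm (x - y)) / (real (n + 2) * fact (n + 1)) =
        (r ^ (n + 1) / fact (n + 1)) * norm (x - y)"
      by (simp only: mult.assoc) (subst mult_divide_mult_cancel_left, auto)
    finally show ?thesis .
  qed
  show *: "norm (exp x - exp y - (x - y)) \<le> (exp r - 1) * norm (x - y)"
    using norm_suminf_le[OF fg sums_summable[OF g]] sums_unique[OF f] sums_unique[OF g] by metis
  show "norm (exp x - exp y) \<le> exp r * norm (x - y)"
    using norm_triangle_ineq[of "exp x - exp y - (x - y)" "x - y"] * by (simp add: algebra_simps)
qed

lemma continuous_on_exp_banach:
  fixes f :: "'t::topological_space \<Rightarrow> 'r::{real_normed_algebra_1,banach}"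
  assumes "continuous_on A f"
  shows "continuous_on A (\<lambda>x. exp (f x))"
proof -
  have "isCont exp x" for x :: 'r
    unfolding isCont_def
  proof (rule LIM_zero_cancel, rule Lim_null_comparison)
    have "\<forall>\<^sub>F y in at x. y \<in> ball x 1" by (intro eventually_at_in_open') auto
    then show "\<forall>\<^sub>F y in at x. norm (exp y - exp x) \<le> exp (norm x + 1) * norm (y - x)"
    proof eventually_elim
      case (elim y)
      then have "norm y \<le> norm x + 1"
        using norm_triangle_ineq[of x "y - x"] by (simp add: dist_norm norm_minus_commute)
      then show ?case by (intro norm_exp_diff_le(2)) auto
    qed
    show "((\<lambda>y. exp (norm x + 1) * norm (y - x)) \<longlongrightarrow> 0) (at x)"
      by (rule tendsto_eq_intros | rule refl | simp)+
  qed
  then have "continuous_on UNIV (exp :: 'r \<Rightarrow> 'r)" by (simp add: continuous_on_eq_continuous_at)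
  then show ?thesis using continuous_on_compose2[OF _ assms] by blast
qed

text \<open>The linear part of a product of two exponentials is the sum of the exponents. The error
  is Lipschitz with a constant that tends to 0 with \<open>r\<close>, which makes the chart
  \<open>F\<close> of the next theorem injective near 0.\<close>

lemma norm_exp_mult_exp_diff_le:
  fixes a a' b b' :: "'r::{real_normed_algebra_1,banach}"
  assumes "norm a \<le> r" "norm a' \<le> r" "norm b \<le> r" "norm b' \<le> r"
    and "norm (a - a') \<le> d" "norm (b - b') \<le> d"
  shows "norm (exp a * exp b - exp a' * exp b' - ((a - a') + (b - b')))
    \<le> (2 * exp r * (exp r - 1) + 2 * exp r * r) * d"
proof -
  have r: "r \<ge> 0" and d: "d \<ge> 0" using assms(1,5) norm_ge_zero order_trans by blast+
  have e1: "norm (exp z - 1) \<le> exp r * r" if "norm z \<le> r" for z :: 'r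
    using order_trans[OF norm_exp_diff_le(2)[of z r 0] mult_left_mono[of "norm (z - 0)" r "exp r"]]
      that r by simp
  have e2: "norm (exp z) \<le> exp r" if "norm z \<le> r" for z :: 'r
    using norm_exp[of z] that by (meson exp_le_cancel_iff order_trans)
  have "exp a * exp b - exp a' * exp b' - ((a - a') + (b - b')) =
      (exp a - exp a' - (a - a')) * exp b + exp a' * (exp b - exp b' - (b - b')) +
      ((a - a') * (exp b - 1) + (exp a' - 1) * (b - b'))"
    by (simp add: algebra_simps)
  also have "norm \<dots> \<le> (norm (exp a - exp a' - (a - a')) * norm (exp b) +
      norm (exp a') * norm (exp b - exp b' - (b - b'))) +
      (norm (a - a') * norm (exp b - 1) + norm (exp a' - 1) * norm (b - b'))"
    by (intro norm_triangle_le add_mono norm_mult_ineq)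
  also have "\<dots> \<le> (((exp r - 1) * d) * exp r + exp r * ((exp r - 1) * d)) + (d * (exp r * r) + (exp r * r) * d)"
    using assms r d e1 e2
    by (intro add_mono mult_mono order.trans[OF norm_exp_diff_le(1) mult_left_mono]) auto
  also have "\<dots> = (2 * exp r * (exp r - 1) + 2 * exp r * r) * d" by (simp add: algebra_simps)
  finally show ?thesis .
qed

lemma orthogonal_projection_exists:
  fixes K :: "'e::euclidean_space set"
  assumes "subspace K"
  obtains P where "linear P" "\<And>x. P x \<in> K" "\<And>x k. k \<in> K \<Longrightarrow> k \<bullet> (x - P x) = 0"
proof -
  obtain B where B: "B \<subseteq> K" "pairwise orthogonal B" "\<And>b. b \<in> B \<Longrightarrow> norm b = 1" "independent B" "span B = K"
    using orthonormal_basis_subspace[OF assms] by metis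
  then have fin: "finite B" by (simp add: independent_imp_finite)
  define P where "P x = (\<Sum>b\<in>B. (x \<bullet> b) *\<^sub>R b)" for x
  have "linear P"
    by (rule linearI) (simp_all add: P_def inner_left_distrib scaleR_add_left sum.distrib scaleR_sum_right)
  moreover have "P x \<in> K" for x
    unfolding P_def using B(1) assms by (intro subspace_sum subspace_scale) auto
  moreover have "k \<bullet> (x - P x) = 0" if "k \<in> K" for x k
  proof -
    have *: "b \<bullet> (x - P x) = 0" if b: "b \<in> B" for b
    proof -
      have "b \<bullet> P x = (\<Sum>b'\<in>B. (x \<bullet> b') * (b \<bullet> b'))" by (simp add: P_def inner_sum_right)
      also have "\<dots> = (\<Sum>b'\<in>B. if b' = b then x \<bullet> b else 0)"
        using B(2,3) b by (intro sum.cong) (auto simp: pairwise_def orthogonal_def norm_eq_1)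
      finally show ?thesis using b fin by (simp add: inner_diff_right inner_commute)
    qed
    have "k \<in> span B" using that B(5) by simp
    then show ?thesis
      by (induction rule: span_induct_alt) (simp_all add: inner_left_distrib *)
  qed
  ultimately show ?thesis using that by blast
qed

text \<open>Von Neumann's argument for closed linear groups. Closedness is used through
  \<open>tangent\<close>: limiting directions of approach to 1 inside \<open>G\<close> lie in
  \<open>K\<close>. Near 1 the group then has no component along a complement of \<open>K\<close>,
  so \<open>exp\<close> restricted to \<open>K\<close> is a chart at 1, and left translation carries
  it to every point.\<close>

lemma locally_Euclidean_closed_subgroup:
  fixes c :: "'r::{real_normed_algebra_1,banach} \<Rightarrow> 'e::euclidean_space" and G K :: "'r set"
  assumes c: "euclidean_iso c"
    and one: "1 \<in> G" and mult: "\<And>x y. x \<in> G \<Longrightarrow> y \<in> G \<Longrightarrow> x * y \<in> G"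
    and inverse: "\<And>x. x \<in> G \<Longrightarrow> \<exists>y\<in>G. y * x = 1 \<and> x * y = 1"
    and K: "subspace K" and exp: "\<And>x. x \<in> K \<Longrightarrow> exp x \<in> G"
    and tangent: "\<And>m t v. \<lbrakk>m \<longlonglongrightarrow> 0; \<And>n. exp (m n) \<in> G; (\<lambda>n. t n *\<^sub>R m n) \<longlonglongrightarrow> v\<rbrakk> \<Longrightarrow> v \<in> K"
  shows "locally_Euclidean (dim K) G"
proof -
  note cl = euclidean_isoD(1)[OF c] euclidean_isoD(7)[OF c]
  note ccont = euclidean_isoD(3,4)[OF c]
  note cinv = euclidean_isoD(5,6)[OF c]
  let ?i = "inv_into UNIV c"
  have "subspace (c ` K)" using cl(1) K by (rule linear_subspace_image)
  then obtain P where P: "linear P" "\<And>x. P x \<in> c ` K" "\<And>x k. k \<in> c ` K \<Longrightarrow> k \<bullet> (x - P x) = 0"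
    using orthogonal_projection_exists by metis
  define p where "p x = ?i (P (c x))" for x
  define q where "q x = x - p x" for x
  have pK: "p x \<in> K" for x using P(2)[of "c x"] cinv(1) by (auto simp: p_def)
  have "bounded_linear (?i \<circ> P \<circ> c)"
    using c P(1) by (auto simp: euclidean_iso_def o_def linear_conv_bounded_linear intro!: bounded_linear_compose[of ?i] bounded_linear_compose[of P])
  then have p: "bounded_linear p" by (simp add: p_def[abs_def] o_def)
  then have q: "bounded_linear q" unfolding q_def[abs_def] by (intro bounded_linear_sub bounded_linear_ident)
  obtain C1 where C1: "\<And>x. norm (p x) \<le> norm x * C1" using bounded_linear.bounded[OF p] by blast
  obtain C2 where C2: "\<And>x. norm (q x) \<le> norm x * C2" using bounded_linear.bounded[OF q] by blast
  define C where "C = max 1 (max C1 C2)"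
  have C: "norm (p x) \<le> C * norm x" "norm (q x) \<le> C * norm x" "C > 0" for x
  proof -
    show "norm (p x) \<le> C * norm x"
      using order_trans[OF C1[of x] mult_left_mono[of C1 C "norm x"]] by (simp add: C_def mult.commute)
    show "norm (q x) \<le> C * norm x"
      using order_trans[OF C2[of x] mult_left_mono[of C2 C "norm x"]] by (simp add: C_def mult.commute)
  qed (simp add: C_def)
  \<comment> \<open>With the exponential written as a product, the factor from \<open>K\<close> can
    be cancelled inside \<open>G\<close>, which leaves \<open>exp (q x)\<close> in
    \<open>G\<close>.\<close>
  define F where "F x = exp (p x) * exp (q x)" for x
  \<comment> \<open>This expression bounds the Lipschitz constant of \<open>F\<close> minus the
    identity; once it is below 1/2, \<open>F\<close> is injective.\<close>
  have "((\<lambda>r. (2 * exp r * (exp r - 1) + 2 * exp r * r) * C) \<longlongrightarrow> (2 * exp 0 * (exp 0 - 1) + 2 * exp 0 * 0) * C) (at_right (0::real))"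
    by (intro tendsto_intros)
  then have "eventually (\<lambda>r. (2 * exp r * (exp r - 1) + 2 * exp r * r) * C < 1/2) (at_right (0::real))"
    by (rule order_tendstoD(2)) simp
  then obtain r where r: "r > 0" "(2 * exp r * (exp r - 1) + 2 * exp r * r) * C < 1/2"
    by (metis (mono_tags, lifting) eventually_at_right_field dense)
  define \<rho> where "\<rho> = r / C"
  have \<rho>: "\<rho> > 0" using r C(3) by (simp add: \<rho>_def)
  have small: "norm (p x) \<le> r" "norm (q x) \<le> r" if "x \<in> ball 0 \<rho>" for x
  proof -
    have "C * norm x \<le> r" using that C(3) by (simp add: \<rho>_def field_simps)
    then show "norm (p x) \<le> r" "norm (q x) \<le> r" using C(1,2)[of x] by auto
  qed
  have injF: "inj_on F (ball 0 \<rho>)"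
  proof (rule inj_onI)
    fix x y assume xy: "x \<in> ball 0 \<rho>" "y \<in> ball 0 \<rho>" "F x = F y"
    have d: "p x - p y = p (x - y)" "q x - q y = q (x - y)"
      using p q by (simp_all add: bounded_linear.linear linear_diff)
    have "norm (F x - F y - ((p x - p y) + (q x - q y)))
        \<le> (2 * exp r * (exp r - 1) + 2 * exp r * r) * (C * norm (x - y))"
      unfolding F_def using small xy(1,2) C(1,2)[of "x - y"]
      by (intro norm_exp_mult_exp_diff_le) (auto simp: d)
    moreover have "(p x - p y) + (q x - q y) = x - y" by (simp add: q_def)
    ultimately have "norm (x - y) \<le> ((2 * exp r * (exp r - 1) + 2 * exp r * r) * C) * norm (x - y)"
      using xy(3) by (simp add: norm_minus_commute mult.assoc)
    also have "\<dots> \<le> (1/2) * norm (x - y)" using r(2) by (intro mult_right_mono) auto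
    finally show "x = y" by simp
  qed
  have contF: "continuous_on A F" for A
    unfolding F_def by (intro continuous_on_mult continuous_on_exp_banach continuous_on_id bounded_linear.continuous_on[OF p] bounded_linear.continuous_on[OF q])
  define \<Psi> where "\<Psi> = c \<circ> F \<circ> ?i"
  have op_c: "open (c ` A)" if "open A" for A
  proof -
    have "c ` A = ?i -` A" by (auto simp: cinv) (metis cinv(2) image_eqI)
    then show ?thesis using ccont(2)[of UNIV] that by (simp add: open_vimage)
  qed
  have \<Psi>c: "continuous_on B \<Psi>" for B
    unfolding \<Psi>_def by (intro continuous_on_compose ccont contF)
  have \<Psi>i: "inj_on \<Psi> (c ` ball 0 \<rho>)"
    unfolding \<Psi>_def
    by (auto intro!: inj_onI dest!: inj_onD[OF euclidean_isoD(2)[OF c]] inj_onD[OF injF] simp: cinv)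
  \<comment> \<open>Invariance of domain, applied to \<open>F\<close> in the coordinates
    \<open>c\<close>, turns injectivity into openness.\<close>
  have openF: "open (F ` A)" if "open A" "A \<subseteq> ball 0 \<rho>" for A
  proof -
    have "open (\<Psi> ` c ` A)"
      using invariance_of_domain[OF \<Psi>c op_c[OF that(1)]] \<Psi>i that(2) by (meson image_mono inj_on_subset)
    then have "open (c -` \<Psi> ` c ` A)" using ccont(1)[of UNIV] by (simp add: open_vimage)
    moreover have "\<Psi> ` c ` A = c ` F ` A" by (simp add: \<Psi>_def image_image cinv)
    then have "c -` \<Psi> ` c ` A = F ` A" by (simp add: inj_vimage_image_eq[OF euclidean_isoD(2)[OF c]])
    ultimately show ?thesis by simp
  qed
  \<comment> \<open>Otherwise there are points tending to 0 with nonzero complementary parts whose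
    exponentials lie in \<open>G\<close>. Normalised in the coordinates \<open>c\<close>, these
    parts accumulate at a unit vector that belongs to the image of \<open>K\<close> by
    \<open>tangent\<close> and is orthogonal to it.\<close>
  have "\<exists>\<sigma>>0. \<forall>x\<in>ball 0 \<sigma>. F x \<in> G \<longrightarrow> q x = 0"
  proof (rule ccontr)
    assume "\<not> ?thesis"
    then have "\<forall>n. \<exists>x. x \<in> ball 0 (1 / real (Suc n)) \<and> F x \<in> G \<and> q x \<noteq> 0"
      by (metis of_nat_0_less_iff zero_less_Suc zero_less_divide_1_iff)
    then obtain x where x: "\<And>n. x n \<in> ball 0 (1 / real (Suc n))" "\<And>n. F (x n) \<in> G" "\<And>n. q (x n) \<noteq> 0"
      by metis
    have "x \<longlonglongrightarrow> 0"
      using x(1) by (intro tendsto_norm_zero_cancel[OF Lim_null_comparison[OF _ LIMSEQ_inverse_real_of_nat]])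
        (auto simp: inverse_eq_divide less_imp_le intro!: always_eventually)
    then have q0: "(\<lambda>n. q (x n)) \<longlonglongrightarrow> 0"
      using bounded_linear.tendsto_zero[OF q] by blast
    have qG: "exp (q (x n)) \<in> G" for n
    proof -
      have "- p (x n) \<in> K" using pK K by (rule subspace_neg[rotated])
      then have "exp (- p (x n)) * F (x n) \<in> G" using exp mult x(2) by blast
      then show ?thesis by (simp add: F_def mult.assoc[symmetric] exp_minus_inverse[of "- p (x n)", simplified])
    qed
    define t where "t n = 1 / norm (c (q (x n)))" for n
    define u where "u n = t n *\<^sub>R c (q (x n))" for n
    have cq: "c (q (x n)) \<noteq> 0" for n using x(3)[of n] cinv(1)[of "q (x n)"] cinv(1)[of 0] linear_0[OF cl(1)] by metis
    have "u n \<in> sphere 0 1" for n using cq by (simp add: u_def t_def)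
    then obtain l s where l: "l \<in> sphere 0 1" "strict_mono s" "(u \<circ> s) \<longlonglongrightarrow> l"
      using compact_sphere unfolding compact_def by blast
    have "isCont ?i l" using ccont(2)[of UNIV] by (simp add: continuous_on_eq_continuous_at)
    then have "(\<lambda>n. ?i ((u \<circ> s) n)) \<longlonglongrightarrow> ?i l" using l(3) isCont_tendsto_compose by blast
    moreover have "?i ((u \<circ> s) n) = t (s n) *\<^sub>R q (x (s n))" for n
      by (simp add: u_def linear_scale[OF cl(2)] cinv(1))
    ultimately have lim: "(\<lambda>n. t (s n) *\<^sub>R q (x (s n))) \<longlonglongrightarrow> ?i l" by simp
    have "(\<lambda>n. q (x (s n))) \<longlonglongrightarrow> 0" using LIMSEQ_subseq_LIMSEQ[OF q0 l(2)] by (simp add: o_def)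
    then have "?i l \<in> K" using lim qG tangent[of "\<lambda>n. q (x (s n))" "t \<circ> s"] by simp
    then have lK: "l \<in> c ` K" using cinv(2) by (metis image_eqI)
    have "l \<bullet> u n = 0" for n
    proof -
      have "c (q (x n)) = c (x n) - P (c (x n))" by (simp add: q_def p_def linear_diff[OF cl(1)] cinv(2))
      then show ?thesis using P(3)[OF lK] by (simp add: u_def)
    qed
    moreover have "(\<lambda>n. l \<bullet> (u \<circ> s) n) \<longlonglongrightarrow> l \<bullet> l" using l(3) by (intro tendsto_intros)
    ultimately have "l \<bullet> l = 0" by (simp add: LIMSEQ_const_iff)
    then show False using l(1) by simp
  qed
  then obtain \<sigma>' where \<sigma>': "\<sigma>' > 0" "\<forall>x\<in>ball 0 \<sigma>'. F x \<in> G \<longrightarrow> q x = 0" by blast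
  define \<sigma> where "\<sigma> = min \<sigma>' \<rho>"
  have \<sigma>: "\<sigma> > 0" "ball 0 \<sigma> \<subseteq> ball (0::'r) \<rho>" "\<And>x. x \<in> ball 0 \<sigma> \<Longrightarrow> F x \<in> G \<Longrightarrow> q x = 0"
    using \<sigma>' \<rho> by (auto simp: \<sigma>_def)
  define B where "B = K \<inter> ball 0 \<sigma>"
  have qK: "q x = 0" if "x \<in> K" for x
  proof -
    have "c (q x) \<in> c ` K" using that pK K by (auto simp: q_def intro: subspace_diff)
    moreover have "c (q x) = c x - P (c x)" by (simp add: q_def p_def linear_diff[OF cl(1)] cinv(2))
    ultimately have "c (q x) = 0" using P(3) by (metis inner_eq_zero_iff)
    then show ?thesis using cinv(1) linear_0[OF cl(1)] by metis
  qed
  have FK: "F x = exp x" if "x \<in> K" for x using qK[OF that] by (simp add: F_def q_def)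
  have FB: "F ` B = G \<inter> F ` ball 0 \<sigma>"
  proof
    have "F x \<in> G" if "x \<in> B" for x using that FK exp by (auto simp: B_def)
    then show "F ` B \<subseteq> G \<inter> F ` ball 0 \<sigma>" by (auto simp: B_def)
    show "G \<inter> F ` ball 0 \<sigma> \<subseteq> F ` B"
    proof
      fix y assume "y \<in> G \<inter> F ` ball 0 \<sigma>"
      then obtain x where x: "x \<in> ball 0 \<sigma>" "F x \<in> G" "y = F x" by blast
      then have "x = p x" using \<sigma>(3) by (simp add: q_def)
      then show "y \<in> F ` B" using x pK by (metis B_def IntI image_eqI)
    qed
  qed
  have injB: "inj_on F (ball 0 \<sigma>)" using injF \<sigma>(2) inj_on_subset by blast
  obtain g where hom: "homeomorphism (ball 0 \<sigma>) (F ` ball 0 \<sigma>) F g"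
  proof -
    have "homeomorphism (ball 0 \<sigma>) (F ` ball 0 \<sigma>) F (inv_into (ball 0 \<sigma>) F)"
    proof (rule homeomorphismI)
      show "continuous_on (F ` ball 0 \<sigma>) (inv_into (ball 0 \<sigma>) F)"
      proof (rule continuous_on_open_invariant[THEN iffD2], intro allI impI)
        fix A :: "'r set" assume A: "open A"
        have "open (F ` (A \<inter> ball 0 \<sigma>))" using openF A \<sigma>(2) by blast
        moreover have "F ` (A \<inter> ball 0 \<sigma>) \<inter> F ` ball 0 \<sigma> = inv_into (ball 0 \<sigma>) F -` A \<inter> F ` ball 0 \<sigma>"
          using injB by (auto simp: inv_into_f_f dest: inj_onD[OF injB])
        ultimately show "\<exists>A'. open A' \<and> A' \<inter> F ` ball 0 \<sigma> = inv_into (ball 0 \<sigma>) F -` A \<inter> F ` ball 0 \<sigma>"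
          by blast
      qed
    qed (use injB contF in \<open>auto simp: inv_into_f_f\<close>)
    then show thesis using that by blast
  qed
  have homB: "homeomorphism B (F ` B) F g"
    by (rule homeomorphism_of_subsets[OF hom]) (auto simp: B_def)
  have openB: "openin (top_of_set G) (F ` B)"
    unfolding FB using openF[OF open_ball \<sigma>(2)] by (rule openin_open_Int)
  have "openin (top_of_set K) B" unfolding B_def by (simp add: openin_open_Int)
  then have "locally_Euclidean (dim K) B" using locally_Euclidean_openin_subspace[OF c K] by blast
  moreover have "0 \<in> B" using K \<sigma>(1) by (simp add: B_def subspace_0)
  ultimately obtain U where U: "openin (top_of_set B) U" "0 \<in> U"
    "top_of_set U homeomorphic_space Euclidean_space (dim K)"
    unfolding locally_Euclidean_def by blast
  have "openin (top_of_set (F ` B)) (F ` U)"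
    using homeomorphism_imp_open_map[OF homB U(1)] .
  then have opU: "openin (top_of_set G) (F ` U)" using openB openin_trans by blast
  have UB: "U \<subseteq> B" using U(1) openin_imp_subset by blast
  have "homeomorphism U (F ` U) F g"
    by (rule homeomorphism_of_subsets[OF homB UB]) (use UB in auto)
  then have FU: "F ` U homeomorphic U" by (auto simp: homeomorphic_def intro: homeomorphism_symD)
  have "F 0 = 1" using FK[of 0] K by (simp add: subspace_0)
  then have oneU: "1 \<in> F ` U" using U(2) by (metis image_eqI)
  show ?thesis
    unfolding locally_Euclidean_def
  proof
    fix x assume x: "x \<in> G"
    obtain y where y: "y \<in> G" "y * x = 1" "x * y = 1" using inverse x by blast
    have yx: "y * (x * z) = z" "x * (y * z) = z" for z using y by (simp_all add: mult.assoc[symmetric])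
    have GG: "homeomorphism G G ((*) x) ((*) y)"
      by (rule homeomorphismI) (use x y mult in \<open>auto intro!: continuous_intros simp: yx\<close>)
    have op: "openin (top_of_set G) ((*) x ` F ` U)"
      using homeomorphism_imp_open_map[OF GG opU] .
    have "homeomorphism (F ` U) ((*) x ` F ` U) ((*) x) ((*) y)"
      by (rule homeomorphism_of_subsets[OF GG openin_imp_subset[OF opU]])
        (use openin_imp_subset[OF op] in auto)
    then have "(*) x ` F ` U homeomorphic U"
      using FU by (meson homeomorphic_def homeomorphic_sym homeomorphic_trans)
    then have "top_of_set ((*) x ` F ` U) homeomorphic_space Euclidean_space (dim K)"
      using U(3) homeomorphic_space_trans by (metis homeomorphic_space_iff_homeomorphic)
    moreover have "x \<in> (*) x ` F ` U" using oneU by (metis image_eqI mult.right_neutral)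
    ultimately show "\<exists>U. openin (top_of_set G) U \<and> x \<in> U \<and> top_of_set U homeomorphic_space Euclidean_space (dim K)"
      using op by blast
  qed
qed

section \<open>Automorphism groups\<close>

text \<open>A copy of the bounded endomorphisms that is a Banach algebra, so that \<open>exp\<close> is available.\<close>

typedef (overloaded) 'a endo = "UNIV :: ('a::euclidean_space \<Rightarrow>\<^sub>L 'a) set"
  morphisms endo_map Endo ..

lemmas endo_simps [simp] = Endo_inverse[OF UNIV_I] endo_map_inverse

lemma endo_eqI: "endo_map f = endo_map g \<Longrightarrow> f = g"
  by (simp add: endo_map_inject)

instantiation endo :: (euclidean_space) real_normed_algebra_1
begin

definition "0 = Endo 0"
definition "1 = Endo id_blinfun"
definition "f + g = Endo (endo_map f + endo_map g)"
definition "f - g = Endo (endo_map f - endo_map g)"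
definition "- f = Endo (- endo_map f)"
definition "f * g = Endo (endo_map f o\<^sub>L endo_map g)"
definition "a *\<^sub>R f = Endo (a *\<^sub>R endo_map f)"
definition "norm f = norm (endo_map f)"
definition "dist f g = norm (endo_map f - endo_map g)"
definition "sgn f = Endo (sgn (endo_map f))"
definition [code del]: "(uniformity :: ('a endo \<times> 'a endo) filter) = (INF e\<in>{0<..}. principal {(x, y). dist x y < e})"
definition [code del]: "open (U :: 'a endo set) \<longleftrightarrow> (\<forall>x\<in>U. eventually (\<lambda>(x', y). x' = x \<longrightarrow> y \<in> U) uniformity)"

lemmas endo_defs = zero_endo_def one_endo_def plus_endo_def minus_endo_def uminus_endo_def
  times_endo_def scaleR_endo_def norm_endo_def dist_endo_def sgn_endo_def

instance
proof
  fix f g h :: "'a endo" and a b :: real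
  show "dist f g = norm (f - g)" by (simp add: endo_defs)
  show "norm f = 0 \<longleftrightarrow> f = 0" by (metis endo_defs(1,8) endo_map_inverse endo_simps(1) norm_eq_zero)
  show "f * g * h = f * (g * h)" by (auto simp: endo_defs intro!: arg_cong[where f = Endo] blinfun_eqI)
  show "(0 :: 'a endo) \<noteq> 1"
    using norm_blinfun_id[where 'a = 'a] by (auto simp: endo_defs Endo_inject dest: arg_cong[where f = norm])
qed (auto simp: endo_defs algebra_simps sgn_div_norm norm_triangle_ineq norm_blinfun_compose
    uniformity_endo_def open_endo_def blinfun.bilinear_simps intro!: endo_eqI blinfun_eqI)

end

lemma bounded_linear_endo_map: "bounded_linear (endo_map :: 'a::euclidean_space endo \<Rightarrow> _)"
  by (rule bounded_linear_intro[where K = 1]) (simp_all add: endo_defs)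

lemma bounded_linear_Endo: "bounded_linear (Endo :: _ \<Rightarrow> 'a::euclidean_space endo)"
  by (rule bounded_linear_intro[where K = 1]) (simp_all add: endo_defs)

instance endo :: (euclidean_space) banach
proof
  fix X :: "nat \<Rightarrow> 'a endo" assume "Cauchy X"
  then have "Cauchy (\<lambda>n. endo_map (X n))" using bounded_linear.Cauchy[OF bounded_linear_endo_map] by blast
  then obtain l where "(\<lambda>n. endo_map (X n)) \<longlonglongrightarrow> l" by (metis Cauchy_convergent convergent_def)
  then have "X \<longlonglongrightarrow> Endo l" using bounded_linear.tendsto[OF bounded_linear_Endo] by fastforce
  then show "convergent X" by (auto simp: convergent_def)
qed

lemma endo_map_simps [simp]:
  "endo_map 0 = 0" "endo_map 1 = id_blinfun" "endo_map (f + g) = endo_map f + endo_map g"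
  "endo_map (f - g) = endo_map f - endo_map g" "endo_map (- f) = - endo_map f"
  "endo_map (f * g) = endo_map f o\<^sub>L endo_map g" "endo_map (a *\<^sub>R f) = a *\<^sub>R endo_map f"
  by (simp_all add: endo_defs)

lemma euclidean_iso_endo_map:
  assumes "euclidean_iso c"
  shows "euclidean_iso (\<lambda>f. c (endo_map f))"
proof -
  have "inv_into UNIV (\<lambda>f. c (endo_map f)) = Endo \<circ> inv_into UNIV c"
    by (rule inv_equality) (simp_all add: euclidean_isoD[OF assms])
  moreover have "bij (\<lambda>f. c (endo_map f))"
    by (rule o_bij[where g = "Endo \<circ> inv_into UNIV c"]) (simp_all add: fun_eq_iff euclidean_isoD[OF assms])
  ultimately show ?thesis
    using assms bounded_linear_compose[OF _ bounded_linear_endo_map, of c]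
      bounded_linear_compose[OF bounded_linear_Endo, of "inv_into UNIV c"]
    by (simp add: euclidean_iso_def o_def)
qed

lemma locally_Euclidean_homeomorphic:
  assumes "locally_Euclidean n S" "homeomorphism S T f g"
  shows "locally_Euclidean n T"
  unfolding locally_Euclidean_def
proof
  fix y assume "y \<in> T"
  then have "g y \<in> S" "f (g y) = y" using assms(2) by (auto simp: homeomorphism_def)
  then obtain U where U: "openin (top_of_set S) U" "g y \<in> U" "top_of_set U homeomorphic_space Euclidean_space n"
    using assms(1) unfolding locally_Euclidean_def by blast
  have "homeomorphism U (f ` U) f g"
    by (rule homeomorphism_of_subsets[OF assms(2) openin_imp_subset[OF U(1)]])
      (use openin_imp_subset[OF U(1)] assms(2) in \<open>auto simp: homeomorphism_def\<close>)
  then have "top_of_set (f ` U) homeomorphic_space Euclidean_space n"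
    using U(3) by (metis homeomorphic_def homeomorphic_space_iff_homeomorphic homeomorphic_space_sym homeomorphic_space_trans)
  then show "\<exists>U. openin (top_of_set T) U \<and> y \<in> U \<and> top_of_set U homeomorphic_space Euclidean_space n"
    using homeomorphism_imp_open_map[OF assms(2) U(1)] U(2) \<open>f (g y) = y\<close> by (metis image_eqI)
qed

section \<open>The Lie algebras of the automorphism group and of the stabilizers\<close>

definition derivations :: "('a::euclidean_space \<Rightarrow> 'a \<Rightarrow> 'a) \<Rightarrow> ('a \<Rightarrow>\<^sub>L 'a) set" where
  "derivations br = {D :: 'a \<Rightarrow>\<^sub>L 'a. \<forall>x y. D (br x y) = br (D x) y + br x (D y)}"

text \<open>The Lie algebra of the stabilizer of \<open>\<phi>\<close> in the general linear group;
  for a G2-structure it is a copy of the 14-dimensional algebra g2.\<close>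

definition annihilator3 :: "'a::euclidean_space trilin \<Rightarrow> ('a \<Rightarrow>\<^sub>L 'a) set" where
  "annihilator3 \<phi> = {D :: 'a \<Rightarrow>\<^sub>L 'a. \<forall>x y z. \<phi> (D x) y z + \<phi> x (D y) z + \<phi> x y (D z) = 0}"

lemma subspace_derivations:
  assumes "bilinear br"
  shows "subspace (derivations br)"
  unfolding subspace_def derivations_def
  by (auto simp: blinfun.bilinear_simps bilinear_ladd[OF assms] bilinear_radd[OF assms]
      bilinear_lmul[OF assms] bilinear_rmul[OF assms] bilinear_lzero[OF assms] bilinear_rzero[OF assms]
      scaleR_add_right)

lemma subspace_annihilator3: "subspace (annihilator3 \<phi>)"
proof (rule subspaceI)
  show "0 \<in> annihilator3 \<phi>" by (simp add: annihilator3_def blinfun.bilinear_simps)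
next
  fix D E assume DE: "D \<in> annihilator3 \<phi>" "E \<in> annihilator3 \<phi>"
  show "D + E \<in> annihilator3 \<phi>"
    unfolding annihilator3_def
  proof (clarsimp simp: blinfun.bilinear_simps)
    fix x y z
    have "\<phi> (D x) y z + \<phi> x (D y) z + \<phi> x y (D z) = 0" "\<phi> (E x) y z + \<phi> x (E y) z + \<phi> x y (E z) = 0"
      using DE by (auto simp: annihilator3_def)
    then show "\<phi> (D x) y z + \<phi> (E x) y z + (\<phi> x (D y) z + \<phi> x (E y) z) + (\<phi> x y (D z) + \<phi> x y (E z)) = 0"
      by linarith
  qed
next
  fix a D assume D: "D \<in> annihilator3 \<phi>"
  show "a *\<^sub>R D \<in> annihilator3 \<phi>"
    unfolding annihilator3_def
  proof (clarsimp simp: blinfun.bilinear_simps)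
    fix x y z
    have "\<phi> (D x) y z + \<phi> x (D y) z + \<phi> x y (D z) = 0" using D by (auto simp: annihilator3_def)
    then have "a * (\<phi> (D x) y z + \<phi> x (D y) z + \<phi> x y (D z)) = 0" by simp
    then show "a * \<phi> (D x) y z + a * \<phi> x (D y) z + a * \<phi> x y (D z) = 0"
      by (simp only: distrib_left)
  qed
qed

text \<open>Along the flow of \<open>D\<close> both structures are transported unchanged: the
  functions \<open>f\<close> below have derivative zero by the derivation and the annihilation
  identity, and comparing times 0 and 1 gives the claim.\<close>

lemma exp_derivation:
  fixes D :: "'a::euclidean_space endo"
  assumes br: "bilinear br" and D: "endo_map D \<in> derivations br \<inter> annihilator3 \<phi>"
  shows "endo_map (exp D) \<in> stabilizer br \<phi>"
proof -
  have bb: "bounded_bilinear br" using br by (simp add: bilinear_conv_bounded_bilinear)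
  have DD: "endo_map D (br x y) = br (endo_map D x) y + br x (endo_map D y)"
    "\<phi> (endo_map D x) y z + \<phi> x (endo_map D y) z + \<phi> x y (endo_map D z) = 0" for x y z
    using D by (auto simp: derivations_def annihilator3_def)
  define u where "u x t = endo_map (exp (t *\<^sub>R D)) x" for x t
  have ev: "bounded_linear (\<lambda>E. endo_map E x)" for x :: 'a
    using bounded_linear_compose[OF blinfun.bounded_linear_left bounded_linear_endo_map] .
  have u: "(u x has_vector_derivative endo_map D (u x t)) (at t)" for x t
    using bounded_linear.has_vector_derivative[OF ev exp_scaleR_has_vector_derivative_left[of D t], of x]
    by (simp add: u_def[abs_def])
  have u0: "u x 0 = x" for x by (simp add: u_def)
  have const: "f 1 = f 0" if z: "\<And>t. (f has_vector_derivative 0) (at t)" for f :: "real \<Rightarrow> 'z::real_normed_vector"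
  proof -
    obtain k where "\<And>x. f x = k"
      by (rule has_vector_derivative_zero_constant[of UNIV f]) (simp_all add: z)
    then show ?thesis by simp
  qed
  have "exp (- D) * exp D = 1" "exp D * exp (- D) = 1"
    using exp_minus_inverse[of D] exp_minus_inverse[of "- D"] by simp_all
  from this[THEN arg_cong[where f = "\<lambda>E. blinfun_apply (endo_map E)"]]
  have inv: "endo_map (exp (- D)) (endo_map (exp D) x) = x" "endo_map (exp D) (endo_map (exp (- D)) x) = x" for x
    by (auto simp: fun_eq_iff)
  have "endo_map (exp D) (br x y) = br (endo_map (exp D) x) (endo_map (exp D) y)" for x y
  proof -
    \<comment> \<open>Pulling the bracket of the moved vectors back by the inverse flow produces a
      constant function of time.\<close>
    define f where "f t = endo_map (exp (t *\<^sub>R (- D))) (br (u x t) (u y t))" for t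
    have "(f has_vector_derivative 0) (at t)" for t
    proof -
      have 1: "((\<lambda>t. br (u x t) (u y t)) has_vector_derivative br (u x t) (endo_map D (u y t)) + br (endo_map D (u x t)) (u y t)) (at t)"
        by (rule bounded_bilinear.has_vector_derivative[OF bb u u])
      have 2: "((\<lambda>t. endo_map (exp (t *\<^sub>R (- D)))) has_vector_derivative endo_map (exp (t *\<^sub>R (- D)) * - D)) (at t)"
        by (rule bounded_linear.has_vector_derivative[OF bounded_linear_endo_map exp_scaleR_has_vector_derivative_right])
      show ?thesis
        using blinfun.has_vector_derivative[OF 2 1]
        by (simp add: f_def[abs_def] blinfun.bilinear_simps DD(1))
    qed
    then have "f 1 = f 0" by (rule const)
    then have "endo_map (exp (- D)) (br (endo_map (exp D) x) (endo_map (exp D) y)) = br x y"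
      by (simp add: f_def u_def)
    then show ?thesis by (metis inv(2))
  qed
  moreover have "\<phi> (endo_map (exp D) x) (endo_map (exp D) y) (endo_map (exp D) z) = \<phi> x y z" for x y z
  proof -
    define f where "f t = \<phi> (u x t) (u y t) (u z t)" for t
    have "(f has_vector_derivative 0) (at t)" for t
    proof -
      have 1: "((\<lambda>t. \<phi> (u x t)) has_vector_derivative \<phi> (endo_map D (u x t))) (at t)"
        by (rule bounded_linear.has_vector_derivative[OF blinfun.bounded_linear_right u])
      show ?thesis
        using blinfun.has_vector_derivative[OF blinfun.has_vector_derivative[OF 1 u] u] DD(2)
        by (simp add: f_def[abs_def] blinfun.bilinear_simps algebra_simps)
    qed
    then have "f 1 = f 0" by (rule const)
    then show ?thesis by (simp add: f_def u_def)
  qed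
  moreover have "bij (blinfun_apply (endo_map (exp D)))"
    by (rule o_bij[where g = "blinfun_apply (endo_map (exp (- D)))"]) (simp_all add: fun_eq_iff inv)
  ultimately show ?thesis by (simp add: stabilizer_def Aut_def)
qed

text \<open>Since \<open>exp z - 1 - z\<close> is of smaller order than \<open>z\<close>, the
  rescaled logarithms and the rescaled differences from 1 have the same limit.\<close>

lemma exp_tangent_vector:
  fixes m :: "nat \<Rightarrow> 'r::{real_normed_algebra_1,banach}"
  assumes m: "m \<longlonglongrightarrow> 0" and t: "(\<lambda>n. t n *\<^sub>R m n) \<longlonglongrightarrow> v"
  shows "(\<lambda>n. t n *\<^sub>R (exp (m n) - 1)) \<longlonglongrightarrow> v" "(\<lambda>n. exp (m n)) \<longlonglongrightarrow> 1"
proof -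
  have nm: "(\<lambda>n. norm (m n)) \<longlonglongrightarrow> 0" using m tendsto_norm_zero by blast
  have e: "(\<lambda>n. exp (norm (m n)) - 1) \<longlonglongrightarrow> 0"
    using tendsto_diff[OF tendsto_exp[OF nm] tendsto_const[of 1]] by simp
  have le: "norm (exp (m n) - 1 - m n) \<le> (exp (norm (m n)) - 1) * norm (m n)" for n
    using norm_exp_diff_le(1)[of "m n" "norm (m n)" 0] by simp
  have lim: "(\<lambda>n. (exp (norm (m n)) - 1) * norm (t n *\<^sub>R m n)) \<longlonglongrightarrow> 0"
    using tendsto_mult[OF e tendsto_norm[OF t]] by simp
  have le': "norm (t n *\<^sub>R (exp (m n) - 1 - m n)) \<le> (exp (norm (m n)) - 1) * norm (t n *\<^sub>R m n)" for n
    using mult_left_mono[OF le[of n], of "\<bar>t n\<bar>"] by (simp add: mult.left_commute)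
  have "(\<lambda>n. t n *\<^sub>R (exp (m n) - 1 - m n)) \<longlonglongrightarrow> 0"
    by (rule Lim_null_comparison[OF always_eventually[OF allI[OF le']] lim])
  from tendsto_add[OF this t] show "(\<lambda>n. t n *\<^sub>R (exp (m n) - 1)) \<longlonglongrightarrow> v"
    by (simp flip: scaleR_add_right)
  have lim2: "(\<lambda>n. (exp (norm (m n)) - 1) * norm (m n)) \<longlonglongrightarrow> 0"
    using tendsto_mult[OF e nm] by simp
  have "(\<lambda>n. exp (m n) - 1 - m n) \<longlonglongrightarrow> 0"
    by (rule Lim_null_comparison[OF always_eventually[OF allI[OF le]] lim2])
  from tendsto_add[OF tendsto_add[OF this m] tendsto_const[of 1]] show "(\<lambda>n. exp (m n)) \<longlonglongrightarrow> 1"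
    by simp
qed

text \<open>A difference quotient at the identity. Telescoping gives exact Leibniz rules for
  \<open>E n\<close> in which some arguments are still moved by \<open>A n\<close>; in the limit
  these become the derivation and annihilation identities.\<close>

lemma stabilizer_tangent_vector:
  fixes A :: "nat \<Rightarrow> 'a::euclidean_space \<Rightarrow>\<^sub>L 'a"
  assumes br: "bilinear br" and A: "A \<longlonglongrightarrow> id_blinfun" "\<And>n. A n \<in> stabilizer br \<phi>"
    and v: "(\<lambda>n. t n *\<^sub>R (A n - id_blinfun)) \<longlonglongrightarrow> v"
  shows "v \<in> derivations br \<inter> annihilator3 \<phi>"
proof -
  interpret br: bounded_bilinear br using br by (simp add: bilinear_conv_bounded_bilinear)
  define E where "E n = t n *\<^sub>R (A n - id_blinfun)" for n
  have E: "(\<lambda>n. E n x) \<longlonglongrightarrow> v x" for x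
    using blinfun.tendsto[OF v tendsto_const] by (simp add: E_def)
  have A1: "(\<lambda>n. A n x) \<longlonglongrightarrow> x" for x
    using blinfun.tendsto[OF A(1) tendsto_const[of x]] by simp
  have Ex: "E n x = t n *\<^sub>R (A n x - x)" for n x by (simp add: E_def blinfun.bilinear_simps)
  have Ab: "A n (br x y) = br (A n x) (A n y)" "\<phi> (A n x) (A n y) (A n z) = \<phi> x y z" for n x y z
    using A(2)[of n] by (auto simp: stabilizer_def Aut_def)
  have "v (br x y) = br (v x) y + br x (v y)" for x y
  proof (rule LIMSEQ_unique[OF E])
    have "E n (br x y) = br (E n x) (A n y) + br x (E n y)" for n
      by (simp add: Ex Ab br.add_left br.diff_left br.diff_right br.scaleR_left br.scaleR_right
          flip: scaleR_add_right)
    then show "(\<lambda>n. E n (br x y)) \<longlonglongrightarrow> br (v x) y + br x (v y)"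
      using tendsto_add[OF br.tendsto[OF E A1] br.tendsto[OF tendsto_const E]] by simp
  qed
  moreover have "\<phi> (v x) y z + \<phi> x (v y) z + \<phi> x y (v z) = 0" for x y z
  proof (rule LIMSEQ_unique)
    have "\<phi> (E n x) (A n y) (A n z) + \<phi> x (E n y) (A n z) + \<phi> x y (E n z) = 0" for n
    proof -
      have "\<phi> (E n x) (A n y) (A n z) + \<phi> x (E n y) (A n z) + \<phi> x y (E n z) =
          t n * (\<phi> (A n x) (A n y) (A n z) - \<phi> x y z)"
        by (simp add: Ex blinfun.bilinear_simps algebra_simps)
      then show ?thesis by (simp add: Ab)
    qed
    then show "(\<lambda>n. \<phi> (E n x) (A n y) (A n z) + \<phi> x (E n y) (A n z) + \<phi> x y (E n z)) \<longlonglongrightarrow> 0" by simp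
    show "(\<lambda>n. \<phi> (E n x) (A n y) (A n z) + \<phi> x (E n y) (A n z) + \<phi> x y (E n z))
        \<longlonglongrightarrow> \<phi> (v x) y z + \<phi> x (v y) z + \<phi> x y (v z)"
      by (intro tendsto_add blinfun.tendsto tendsto_const E A1)
  qed
  ultimately show ?thesis by (simp add: derivations_def annihilator3_def)
qed

lemma locally_Euclidean_stabilizer:
  fixes br :: "'a::euclidean_space \<Rightarrow> 'a \<Rightarrow> 'a"
  assumes br: "bilinear br"
  shows "locally_Euclidean (dim (derivations br \<inter> annihilator3 \<phi>)) (stabilizer br \<phi>)"
proof -
  let ?K = "derivations br \<inter> annihilator3 \<phi>" and ?S = "stabilizer br \<phi>"
  have sub: "subspace ?K" by (intro subspace_inter subspace_derivations[OF br] subspace_annihilator3)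
  have inj: "inj_on Endo A" for A :: "('a \<Rightarrow>\<^sub>L 'a) set" by (simp add: inj_on_def Endo_inject)
  have mem: "f \<in> Endo ` A \<longleftrightarrow> endo_map f \<in> A" for f :: "'a endo" and A
    by (metis endo_simps image_iff)
  have "locally_Euclidean (dim (Endo ` ?K)) (Endo ` ?S)"
  proof (rule locally_Euclidean_closed_subgroup[OF euclidean_iso_endo_map[OF euclidean_iso_endomorphism]])
    show "1 \<in> Endo ` ?S" by (auto simp: mem stabilizer_def Aut_def bij_id[unfolded id_def])
    show "f * g \<in> Endo ` ?S" if "f \<in> Endo ` ?S" "g \<in> Endo ` ?S" for f g
    proof -
      have "blinfun_apply (endo_map f o\<^sub>L endo_map g) = blinfun_apply (endo_map f) \<circ> blinfun_apply (endo_map g)"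
        by (simp add: fun_eq_iff)
      then show ?thesis using that by (auto simp: mem stabilizer_def Aut_def bij_comp)
    qed
    show "\<exists>g\<in>Endo ` ?S. g * f = 1 \<and> f * g = 1" if "f \<in> Endo ` ?S" for f
    proof -
      define h where "h = inv_into UNIV (blinfun_apply (endo_map f))"
      have f: "bij (blinfun_apply (endo_map f))"
        "\<And>x y. endo_map f (br x y) = br (endo_map f x) (endo_map f y)"
        "\<And>x y z. \<phi> (endo_map f x) (endo_map f y) (endo_map f z) = \<phi> x y z"
        using that by (auto simp: mem stabilizer_def Aut_def)
      have hf: "h (endo_map f x) = x" "endo_map f (h x) = x" for x
        using f(1) by (auto simp: h_def bij_is_inj bij_is_surj surj_f_inv_f)
      have "linear h"
        by (rule linearI; rule inj_eq[OF bij_is_inj[OF f(1)], THEN iffD1])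
          (simp_all add: blinfun.bilinear_simps hf)
      then have h: "blinfun_apply (Blinfun h) = h"
        by (simp add: bounded_linear_Blinfun_apply linear_conv_bounded_linear)
      have "Blinfun h \<in> ?S"
        unfolding stabilizer_def Aut_def
      proof (intro CollectI conjI allI; (unfold h)?)
        show "bij h" unfolding h_def by (rule bij_imp_bij_inv[OF f(1)])
        show "h (br x y) = br (h x) (h y)" for x y by (metis hf f(2))
        show "\<phi> (h x) (h y) (h z) = \<phi> x y z" for x y z by (metis hf(2) f(3))
      qed
      moreover have "Endo (Blinfun h) * f = 1" "f * Endo (Blinfun h) = 1"
        by (auto intro!: endo_eqI blinfun_eqI simp: h hf)
      ultimately show ?thesis by blast
    qed
    show "subspace (Endo ` ?K)"
      using linear_subspace_image[OF bounded_linear.linear[OF bounded_linear_Endo] sub] .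
    show "exp f \<in> Endo ` ?S" if "f \<in> Endo ` ?K" for f
      using that exp_derivation[OF br] by (simp only: mem)
    show "v \<in> Endo ` ?K" if m: "m \<longlonglongrightarrow> 0" "\<And>n. exp (m n) \<in> Endo ` ?S"
      "(\<lambda>n. t n *\<^sub>R m n) \<longlonglongrightarrow> v" for m t v
      unfolding mem
    proof (rule stabilizer_tangent_vector[OF br])
      note lim = exp_tangent_vector[OF m(1,3), THEN bounded_linear.tendsto[OF bounded_linear_endo_map]]
      show "(\<lambda>n. endo_map (exp (m n))) \<longlonglongrightarrow> id_blinfun" using lim(2) by simp
      show "endo_map (exp (m n)) \<in> ?S" for n using m(2) mem by blast
      show "(\<lambda>n. t n *\<^sub>R (endo_map (exp (m n)) - id_blinfun)) \<longlonglongrightarrow> endo_map v" using lim(1) by simp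
    qed
  qed
  moreover have "dim (Endo ` ?K) = dim ?K"
    by (intro dim_injective_linear_image bounded_linear.linear[OF bounded_linear_Endo] inj)
  moreover have "homeomorphism (Endo ` ?S) ?S endo_map Endo"
    by (rule homeomorphismI)
      (auto intro!: linear_continuous_on bounded_linear_Endo bounded_linear_endo_map)
  ultimately show ?thesis using locally_Euclidean_homeomorphic by metis
qed

lemma id_mem_stabilizer: "id_blinfun \<in> stabilizer br \<phi>"
  by (auto simp: stabilizer_def Aut_def bij_id[unfolded id_def])

lemma manifold_dim_stabilizer:
  assumes "bilinear br"
  shows "manifold_dim (stabilizer br \<phi>) = dim (derivations br \<inter> annihilator3 \<phi>)"
  using manifold_dim_eq[OF locally_Euclidean_stabilizer[OF assms]] id_mem_stabilizer by blast

text \<open>The full automorphism group is the stabilizer of the zero form, which every endomorphism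
  annihilates.\<close>

lemma manifold_dim_Aut:
  fixes br :: "'a::euclidean_space \<Rightarrow> 'a \<Rightarrow> 'a"
  assumes "bilinear br"
  shows "manifold_dim (Aut br) = dim (derivations br)"
proof -
  have "stabilizer br 0 = Aut br" "annihilator3 (0 :: 'a trilin) = UNIV"
    by (auto simp: stabilizer_def annihilator3_def)
  then show ?thesis using manifold_dim_stabilizer[OF assms, of 0] by simp
qed

section \<open>Adapted frames\<close>

text \<open>Frame indices are numerals; rewriting the index \<open>1\<close> to \<open>Suc 0\<close>
  would hide it from the evaluation rules.\<close>

declare One_nat_def [simp del]

text \<open>Carrying the vectors \<open>u\<close> along with the coframe \<open>\<eta>\<close>
  reduces statements about forms to evaluations on frame vectors. \<open>dual\<close> and
  \<open>expand\<close> make \<open>u\<close> a basis, so the dimension is 7.\<close>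

locale G2_frame =
  fixes \<phi> :: "'a::euclidean_space trilin" and u :: "nat \<Rightarrow> 'a" and \<eta> :: "nat \<Rightarrow> 'a \<Rightarrow>\<^sub>L real"
  assumes dual: "\<And>i j. i \<in> {1..7} \<Longrightarrow> j \<in> {1..7} \<Longrightarrow> \<eta> i (u j) = (if i = j then 1 else 0)"
    and expand: "\<And>x. x = \<eta> 1 x *\<^sub>R u 1 + \<eta> 2 x *\<^sub>R u 2 + \<eta> 3 x *\<^sub>R u 3 + \<eta> 4 x *\<^sub>R u 4
      + \<eta> 5 x *\<^sub>R u 5 + \<eta> 6 x *\<^sub>R u 6 + \<eta> 7 x *\<^sub>R u 7"
    and phi: "\<And>x y z. \<phi> x y z =
      wedge3 (\<eta> 1) (\<eta> 2) (\<eta> 7) x y z + wedge3 (\<eta> 3) (\<eta> 4) (\<eta> 7) x y z + wedge3 (\<eta> 5) (\<eta> 6) (\<eta> 7) x y z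
      + wedge3 (\<eta> 1) (\<eta> 3) (\<eta> 5) x y z - wedge3 (\<eta> 2) (\<eta> 3) (\<eta> 6) x y z - wedge3 (\<eta> 1) (\<eta> 4) (\<eta> 6) x y z
      - wedge3 (\<eta> 2) (\<eta> 4) (\<eta> 5) x y z"

lemma atLeast1_atMost7: "{1..7::nat} = {1, 2, 3, 4, 5, 6, 7}"
  by auto

lemma sum_1_7: "(\<Sum>i=1..7::nat. f i) = f 1 + f 2 + f 3 + f 4 + f 5 + f 6 + (f 7 :: 'b::comm_monoid_add)"
  unfolding atLeast1_atMost7 by (simp add: add.assoc)

lemma ball_1_7: "(\<forall>i\<in>{1..7::nat}. P i) \<longleftrightarrow> P 1 \<and> P 2 \<and> P 3 \<and> P 4 \<and> P 5 \<and> P 6 \<and> P 7"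
  unfolding atLeast1_atMost7 by simp

context G2_frame
begin

lemma eta_u [simp]:
  assumes "i \<in> {1..7}" "j \<in> {1..7}"
  shows "\<eta> i (u j) = (if i = j then 1 else 0)"
  using dual assms by blast

lemma frame_eqI:
  assumes "\<And>i. i \<in> {1..7} \<Longrightarrow> \<eta> i x = \<eta> i y"
  shows "x = y"
  by (rule trans[OF expand[of x]], rule trans[OF _ expand[of y, symmetric]]) (simp add: assms)

lemma linear_frame_eqI:
  fixes f g :: "'a \<Rightarrow>\<^sub>L 'b::real_normed_vector"
  assumes "\<And>i. i \<in> {1..7} \<Longrightarrow> f (u i) = g (u i)"
  shows "f = g"
proof (rule blinfun_eqI)
  fix x
  have "h x = \<eta> 1 x *\<^sub>R h (u 1) + \<eta> 2 x *\<^sub>R h (u 2) + \<eta> 3 x *\<^sub>R h (u 3) + \<eta> 4 x *\<^sub>R h (u 4)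
      + \<eta> 5 x *\<^sub>R h (u 5) + \<eta> 6 x *\<^sub>R h (u 6) + \<eta> 7 x *\<^sub>R h (u 7)" for h :: "'a \<Rightarrow>\<^sub>L 'b"
    using arg_cong[OF expand[of x], of h] by (simp only: blinfun.bilinear_simps)
  from this[of f] this[of g] show "f x = g x" by (simp add: assms)
qed

lemma phi_forms3: "\<phi> \<in> forms3"
  by (simp add: forms3_def phi wedge3_def algebra_simps)

lemma dual_basis7: "dual_basis7 \<eta>"
  unfolding dual_basis7_def
proof (intro conjI)
  show inj: "inj_on \<eta> {1..7}"
    by (rule inj_onI) (metis eta_u zero_neq_one)
  have fin: "finite (\<eta> ` {1..7})" by simp
  show "independent (\<eta> ` {1..7})"
    unfolding independent_explicit_finite_subsets
  proof (intro allI impI ballI)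
    fix A f v assume A: "A \<subseteq> \<eta> ` {1..7}" "finite A" "(\<Sum>v\<in>A. f v *\<^sub>R v) = 0" "v \<in> A"
    then obtain i where i: "i \<in> {1..7}" "v = \<eta> i" by blast
    have "0 = (\<Sum>v\<in>A. f v *\<^sub>R v) (u i)" using A(3) by simp
    also have "\<dots> = (\<Sum>w\<in>A. f w * w (u i))" by (simp add: blinfun.bilinear_simps)
    also have "\<dots> = (\<Sum>w\<in>A. if w = v then f v else 0)"
    proof (rule sum.cong)
      fix w assume "w \<in> A"
      then obtain j where "j \<in> {1..7}" "w = \<eta> j" using A(1) by blast
      then show "f w * w (u i) = (if w = v then f v else 0)"
        using i inj by (auto simp: inj_on_eq_iff)
    qed simp
    also have "\<dots> = f v" using A by simp
    finally show "f v = 0" by simp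
  qed
  have "f \<in> span (\<eta> ` {1..7})" for f
  proof -
    have "f = (\<Sum>i=1..7. f (u i) *\<^sub>R \<eta> i)"
      by (rule linear_frame_eqI) (auto simp: blinfun.bilinear_simps if_distrib cong: if_cong)
    also have "\<dots> \<in> span (\<eta> ` {1..7})" by (intro span_sum span_scale span_base) auto
    finally show ?thesis .
  qed
  then show "span (\<eta> ` {1..7}) = UNIV" by blast
qed

lemma G2_structure: "G2_structure \<phi>"
  unfolding G2_structure_def Let_def
  using phi_forms3 dual_basis7 phi by blast

end

text \<open>A basis of the dual space is the dual basis of a basis of vectors. The vectors
  \<open>u\<close> come from functionals on the dual space, and a vector on which the whole coframe
  vanishes is zero because the coframe spans.\<close>

lemma G2_structure_iff_frame: "G2_structure \<phi> \<longleftrightarrow> (\<exists>u \<eta>. G2_frame \<phi> u \<eta>)"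
proof
  assume "G2_structure \<phi>"
  then obtain \<eta> where \<eta>: "dual_basis7 \<eta>" and phi: "\<And>x y z. \<phi> x y z =
      wedge3 (\<eta> 1) (\<eta> 2) (\<eta> 7) x y z + wedge3 (\<eta> 3) (\<eta> 4) (\<eta> 7) x y z + wedge3 (\<eta> 5) (\<eta> 6) (\<eta> 7) x y z
      + wedge3 (\<eta> 1) (\<eta> 3) (\<eta> 5) x y z - wedge3 (\<eta> 2) (\<eta> 3) (\<eta> 6) x y z - wedge3 (\<eta> 1) (\<eta> 4) (\<eta> 6) x y z
      - wedge3 (\<eta> 2) (\<eta> 4) (\<eta> 5) x y z"
    unfolding G2_structure_def Let_def by blast
  have inj: "inj_on \<eta> {1..7}" and ind: "independent (\<eta> ` {1..7})" and span: "span (\<eta> ` {1..7}) = UNIV"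
    using \<eta> by (auto simp: dual_basis7_def)
  \<comment> \<open>Every linear functional on the dual space is the evaluation at a vector.\<close>
  have "\<exists>v. \<forall>i\<in>{1..7}. \<eta> i v = (if i = j then 1 else 0)" for j
  proof -
    obtain l :: "('a \<Rightarrow>\<^sub>L real) \<Rightarrow> real" where l: "linear l"
      "\<forall>f\<in>\<eta> ` {1..7}. l f = (if inv_into {1..7} \<eta> f = j then 1 else 0)"
      using linear_independent_extend[OF ind, of "\<lambda>f. if inv_into {1..7} \<eta> f = j then 1 else 0"] by auto
    define v where "v = (\<Sum>b\<in>Basis. l (blinfun_inner_left b) *\<^sub>R b)"
    have "f v = l f" for f :: "'a \<Rightarrow>\<^sub>L real"
    proof -
      have "f = (\<Sum>b\<in>Basis. f b *\<^sub>R blinfun_inner_left b)"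
      proof (rule blinfun_eqI)
        fix x
        have "f x = f (\<Sum>b\<in>Basis. (x \<bullet> b) *\<^sub>R b)" by (simp add: euclidean_representation)
        also have "\<dots> = (\<Sum>b\<in>Basis. f b *\<^sub>R blinfun_inner_left b) x"
          by (simp add: blinfun.bilinear_simps mult.commute inner_commute)
        finally show "f x = (\<Sum>b\<in>Basis. f b *\<^sub>R blinfun_inner_left b) x" .
      qed
      from arg_cong[OF this, of l] have "l f = (\<Sum>b\<in>Basis. f b * l (blinfun_inner_left b))"
        by (simp only: linear_sum[OF l(1)] linear_scale[OF l(1)] real_scaleR_def)
      then show ?thesis by (simp add: v_def blinfun.bilinear_simps mult.commute)
    qed
    then have "\<eta> i v = (if i = j then 1 else 0)" if "i \<in> {1..7}" for i
      using l(2) that inv_into_f_f[OF inj that] by auto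
    then show ?thesis by blast
  qed
  then obtain u where u: "\<And>i j. i \<in> {1..7} \<Longrightarrow> \<eta> i (u j) = (if i = j then 1 else 0)" by metis
  have expand: "x = (\<Sum>i=1..7. \<eta> i x *\<^sub>R u i)" for x
  proof -
    define y where "y = x - (\<Sum>i=1..7. \<eta> i x *\<^sub>R u i)"
    define Y where "Y = {f :: 'a \<Rightarrow>\<^sub>L real. f y = 0}"
    have "\<eta> ` {1..7} \<subseteq> Y"
      by (auto simp: Y_def y_def blinfun.bilinear_simps u if_distrib cong: if_cong)
    moreover have "subspace Y" by (auto simp: Y_def subspace_def blinfun.bilinear_simps)
    ultimately have "span (\<eta> ` {1..7}) \<subseteq> Y" by (rule span_minimal)
    then have "blinfun_inner_left y \<in> Y" using span by blast
    then have "blinfun_inner_left y y = 0" by (simp add: Y_def)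
    then have "y = 0" by simp
    then show ?thesis unfolding y_def by (rule eq_iff_diff_eq_0[THEN iffD2])
  qed
  from u expand[unfolded sum_1_7] phi have "G2_frame \<phi> u \<eta>" by (rule G2_frame.intro)
  then show "\<exists>u \<eta>. G2_frame \<phi> u \<eta>" by blast
qed (auto intro: G2_frame.G2_structure)

section \<open>The metric and the cross product of a G2-structure\<close>

context G2_frame
begin

definition metric :: "'a \<Rightarrow> 'a \<Rightarrow> real" where
  "metric x y = (\<Sum>i=1..7. \<eta> i x * \<eta> i y)"

definition cross :: "'a \<Rightarrow> 'a \<Rightarrow> 'a" where
  "cross x y = (\<Sum>i=1..7. \<phi> x y (u i) *\<^sub>R u i)"

lemma eta_cross: "i \<in> {1..7} \<Longrightarrow> \<eta> i (cross x y) = \<phi> x y (u i)"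
  by (simp add: cross_def blinfun.bilinear_simps if_distrib cong: if_cong)

lemma metric_commute: "metric x y = metric y x"
  by (simp add: metric_def mult.commute)

lemma metric_simps:
  "metric (x + y) z = metric x z + metric y z" "metric (a *\<^sub>R x) z = a * metric x z"
  "metric (- x) z = - metric x z" "metric (x - y) z = metric x z - metric y z"
  "metric z (x + y) = metric z x + metric z y" "metric z (a *\<^sub>R x) = a * metric z x"
  "metric z (- x) = - metric z x" "metric z (x - y) = metric z x - metric z y"
  by (simp_all add: metric_def sum_1_7 blinfun.bilinear_simps algebra_simps)

lemma metric_cross: "metric (cross x y) z = \<phi> x y z"
proof -
  have "\<phi> x y z = \<phi> x y (\<Sum>i=1..7. \<eta> i z *\<^sub>R u i)" using expand[of z] by (simp add: sum_1_7)
  then show ?thesis by (simp add: metric_def eta_cross blinfun.bilinear_simps mult.commute)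
qed

lemma phi_alt: "\<phi> x y z = - \<phi> y x z" "\<phi> x y z = - \<phi> x z y" "\<phi> x x y = 0" "\<phi> x y x = 0" "\<phi> y x x = 0"
  by (simp_all add: phi wedge3_def algebra_simps)

lemma phi_cyclic: "\<phi> x y z = \<phi> y z x"
  by (metis phi_alt(1,2) minus_minus)

lemma cross_anticommute: "cross x y = - cross y x"
  by (rule frame_eqI) (simp add: eta_cross blinfun.bilinear_simps phi_alt(1)[of x y])

lemma cross_simps: "cross (- x) y = - cross x y" "cross x (- y) = - cross x y" "cross x x = 0"
  by (rule frame_eqI; simp add: eta_cross blinfun.bilinear_simps phi_alt(3))+

lemma phi_u:
  "\<phi> x y (u 1) = (\<eta> 2 x * \<eta> 7 y - \<eta> 7 x * \<eta> 2 y) + (\<eta> 3 x * \<eta> 5 y - \<eta> 5 x * \<eta> 3 y) - (\<eta> 4 x * \<eta> 6 y - \<eta> 6 x * \<eta> 4 y)"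
  "\<phi> x y (u 2) = (\<eta> 7 x * \<eta> 1 y - \<eta> 1 x * \<eta> 7 y) - (\<eta> 3 x * \<eta> 6 y - \<eta> 6 x * \<eta> 3 y) - (\<eta> 4 x * \<eta> 5 y - \<eta> 5 x * \<eta> 4 y)"
  "\<phi> x y (u 3) = (\<eta> 4 x * \<eta> 7 y - \<eta> 7 x * \<eta> 4 y) + (\<eta> 5 x * \<eta> 1 y - \<eta> 1 x * \<eta> 5 y) - (\<eta> 6 x * \<eta> 2 y - \<eta> 2 x * \<eta> 6 y)"
  "\<phi> x y (u 4) = (\<eta> 7 x * \<eta> 3 y - \<eta> 3 x * \<eta> 7 y) - (\<eta> 6 x * \<eta> 1 y - \<eta> 1 x * \<eta> 6 y) - (\<eta> 5 x * \<eta> 2 y - \<eta> 2 x * \<eta> 5 y)"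
  "\<phi> x y (u 5) = (\<eta> 6 x * \<eta> 7 y - \<eta> 7 x * \<eta> 6 y) + (\<eta> 1 x * \<eta> 3 y - \<eta> 3 x * \<eta> 1 y) - (\<eta> 2 x * \<eta> 4 y - \<eta> 4 x * \<eta> 2 y)"
  "\<phi> x y (u 6) = (\<eta> 7 x * \<eta> 5 y - \<eta> 5 x * \<eta> 7 y) - (\<eta> 2 x * \<eta> 3 y - \<eta> 3 x * \<eta> 2 y) - (\<eta> 1 x * \<eta> 4 y - \<eta> 4 x * \<eta> 1 y)"
  "\<phi> x y (u 7) = (\<eta> 1 x * \<eta> 2 y - \<eta> 2 x * \<eta> 1 y) + (\<eta> 3 x * \<eta> 4 y - \<eta> 4 x * \<eta> 3 y) + (\<eta> 5 x * \<eta> 6 y - \<eta> 6 x * \<eta> 5 y)"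
  by (simp_all add: phi wedge3_def algebra_simps)

text \<open>The polarisation of \<open>x \<times> (x \<times> z) = \<langle>x,z\<rangle> x -
  \<langle>x,x\<rangle> z\<close>, which expresses that the octonions are alternative. Each of the
  seven components is a polynomial identity in the coordinates.\<close>

lemma cross_cross:
  "cross x (cross y z) + cross y (cross x z) = - (2 * metric x y) *\<^sub>R z + metric x z *\<^sub>R y + metric y z *\<^sub>R x"
proof (rule frame_eqI)
  fix i :: nat
  let ?P = "\<lambda>i. \<phi> x (cross y z) (u i) + \<phi> y (cross x z) (u i)
      = - (2 * metric x y) * \<eta> i z + metric x z * \<eta> i y + metric y z * \<eta> i x"
  have "\<eta> 1 (cross v w) = \<phi> v w (u 1)" "\<eta> 2 (cross v w) = \<phi> v w (u 2)" "\<eta> 3 (cross v w) = \<phi> v w (u 3)"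
    "\<eta> 4 (cross v w) = \<phi> v w (u 4)" "\<eta> 5 (cross v w) = \<phi> v w (u 5)" "\<eta> 6 (cross v w) = \<phi> v w (u 6)"
    "\<eta> 7 (cross v w) = \<phi> v w (u 7)" for v w
    by (simp_all add: eta_cross)
  note simps = phi_u this metric_def sum_1_7
  have "?P 1" "?P 2" "?P 3" "?P 4" "?P 5" "?P 6" "?P 7"
    by (simp_all only: simps, Groebner_Basis.algebra+)
  then have "\<forall>i\<in>{1..7}. ?P i" unfolding ball_1_7 by blast
  moreover assume "i \<in> {1..7}"
  ultimately show "\<eta> i (cross x (cross y z) + cross y (cross x z))
      = \<eta> i (- (2 * metric x y) *\<^sub>R z + metric x z *\<^sub>R y + metric y z *\<^sub>R x)"
    by (simp add: blinfun.bilinear_simps eta_cross)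
qed

lemma cross_cross_orthogonal:
  assumes "metric x y = 0" "metric x z = 0" "metric y z = 0"
  shows "cross x (cross y z) = - cross y (cross x z)"
  using cross_cross[of x y z] assms by (simp add: eq_neg_iff_add_eq_0)

lemma cross_cross_self: "cross x (cross x z) = metric x z *\<^sub>R x - metric x x *\<^sub>R z"
proof -
  have "2 *\<^sub>R cross x (cross x z) = 2 *\<^sub>R (metric x z *\<^sub>R x - metric x x *\<^sub>R z)"
    using cross_cross[of x x z] by (simp add: scaleR_2[symmetric] scaleR_right_diff_distrib)
  then show ?thesis by simp
qed

lemma metric_cross_cross:
  "metric (cross x y) (cross x z) = metric x x * metric y z - metric x y * metric x z"
proof -
  have "metric (cross x y) (cross x z) = - metric (cross x (cross x z)) y"
    using metric_cross[of x y "cross x z"] metric_cross[of x "cross x z" y] phi_alt(2)[of x y "cross x z"] by simp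
  then show ?thesis by (simp add: cross_cross_self metric_simps metric_commute[of z y])
qed

lemma metric_cross_left [simp]: "metric (cross x y) x = 0" "metric (cross x y) y = 0"
  "metric x (cross x y) = 0" "metric y (cross x y) = 0"
  by (simp_all add: metric_cross phi_alt(3-5) metric_commute[of _ "cross x y"])

lemma metric_pos: "x \<noteq> 0 \<Longrightarrow> metric x x > 0"
proof -
  assume "x \<noteq> 0"
  then obtain i where "i \<in> {1..7}" "\<eta> i x \<noteq> 0" using frame_eqI[of x 0] by auto
  then show ?thesis
    unfolding metric_def by (intro sum_pos2[of _ i]) (auto simp: zero_less_mult_iff)
qed

lemma metric_eq_0_iff [simp]: "metric x x = 0 \<longleftrightarrow> x = 0"
  using metric_pos[of x] by (cases "x = 0") (auto simp: metric_def)

text \<open>Three orthonormal vectors \<open>a, b, c\<close> with \<open>c\<close> orthogonal to \<open>a \<times> b\<close> generate an adapted frame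
  by cross products, as three such imaginary octonions generate the octonions.\<close>

lemma adapted_frame_exists:
  assumes on: "metric a a = 1" "metric b b = 1" "metric c c = 1"
    "metric a b = 0" "metric a c = 0" "metric b c = 0" and abc: "\<phi> a b c = 0"
  obtains u' \<eta>' where "G2_frame \<phi> u' \<eta>'" "u' 1 = a" "u' 2 = b" "u' 3 = c"
proof -
  \<comment> \<open>The missing frame vectors are read off the standard form: \<open>s\<close>,
    \<open>q\<close>, \<open>r\<close>, \<open>p\<close> become number 7, 5, 6, 4. The sign of
    \<open>r\<close> comes from the negative term with indices 2, 3, 6.\<close>
  define s where "s = cross a b"
  define q where "q = cross a c"
  define r where "r = - cross b c"
  define p where "p = cross s c"
  note sym = metric_commute
  note on' = on sym[of b a] sym[of c a] sym[of c b]
  note mcc = metric_cross_cross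
  have s: "metric s s = 1" "metric s a = 0" "metric s b = 0" "metric s c = 0"
    unfolding s_def by (simp add: mcc on', simp, simp, simp add: metric_cross abc)
  note s' = s sym[of a s] sym[of b s] sym[of c s]
  have acb: "\<phi> a c b = 0" "\<phi> b c a = 0" "\<phi> c a b = 0"
    using phi_alt(2)[of a c b] phi_cyclic[of a b c] phi_cyclic[of b c a] abc by simp_all
  have q: "metric q q = 1" "metric q a = 0" "metric q c = 0" "metric q b = 0" "metric q s = 0"
    unfolding q_def s_def
    by (simp add: mcc on', simp, simp, simp add: metric_cross acb, simp add: mcc on')
  have r: "metric r r = 1" "metric r b = 0" "metric r c = 0" "metric r a = 0" "metric r s = 0" "metric r q = 0"
    unfolding r_def s_def q_def
    by (simp add: mcc on' metric_simps, simp add: metric_simps, simp add: metric_simps,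
        simp add: metric_cross acb metric_simps,
        simp add: mcc on' metric_simps cross_anticommute[of a b],
        simp add: mcc on' metric_simps cross_anticommute[of a c] cross_anticommute[of b c])
  have "metric p a = metric (cross c a) s" "metric p b = metric (cross c b) s"
    by (simp_all add: p_def metric_cross phi_cyclic[of s c])
  moreover have "cross c a = - q" "cross c b = r"
    by (simp_all add: q_def r_def cross_anticommute[of c])
  ultimately have p1: "metric p a = 0" "metric p b = 0" using q r by (simp_all add: metric_simps)
  have p2: "metric p q = 0" "metric p r = 0"
    unfolding p_def q_def r_def cross_anticommute[of s c] cross_anticommute[of a c] cross_anticommute[of b c]
    by (simp_all add: mcc metric_simps on' s')
  have p: "metric p p = 1" "metric p s = 0" "metric p c = 0"
    unfolding p_def by (simp add: mcc on' s', simp, simp)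
  note gs = on' s' q r p p1 p2 sym[of a q] sym[of b q] sym[of c q] sym[of s q]
    sym[of a r] sym[of b r] sym[of c r] sym[of s r] sym[of q r]
    sym[of a p] sym[of b p] sym[of c p] sym[of s p] sym[of q p] sym[of r p]
  define u' where "u' i = (if i = 1 then a else if i = 2 then b else if i = 3 then c else if i = 4 then p
    else if i = 5 then q else if i = 6 then r else s)" for i :: nat
  have u': "u' 1 = a" "u' 2 = b" "u' 3 = c" "u' 4 = p" "u' 5 = q" "u' 6 = r" "u' 7 = s"
    by (simp_all add: u'_def)
  define \<eta>' where "\<eta>' i = (\<Sum>j=1..7. \<eta> j (u' i) *\<^sub>R \<eta> j)" for i
  have eta': "\<eta>' i x = metric (u' i) x" for i x
    by (simp add: \<eta>'_def metric_def blinfun.bilinear_simps)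
  have dual': "\<eta>' i (u' j) = (if i = j then 1 else 0)" if "i \<in> {1..7}" "j \<in> {1..7}" for i j
  proof -
    have "\<forall>i\<in>{1..7}. \<forall>j\<in>{1..7}. \<eta>' i (u' j) = (if i = j then 1 else 0)"
      unfolding ball_1_7 by (simp add: eta' u' gs)
    then show ?thesis using that by blast
  qed
  have expand': "x = \<eta>' 1 x *\<^sub>R u' 1 + \<eta>' 2 x *\<^sub>R u' 2 + \<eta>' 3 x *\<^sub>R u' 3 + \<eta>' 4 x *\<^sub>R u' 4
      + \<eta>' 5 x *\<^sub>R u' 5 + \<eta>' 6 x *\<^sub>R u' 6 + \<eta>' 7 x *\<^sub>R u' 7" for x
  proof -
    \<comment> \<open>\<open>T\<close> sends the old frame to the new vectors. Their duality
      relations make it injective, hence surjective, so the new vectors span.\<close>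
    define T where "T w = (\<Sum>i=1..7. \<eta> i w *\<^sub>R u' i)" for w
    have lin: "linear T"
      by (rule linearI) (simp_all add: T_def blinfun.bilinear_simps scaleR_add_left sum.distrib scaleR_sum_right)
    have TT: "\<eta>' j (T w) = \<eta> j w" if "j \<in> {1..7}" for j w
      using that by (simp add: T_def blinfun.bilinear_simps dual' if_distrib cong: if_cong)
    have "inj T"
      by (rule injI) (metis TT frame_eqI)
    then have "surj T" using lin by (simp add: linear_injective_imp_surjective)
    then obtain w where w: "x = T w" by (metis surjD)
    have "x = (\<Sum>i=1..7. \<eta>' i x *\<^sub>R u' i)"
      unfolding w by (subst T_def) (simp add: TT)
    then show ?thesis by (simp only: sum_1_7)
  qed
  note cc = cross_anticommute
  have X: "cross a b = s" "cross a c = q" "cross b c = - r" "cross s c = p"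
    by (simp_all add: s_def q_def r_def p_def)
  have X2: "cross a s = - b" "cross b s = a" "cross a q = - c" "cross c q = a" "cross b r = c" "cross c r = - b"
    "cross s p = - c" "cross c p = s"
  proof -
    show "cross a s = - b" using cross_cross_self[of a b] by (simp add: X gs)
    show "cross b s = a" using cross_cross_self[of b a] by (simp add: X gs cc[of b a] cross_simps)
    show "cross a q = - c" using cross_cross_self[of a c] by (simp add: X gs)
    show "cross c q = a" using cross_cross_self[of c a] by (simp add: X gs cc[of c a] cross_simps)
    show "cross b r = c" using cross_cross_self[of b c] by (simp add: X gs cross_simps)
    show "cross c r = - b" using cross_cross_self[of c b] by (simp add: X gs cc[of c b] cross_simps)
    show "cross s p = - c" using cross_cross_self[of s c] by (simp add: X gs)
    show "cross c p = s" using cross_cross_self[of c s] by (simp add: X gs cc[of c s] cross_simps)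
  qed
  \<comment> \<open>For orthogonal vectors the two outer factors of a double cross product can be
    exchanged up to sign; two exchanges turn \<open>a \<times> (b \<times> c)\<close> into a
    multiple of \<open>c \<times> (a \<times> b)\<close>.\<close>
  have ar: "cross a r = p"
  proof -
    have "cross a (cross b c) = - cross b (cross a c)" "cross b (cross c a) = - cross c (cross b a)"
      by (rule cross_cross_orthogonal; simp add: gs)+
    then show ?thesis by (simp add: X cross_simps cc[of c a] cc[of b a] cc[of c s])
  qed
  have bq: "cross b q = p"
    using cross_cross_orthogonal[of a b c] ar by (simp add: gs X cross_simps)
  have X3: "cross a p = - r" "cross b p = - q" "cross p r = - a" "cross p q = - b"
  proof -
    show "cross a p = - r" using cross_cross_self[of a r] by (simp add: ar gs)
    show "cross b p = - q" using cross_cross_self[of b q] by (simp add: bq gs)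
    show "cross p r = - a" using cross_cross_self[of r a] cc[of r p] by (simp add: ar gs cc[of r a] cross_simps)
    show "cross p q = - b" using cross_cross_self[of q b] cc[of q p] by (simp add: bq gs cc[of q b] cross_simps)
  qed
  have sq: "cross s q = r"
    using cross_cross_orthogonal[of s a c] cross_cross_orthogonal[of a s c] ar
    by (simp add: gs X cross_simps X3)
  have X4: "cross q r = s" "cross s r = - q"
  proof -
    show "cross q r = s" using cross_cross_self[of q s] by (simp add: sq gs cc[of q s] cross_simps)
    show "cross s r = - q" using cross_cross_self[of s q] by (simp add: sq gs)
  qed
  note table = X X2 ar bq X3 sq X4
  have phi': "\<phi> x y z =
      wedge3 (\<eta>' 1) (\<eta>' 2) (\<eta>' 7) x y z + wedge3 (\<eta>' 3) (\<eta>' 4) (\<eta>' 7) x y z + wedge3 (\<eta>' 5) (\<eta>' 6) (\<eta>' 7) x y z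
      + wedge3 (\<eta>' 1) (\<eta>' 3) (\<eta>' 5) x y z - wedge3 (\<eta>' 2) (\<eta>' 3) (\<eta>' 6) x y z - wedge3 (\<eta>' 1) (\<eta>' 4) (\<eta>' 6) x y z
      - wedge3 (\<eta>' 2) (\<eta>' 4) (\<eta>' 5) x y z" for x y z
  proof -
    have mz: "metric a z = \<eta>' 1 z" "metric b z = \<eta>' 2 z" "metric c z = \<eta>' 3 z" "metric p z = \<eta>' 4 z"
      "metric q z = \<eta>' 5 z" "metric r z = \<eta>' 6 z" "metric s z = \<eta>' 7 z" by (simp_all add: eta' u')
    have flip: "\<phi> w v z = - k" if "\<phi> v w z = k" for v w k using that phi_alt(1)[of w v z] by simp
    note t = table[THEN arg_cong[where f = "\<lambda>v. metric v z"], unfolded metric_cross metric_simps mz]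
    have "\<phi> x y z = \<phi> (\<eta>' 1 x *\<^sub>R a + \<eta>' 2 x *\<^sub>R b + \<eta>' 3 x *\<^sub>R c + \<eta>' 4 x *\<^sub>R p
      + \<eta>' 5 x *\<^sub>R q + \<eta>' 6 x *\<^sub>R r + \<eta>' 7 x *\<^sub>R s)
      (\<eta>' 1 y *\<^sub>R a + \<eta>' 2 y *\<^sub>R b + \<eta>' 3 y *\<^sub>R c + \<eta>' 4 y *\<^sub>R p
      + \<eta>' 5 y *\<^sub>R q + \<eta>' 6 y *\<^sub>R r + \<eta>' 7 y *\<^sub>R s) z"
      using arg_cong2[OF expand'[of x] expand'[of y], of "\<lambda>x y. \<phi> x y z"] unfolding u' .
    then show ?thesis
      by (rule trans) (simp only: blinfun.bilinear_simps real_scaleR_def t t[THEN flip] phi_alt(3) wedge3_def,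
        Groebner_Basis.algebra)
  qed
  have "G2_frame \<phi> u' \<eta>'" using dual' expand' phi' by (rule G2_frame.intro)
  then show thesis using that u' by blast
qed

end

lemma forms3_antisym:
  assumes "\<psi> \<in> forms3"
  shows "\<psi> x y z = - \<psi> y x z" "\<psi> x y z = - \<psi> x z y" "\<psi> x x z = 0" "\<psi> x z z = 0" "\<psi> x z x = 0"
proof -
  have a: "\<And>x y. \<psi> x x y = 0" "\<And>x y. \<psi> x y x = 0" "\<And>x y. \<psi> y x x = 0"
    using assms unfolding forms3_def by blast+
  have "\<psi> (x + y) (x + y) z = 0" "\<psi> x (y + z) (y + z) = 0" by (simp_all only: a)
  then show "\<psi> x y z = - \<psi> y x z" "\<psi> x y z = - \<psi> x z y"
    by (simp_all add: blinfun.bilinear_simps a)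
qed (use assms in \<open>auto simp: forms3_def\<close>)

lemma subspace_forms3: "subspace forms3"
  unfolding subspace_def forms3_def by (auto simp: blinfun.bilinear_simps)

lemma bilin_exists:
  fixes f :: "'a::euclidean_space \<Rightarrow> 'a \<Rightarrow> real"
  assumes "\<And>y. linear (\<lambda>x. f x y)" "\<And>x. linear (f x)"
  obtains \<omega> :: "'a bilin" where "\<And>x y. \<omega> x y = f x y"
proof -
  define F where "F x = Blinfun (f x)" for x
  have F: "F x y = f x y" for x y
    unfolding F_def using assms(2)[of x] by (simp add: bounded_linear_Blinfun_apply linear_conv_bounded_linear)
  have "linear F"
    by (rule linearI; rule blinfun_eqI)
      (simp_all add: F blinfun.bilinear_simps linear_add[OF assms(1)] linear_scale[OF assms(1)])
  then have "Blinfun F x y = f x y" for x y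
    by (simp add: bounded_linear_Blinfun_apply linear_conv_bounded_linear F)
  then show thesis using that by blast
qed

lemma trilin_exists:
  fixes f :: "'a::euclidean_space \<Rightarrow> 'a \<Rightarrow> 'a \<Rightarrow> real"
  assumes "\<And>y z. linear (\<lambda>x. f x y z)" "\<And>x z. linear (\<lambda>y. f x y z)" "\<And>x y. linear (f x y)"
  obtains \<psi> :: "'a trilin" where "\<And>x y z. \<psi> x y z = f x y z"
proof -
  have "\<exists>\<omega> :: 'a bilin. \<forall>y z. \<omega> y z = f x y z" for x
    using bilin_exists[of "f x"] assms(2,3) by metis
  then obtain F :: "'a \<Rightarrow> 'a bilin" where F: "\<And>x y z. F x y z = f x y z" by metis
  have "linear F"
    by (rule linearI; rule blinfun_eqI; rule blinfun_eqI)
      (simp_all add: F blinfun.bilinear_simps linear_add[OF assms(1)] linear_scale[OF assms(1)])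
  then have "Blinfun F x y z = f x y z" for x y z
    by (simp add: bounded_linear_Blinfun_apply linear_conv_bounded_linear F)
  then show thesis using that by blast
qed

section \<open>The linear action of endomorphisms on the form\<close>

context G2_frame
begin

lemma phi_uu:
  "\<phi> (u 1) (u 2) v = \<eta> 7 v"
  "\<phi> (u 1) (u 3) v = \<eta> 5 v"
  "\<phi> (u 1) (u 4) v = - \<eta> 6 v"
  "\<phi> (u 1) (u 5) v = - \<eta> 3 v"
  "\<phi> (u 1) (u 6) v = \<eta> 4 v"
  "\<phi> (u 1) (u 7) v = - \<eta> 2 v"
  "\<phi> (u 2) (u 1) v = - \<eta> 7 v"
  "\<phi> (u 2) (u 3) v = - \<eta> 6 v"
  "\<phi> (u 2) (u 4) v = - \<eta> 5 v"
  "\<phi> (u 2) (u 5) v = \<eta> 4 v"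
  "\<phi> (u 2) (u 6) v = \<eta> 3 v"
  "\<phi> (u 2) (u 7) v = \<eta> 1 v"
  "\<phi> (u 3) (u 1) v = - \<eta> 5 v"
  "\<phi> (u 3) (u 2) v = \<eta> 6 v"
  "\<phi> (u 3) (u 4) v = \<eta> 7 v"
  "\<phi> (u 3) (u 5) v = \<eta> 1 v"
  "\<phi> (u 3) (u 6) v = - \<eta> 2 v"
  "\<phi> (u 3) (u 7) v = - \<eta> 4 v"
  "\<phi> (u 4) (u 1) v = \<eta> 6 v"
  "\<phi> (u 4) (u 2) v = \<eta> 5 v"
  "\<phi> (u 4) (u 3) v = - \<eta> 7 v"
  "\<phi> (u 4) (u 5) v = - \<eta> 2 v"
  "\<phi> (u 4) (u 6) v = - \<eta> 1 v"
  "\<phi> (u 4) (u 7) v = \<eta> 3 v"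
  "\<phi> (u 5) (u 1) v = \<eta> 3 v"
  "\<phi> (u 5) (u 2) v = - \<eta> 4 v"
  "\<phi> (u 5) (u 3) v = - \<eta> 1 v"
  "\<phi> (u 5) (u 4) v = \<eta> 2 v"
  "\<phi> (u 5) (u 6) v = \<eta> 7 v"
  "\<phi> (u 5) (u 7) v = - \<eta> 6 v"
  "\<phi> (u 6) (u 1) v = - \<eta> 4 v"
  "\<phi> (u 6) (u 2) v = - \<eta> 3 v"
  "\<phi> (u 6) (u 3) v = \<eta> 2 v"
  "\<phi> (u 6) (u 4) v = \<eta> 1 v"
  "\<phi> (u 6) (u 5) v = - \<eta> 7 v"
  "\<phi> (u 6) (u 7) v = \<eta> 5 v"
  "\<phi> (u 7) (u 1) v = \<eta> 2 v"
  "\<phi> (u 7) (u 2) v = - \<eta> 1 v"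
  "\<phi> (u 7) (u 3) v = \<eta> 4 v"
  "\<phi> (u 7) (u 4) v = - \<eta> 3 v"
  "\<phi> (u 7) (u 5) v = \<eta> 6 v"
  "\<phi> (u 7) (u 6) v = - \<eta> 5 v"
  by (simp_all add: phi wedge3_def)

lemma forms3_frame_eqI:
  assumes \<psi>: "\<psi> \<in> forms3" "\<psi>' \<in> forms3"
    and eq: "\<And>i j k. \<lbrakk>1 \<le> i; i < j; j < k; k \<le> 7\<rbrakk> \<Longrightarrow> \<psi> (u i) (u j) (u k) = \<psi>' (u i) (u j) (u k)"
  shows "\<psi> = \<psi>'"
proof (rule linear_frame_eqI, rule linear_frame_eqI, rule linear_frame_eqI)
  define \<delta> where "\<delta> = \<psi> - \<psi>'"
  have "\<delta> \<in> forms3" using \<psi> subspace_forms3 unfolding \<delta>_def by (rule subspace_diff[rotated])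
  note \<delta> = forms3_antisym[OF this]
  have lt: "\<delta> (u i) (u j) (u k) = 0" if "1 \<le> i" "i < j" "j < k" "k \<le> 7" for i j k
    using eq[OF that] by (simp add: \<delta>_def blinfun.bilinear_simps)
  fix i j k :: nat assume i: "i \<in> {1..7}" and j: "j \<in> {1..7}" and k: "k \<in> {1..7}"
  have "\<delta> (u i) (u j) (u k) = 0"
  proof (cases "i = j \<or> j = k \<or> i = k")
    case True
    then show ?thesis using \<delta>(3-5) by auto
  next
    case False
    then consider "i < j" "j < k" | "i < k" "k < j" | "j < i" "i < k" | "j < k" "k < i" | "k < i" "i < j" | "k < j" "j < i"
      by linarith
    then show ?thesis
    proof cases
      case 1 then show ?thesis using lt i j k by simp
    next
      case 2 then show ?thesis using lt[of i k j] i j k \<delta>(2)[of "u i" "u j" "u k"] by simp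
    next
      case 3 then show ?thesis using lt[of j i k] i j k \<delta>(1)[of "u i" "u j" "u k"] by simp
    next
      case 4 then show ?thesis
        using lt[of j k i] i j k \<delta>(1)[of "u i" "u j" "u k"] \<delta>(2)[of "u j" "u i" "u k"] by simp
    next
      case 5 then show ?thesis
        using lt[of k i j] i j k \<delta>(2)[of "u i" "u j" "u k"] \<delta>(1)[of "u i" "u k" "u j"] by simp
    next
      case 6 then show ?thesis
        using lt[of k j i] i j k \<delta>(1)[of "u i" "u j" "u k"] \<delta>(2)[of "u j" "u i" "u k"] \<delta>(1)[of "u j" "u k" "u i"]
        by simp
    qed
  qed
  then show "\<psi> (u i) (u j) (u k) = \<psi>' (u i) (u j) (u k)" by (simp add: \<delta>_def blinfun.bilinear_simps)
qed

text \<open>The inclusion of g2 in so(7), for the metric that makes the frame orthonormal. The 35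
  equations, one for each increasing triple, split into eight groups involving disjoint sets of
  matrix entries: one for the diagonal and seven that each give three skewness relations.\<close>

lemma annihilator3_skew:
  assumes D: "D \<in> annihilator3 \<phi>" and ij: "i \<in> {1..7}" "j \<in> {1..7}"
  shows "\<eta> i (D (u j)) = - \<eta> j (D (u i))"
proof -
  have E: "\<phi> (u j) (u k) (D (u i)) - \<phi> (u i) (u k) (D (u j)) + \<phi> (u i) (u j) (D (u k)) = 0" for i j k
  proof -
    have "\<phi> (D (u i)) (u j) (u k) + \<phi> (u i) (D (u j)) (u k) + \<phi> (u i) (u j) (D (u k)) = 0"
      using D by (auto simp: annihilator3_def)
    then show ?thesis using phi_cyclic[of "D (u i)"] phi_alt(2)[of "u i" "D (u j)"] by simp
  qed
  \<comment> \<open>The seven triples of the standard form are the lines of a Fano plane. Each line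
    makes the sum of its three diagonal entries vanish, and the incidence matrix is
    invertible.\<close>
  have diag: "\<eta> 1 (D (u 1)) = 0" "\<eta> 2 (D (u 2)) = 0" "\<eta> 3 (D (u 3)) = 0" "\<eta> 4 (D (u 4)) = 0"
    "\<eta> 5 (D (u 5)) = 0" "\<eta> 6 (D (u 6)) = 0" "\<eta> 7 (D (u 7)) = 0"
    using E[of 1 2 7, unfolded phi_uu] E[of 1 3 5, unfolded phi_uu] E[of 1 4 6, unfolded phi_uu]
      E[of 2 3 6, unfolded phi_uu] E[of 2 4 5, unfolded phi_uu] E[of 3 4 7, unfolded phi_uu]
      E[of 5 6 7, unfolded phi_uu] by linarith+
  have skew1: "\<eta> 1 (D (u 2)) = - \<eta> 2 (D (u 1))"
    "\<eta> 3 (D (u 4)) = - \<eta> 4 (D (u 3))"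
    "\<eta> 5 (D (u 6)) = - \<eta> 6 (D (u 5))"
    using E[of 1 3 6, unfolded phi_uu] E[of 1 4 5, unfolded phi_uu] E[of 2 3 5, unfolded phi_uu]
      E[of 2 4 6, unfolded phi_uu]
    by linarith+
  have skew2: "\<eta> 1 (D (u 3)) = - \<eta> 3 (D (u 1))"
    "\<eta> 2 (D (u 4)) = - \<eta> 4 (D (u 2))"
    "\<eta> 6 (D (u 7)) = - \<eta> 7 (D (u 6))"
    using E[of 1 2 6, unfolded phi_uu] E[of 1 4 7, unfolded phi_uu] E[of 2 3 7, unfolded phi_uu]
      E[of 3 4 6, unfolded phi_uu]
    by linarith+
  have skew3: "\<eta> 1 (D (u 4)) = - \<eta> 4 (D (u 1))"
    "\<eta> 2 (D (u 3)) = - \<eta> 3 (D (u 2))"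
    "\<eta> 5 (D (u 7)) = - \<eta> 7 (D (u 5))"
    using E[of 1 2 5, unfolded phi_uu] E[of 1 3 7, unfolded phi_uu] E[of 2 4 7, unfolded phi_uu]
      E[of 3 4 5, unfolded phi_uu]
    by linarith+
  have skew4: "\<eta> 1 (D (u 5)) = - \<eta> 5 (D (u 1))"
    "\<eta> 2 (D (u 6)) = - \<eta> 6 (D (u 2))"
    "\<eta> 4 (D (u 7)) = - \<eta> 7 (D (u 4))"
    using E[of 1 2 4, unfolded phi_uu] E[of 1 6 7, unfolded phi_uu] E[of 2 5 7, unfolded phi_uu]
      E[of 4 5 6, unfolded phi_uu]
    by linarith+
  have skew5: "\<eta> 1 (D (u 6)) = - \<eta> 6 (D (u 1))"
    "\<eta> 2 (D (u 5)) = - \<eta> 5 (D (u 2))"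
    "\<eta> 3 (D (u 7)) = - \<eta> 7 (D (u 3))"
    using E[of 1 2 3, unfolded phi_uu] E[of 1 5 7, unfolded phi_uu] E[of 2 6 7, unfolded phi_uu]
      E[of 3 5 6, unfolded phi_uu]
    by linarith+
  have skew6: "\<eta> 1 (D (u 7)) = - \<eta> 7 (D (u 1))"
    "\<eta> 3 (D (u 6)) = - \<eta> 6 (D (u 3))"
    "\<eta> 4 (D (u 5)) = - \<eta> 5 (D (u 4))"
    using E[of 1 3 4, unfolded phi_uu] E[of 1 5 6, unfolded phi_uu] E[of 3 5 7, unfolded phi_uu]
      E[of 4 6 7, unfolded phi_uu]
    by linarith+
  have skew7: "\<eta> 2 (D (u 7)) = - \<eta> 7 (D (u 2))"
    "\<eta> 3 (D (u 5)) = - \<eta> 5 (D (u 3))"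
    "\<eta> 4 (D (u 6)) = - \<eta> 6 (D (u 4))"
    using E[of 2 3 4, unfolded phi_uu] E[of 2 5 6, unfolded phi_uu] E[of 3 6 7, unfolded phi_uu]
      E[of 4 5 7, unfolded phi_uu]
    by linarith+
  have "\<forall>i\<in>{1..7}. \<forall>j\<in>{1..7}. \<eta> i (D (u j)) = - \<eta> j (D (u i))"
    unfolding ball_1_7 by (simp add: diag skew1 skew2 skew3 skew4 skew5 skew6 skew7)
  then show ?thesis using ij by blast
qed

text \<open>A right inverse of the derivative of the \<open>GL(7)\<close>-orbit map through \<open>\<phi>\<close>; its values on the frame solve
  the linear system in the lemma \<open>infinitesimal_inverse\<close> below.\<close>

definition infinitesimal_column :: "'a trilin \<Rightarrow> nat \<Rightarrow> 'a" where
  "infinitesimal_column \<psi> m = (let t = \<lambda>i j k. \<psi> (u i) (u j) (u k) in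
    if m = 1 then (t 1 2 7 / 3 + t 1 3 5 / 3 - t 1 4 6 / 3 + t 2 3 6 / 6 + t 2 4 5 / 6
          - t 3 4 7 / 6 - t 5 6 7 / 6) *\<^sub>R u 1
        + (- t 1 3 6 / 2 - t 1 4 5 / 2 + t 2 3 5 / 2 - t 2 4 6 / 2) *\<^sub>R u 2
        + (t 1 2 6 / 2 + t 1 4 7 / 2 - t 2 3 7 / 2 - t 3 4 6 / 2) *\<^sub>R u 3
        + (t 1 2 5 / 2 - t 1 3 7 / 2 - t 2 4 7 / 2 - t 3 4 5 / 2) *\<^sub>R u 4
        + (- t 1 2 4 / 2 + t 1 6 7 / 2 - t 2 5 7 / 2 + t 4 5 6 / 2) *\<^sub>R u 5
        + (- t 1 2 3 / 2 - t 1 5 7 / 2 - t 2 6 7 / 2 + t 3 5 6 / 2) *\<^sub>R u 6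
        + (t 1 3 4 / 2 + t 1 5 6 / 2 + t 3 5 7 / 2 - t 4 6 7 / 2) *\<^sub>R u 7
    else if m = 2 then (t 1 2 7 / 3 - t 1 3 5 / 6 + t 1 4 6 / 6 - t 2 3 6 / 3 - t 2 4 5 / 3
          - t 3 4 7 / 6 - t 5 6 7 / 6) *\<^sub>R u 2
        + (t 1 2 5 / 2 + t 1 3 7 / 2 + t 2 4 7 / 2 - t 3 4 5 / 2) *\<^sub>R u 3
        + (- t 1 2 6 / 2 + t 1 4 7 / 2 - t 2 3 7 / 2 + t 3 4 6 / 2) *\<^sub>R u 4
        + (- t 1 2 3 / 2 + t 1 5 7 / 2 + t 2 6 7 / 2 + t 3 5 6 / 2) *\<^sub>R u 5
        + (t 1 2 4 / 2 + t 1 6 7 / 2 - t 2 5 7 / 2 - t 4 5 6 / 2) *\<^sub>R u 6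
        + (t 2 3 4 / 2 + t 2 5 6 / 2 - t 3 6 7 / 2 - t 4 5 7 / 2) *\<^sub>R u 7
    else if m = 3 then (- t 1 2 7 / 6 + t 1 3 5 / 3 + t 1 4 6 / 6 - t 2 3 6 / 3 + t 2 4 5 / 6
          + t 3 4 7 / 3 - t 5 6 7 / 6) *\<^sub>R u 3
        + (- t 1 3 6 / 2 + t 1 4 5 / 2 - t 2 3 5 / 2 - t 2 4 6 / 2) *\<^sub>R u 4
        + (t 2 3 4 / 2 - t 2 5 6 / 2 + t 3 6 7 / 2 - t 4 5 7 / 2) *\<^sub>R u 5
        + (t 1 3 4 / 2 - t 1 5 6 / 2 - t 3 5 7 / 2 - t 4 6 7 / 2) *\<^sub>R u 6
        + t 3 5 6 *\<^sub>R u 7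
    else if m = 4 then (- t 1 2 7 / 6 - t 1 3 5 / 6 - t 1 4 6 / 3 + t 2 3 6 / 6 - t 2 4 5 / 3
          + t 3 4 7 / 3 - t 5 6 7 / 6) *\<^sub>R u 4
        + t 4 6 7 *\<^sub>R u 5
        + (- t 4 5 7) *\<^sub>R u 6
        + t 4 5 6 *\<^sub>R u 7
    else if m = 5 then (t 1 3 4 / 2 - t 1 5 6 / 2 + t 3 5 7 / 2 - t 4 6 7 / 2) *\<^sub>R u 4
        + (- t 1 2 7 / 6 + t 1 3 5 / 3 + t 1 4 6 / 6 + t 2 3 6 / 6 - t 2 4 5 / 3 - t 3 4 7 / 6
          + t 5 6 7 / 3) *\<^sub>R u 5
        + (t 1 3 6 / 2 - t 1 4 5 / 2 - t 2 3 5 / 2 + t 2 4 6 / 2) *\<^sub>R u 6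
        + t 3 4 5 *\<^sub>R u 7
    else if m = 6 then (- t 2 3 4 / 2 + t 2 5 6 / 2 + t 3 6 7 / 2 + t 4 5 7 / 2) *\<^sub>R u 4
        + (- t 2 4 6) *\<^sub>R u 5
        + (- t 1 2 7 / 6 - t 1 3 5 / 6 - t 1 4 6 / 3 - t 2 3 6 / 3 + t 2 4 5 / 6 - t 3 4 7 / 6
          + t 5 6 7 / 3) *\<^sub>R u 6
        + t 3 4 6 *\<^sub>R u 7
    else (t 1 2 3 / 2 - t 1 5 7 / 2 + t 2 6 7 / 2 - t 3 5 6 / 2) *\<^sub>R u 3
        + (t 1 2 4 / 2 + t 1 6 7 / 2 + t 2 5 7 / 2 - t 4 5 6 / 2) *\<^sub>R u 4
        + (t 1 2 5 / 2 + t 1 3 7 / 2 - t 2 4 7 / 2 - t 3 4 5 / 2) *\<^sub>R u 5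
        + (t 1 2 6 / 2 - t 1 4 7 / 2 - t 2 3 7 / 2 - t 3 4 6 / 2) *\<^sub>R u 6
        + (t 1 2 7 / 3 - t 1 3 5 / 6 + t 1 4 6 / 6 + t 2 3 6 / 6 + t 2 4 5 / 6 + t 3 4 7 / 3
          + t 5 6 7 / 3) *\<^sub>R u 7)"

definition infinitesimal_inverse :: "'a trilin \<Rightarrow> 'a \<Rightarrow>\<^sub>L 'a" where
  "infinitesimal_inverse \<psi> = (\<Sum>m=1..7. blinfun_scaleR_left (infinitesimal_column \<psi> m) o\<^sub>L \<eta> m)"

lemma infinitesimal_inverse_u: "m \<in> {1..7} \<Longrightarrow> infinitesimal_inverse \<psi> (u m) = infinitesimal_column \<psi> m"
  by (simp add: infinitesimal_inverse_def blinfun.bilinear_simps if_distrib[of "\<lambda>a. a *\<^sub>R _"] cong: if_cong)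

lemma linear_infinitesimal_inverse: "linear infinitesimal_inverse"
proof -
  have 1: "linear (\<lambda>\<psi> :: 'a trilin. \<psi> x y z)" for x y z
    by (rule linearI) (simp_all add: blinfun.bilinear_simps)
  have 2: "linear (\<lambda>\<psi>. f \<psi> / c)" if "linear f" for f :: "'a trilin \<Rightarrow> real" and c
    by (rule linearI) (simp_all add: linear_add[OF that] linear_scale[OF that] add_divide_distrib)
  have 3: "linear (\<lambda>\<psi>. f \<psi> *\<^sub>R v)" if "linear f" for f :: "'a trilin \<Rightarrow> real" and v :: 'a
    by (rule linearI) (simp_all add: linear_add[OF that] linear_scale[OF that] algebra_simps)
  have 4: "linear (\<lambda>\<psi>. blinfun_scaleR_left (f \<psi>) o\<^sub>L w)" if "linear f" for f :: "'a trilin \<Rightarrow> 'a" and w :: "'a \<Rightarrow>\<^sub>L real"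
    by (rule linearI; rule blinfun_eqI) (simp_all add: linear_add[OF that] linear_scale[OF that] blinfun.bilinear_simps algebra_simps)
  have 5: "linear (\<lambda>\<psi>. if b then f \<psi> else g \<psi>)" if "linear f" "linear g" for b and f g :: "'a trilin \<Rightarrow> 'a"
    using that by (cases b) simp_all
  have "linear (\<lambda>\<psi>. infinitesimal_column \<psi> m)" for m
    unfolding infinitesimal_column_def Let_def
    by (intro 5 linear_compose_add linear_compose_sub linear_compose_neg 1 2 3)
  then show ?thesis
    unfolding infinitesimal_inverse_def by (intro linear_compose_sum ballI 4)
qed

text \<open>Surjectivity of the infinitesimal action on 3-forms, checked on increasing triples. It
  matches the count 49 - 14 = 35 and is the reason why the orbit of \<open>\<phi>\<close> is
  open.\<close>

lemma infinitesimal_inverse: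
  assumes \<psi>: "\<psi> \<in> forms3"
  defines "D \<equiv> infinitesimal_inverse \<psi>"
  shows "\<phi> (D x) y z + \<phi> x (D y) z + \<phi> x y (D z) = \<psi> x y z"
proof -
  have lin: "linear (blinfun_apply D)" by (simp add: blinfun.bounded_linear_right bounded_linear.linear)
  obtain \<psi>' :: "'a trilin" where \<psi>': "\<And>x y z. \<psi>' x y z = \<phi> (D x) y z + \<phi> x (D y) z + \<phi> x y (D z)"
    by (rule trilin_exists[of "\<lambda>x y z. \<phi> (D x) y z + \<phi> x (D y) z + \<phi> x y (D z)"])
      (auto intro!: linearI simp: blinfun.bilinear_simps algebra_simps)
  have "\<psi>' \<in> forms3"
    using phi_alt(1)[of _ "D _"] phi_alt(2)[of _ "D _"] phi_alt(2)[of _ _ "D _"]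
    by (auto simp: forms3_def \<psi>' phi wedge3_def algebra_simps)
  have E: "\<psi>' (u i) (u j) (u k) = \<phi> (u j) (u k) (D (u i)) - \<phi> (u i) (u k) (D (u j)) + \<phi> (u i) (u j) (D (u k))" for i j k
    using phi_cyclic[of "D (u i)"] phi_alt(2)[of "u i" "D (u j)"] by (simp add: \<psi>')
  have "\<psi>' (u i) (u j) (u k) = \<psi> (u i) (u j) (u k)" if "1 \<le> i" "i < j" "j < k" "k \<le> 7" for i j k
  proof -
    have "\<forall>k\<in>{1..7}. \<forall>j\<in>{1..7}. \<forall>i\<in>{1..7}. i < j \<longrightarrow> j < k \<longrightarrow> \<psi>' (u i) (u j) (u k) = \<psi> (u i) (u j) (u k)"
      unfolding ball_1_7
      by (simp add: E phi_uu D_def infinitesimal_inverse_u infinitesimal_column_def Let_def blinfun.bilinear_simps)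
    then show ?thesis using that by auto
  qed
  then have "\<psi>' = \<psi>" using \<open>\<psi>' \<in> forms3\<close> \<psi> by (intro forms3_frame_eqI)
  then show ?thesis using \<psi>' by metis
qed

end

section \<open>Closed G2-structures form an open set of closed forms\<close>

definition trilin_coords :: "'a::euclidean_space trilin \<Rightarrow> real ^ 'a basis_index ^ 'a basis_index ^ 'a basis_index" where
  "trilin_coords \<psi> = (\<chi> i j k. \<psi> (bas i) (bas j) (bas k))"

lemma euclidean_iso_trilin_coords: "euclidean_iso trilin_coords"
  using euclidean_iso_trilinear by (simp add: trilin_coords_def[abs_def])

lemma vec_lambda_eq_sum_axis: "(\<chi> i. f i) = (\<Sum>i\<in>UNIV. axis i (f i :: 'e::euclidean_space))"
proof (rule vec_eq_iff[THEN iffD2], rule allI)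
  fix j
  have "(\<Sum>i\<in>UNIV. axis i (f i)) $ j = (\<Sum>i\<in>UNIV. if j = i then f i else 0)"
    by (simp only: sum_component axis_def vec_lambda_beta eq_commute)
  then show "(\<chi> i. f i) $ j = (\<Sum>i\<in>UNIV. axis i (f i)) $ j" by simp
qed

lemma has_derivative_vec_lambda:
  fixes f :: "'n::finite \<Rightarrow> 'b::real_normed_vector \<Rightarrow> 'e::euclidean_space"
  assumes "\<And>i. (f i has_derivative f' i) F"
  shows "((\<lambda>x. \<chi> i. f i x) has_derivative (\<lambda>h. \<chi> i. f' i h)) F"
proof -
  have "linear (\<lambda>x. axis i x :: 'e ^ 'n)" for i
    by (rule linearI) (simp_all add: axis_def vec_eq_iff)
  then have ax: "bounded_linear (\<lambda>x. axis i x :: 'e ^ 'n)" for i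
    by (simp add: linear_conv_bounded_linear)
  show ?thesis
    unfolding vec_lambda_eq_sum_axis
    by (rule has_derivative_sum) (rule bounded_linear.has_derivative[OF ax assms])
qed

lemma bij_near_id_blinfun:
  fixes A :: "'a::euclidean_space \<Rightarrow>\<^sub>L 'a"
  assumes "norm (A - id_blinfun) < 1"
  shows "bij (blinfun_apply A)"
proof -
  have "x = y" if "A x = A y" for x y
  proof (rule ccontr)
    assume "x \<noteq> y"
    have "(A - id_blinfun) (x - y) = - (x - y)" using that by (simp add: blinfun.bilinear_simps)
    then have "norm (x - y) = norm ((A - id_blinfun) (x - y))" by (simp only: norm_minus_cancel)
    also have "\<dots> \<le> norm (A - id_blinfun) * norm (x - y)" by (rule norm_blinfun)
    also have "\<dots> < 1 * norm (x - y)" using \<open>x \<noteq> y\<close> assms by (intro mult_strict_right_mono) auto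
    finally show False by simp
  qed
  then have "inj (blinfun_apply A)" by (rule injI)
  moreover have "linear (blinfun_apply A)" by (simp add: blinfun.bounded_linear_right bounded_linear.linear)
  ultimately show ?thesis by (simp add: bij_def linear_injective_imp_surjective)
qed

lemma (in G2_frame) G2_structure_pullback:
  fixes \<psi> :: "'a trilin" and A :: "'a \<Rightarrow>\<^sub>L 'a"
  assumes A: "bij (blinfun_apply A)" and \<psi>: "\<And>x y z. \<psi> x y z = \<phi> (A x) (A y) (A z)"
  shows "G2_structure \<psi>"
proof -
  define h where "h = inv_into UNIV (blinfun_apply A)"
  have h: "h (A x) = x" "A (h x) = x" for x
    using A by (auto simp: h_def bij_is_inj bij_is_surj surj_f_inv_f)
  have "G2_frame \<psi> (\<lambda>i. h (u i)) (\<lambda>i. \<eta> i o\<^sub>L A)"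
  proof
    show "(\<eta> i o\<^sub>L A) (h (u j)) = (if i = j then 1 else 0)" if "i \<in> {1..7}" "j \<in> {1..7}" for i j
      using that by (simp add: h)
    show "x = (\<eta> 1 o\<^sub>L A) x *\<^sub>R h (u 1) + (\<eta> 2 o\<^sub>L A) x *\<^sub>R h (u 2) + (\<eta> 3 o\<^sub>L A) x *\<^sub>R h (u 3)
      + (\<eta> 4 o\<^sub>L A) x *\<^sub>R h (u 4) + (\<eta> 5 o\<^sub>L A) x *\<^sub>R h (u 5) + (\<eta> 6 o\<^sub>L A) x *\<^sub>R h (u 6)
      + (\<eta> 7 o\<^sub>L A) x *\<^sub>R h (u 7)" (is "x = ?s") for x
    proof -
      have "A x = A ?s" by (subst expand[of "A x"]) (simp add: blinfun.bilinear_simps h)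
      from arg_cong[OF this, of h] show ?thesis by (simp only: h(1))
    qed
  qed (simp add: \<psi> phi wedge3_def)
  then show ?thesis using G2_structure_iff_frame by blast
qed

text \<open>The map taking \<open>A\<close> to the pull-back of \<open>\<phi>\<close> by
  \<open>A\<close> has a derivative at the identity with a linear right inverse on 3-forms. An open
  mapping theorem then covers a neighbourhood of \<open>\<phi>\<close> by pull-backs along
  invertible maps.\<close>

lemma G2_structure_openin_forms3:
  assumes "G2_structure (\<phi> :: 'a::euclidean_space trilin)"
  shows "\<exists>T. open T \<and> \<phi> \<in> T \<and> (\<forall>\<psi>\<in>T \<inter> forms3. G2_structure \<psi>)"
proof -
  obtain u \<eta> where "G2_frame \<phi> u \<eta>" using assms G2_structure_iff_frame by blast
  then interpret G2_frame \<phi> u \<eta> .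
  let ?c = "trilin_coords :: 'a trilin \<Rightarrow> _"
  note c = euclidean_isoD[OF euclidean_iso_trilin_coords]
  let ?W = "?c ` forms3"
  have "subspace ?W" using linear_subspace_image[OF c(1) subspace_forms3] .
  then obtain P where P: "linear P" "\<And>x. P x \<in> ?W" "\<And>x k. k \<in> ?W \<Longrightarrow> k \<bullet> (x - P x) = 0"
    using orthogonal_projection_exists by metis
  have PW: "P w = w" if "w \<in> ?W" for w
  proof -
    have "w - P w \<in> ?W" using that P(2) \<open>subspace ?W\<close> by (simp add: subspace_diff)
    then show ?thesis using P(3)[of "w - P w" w] by simp
  qed
  define F where "F A = (\<chi> i j k. \<phi> (A (bas i)) (A (bas j)) (A (bas k)))" for A :: "'a \<Rightarrow>\<^sub>L 'a"
  define F' where "F' D = (\<chi> i j k. \<phi> (D (bas i)) (bas j) (bas k) + \<phi> (bas i) (D (bas j)) (bas k)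
      + \<phi> (bas i) (bas j) (D (bas k)))" for D :: "'a \<Rightarrow>\<^sub>L 'a"
  have ev: "((\<lambda>A. blinfun_apply A x) has_derivative (\<lambda>D. blinfun_apply D x)) (at A)" for x :: 'a and A :: "'a \<Rightarrow>\<^sub>L 'a"
    by (rule bounded_linear_imp_has_derivative[OF blinfun.bounded_linear_left])
  have dF: "(F has_derivative F') (at id_blinfun)"
  proof -
    have "((\<lambda>A :: 'a \<Rightarrow>\<^sub>L 'a. \<phi> (A x) (A y) (A z)) has_derivative
        (\<lambda>D :: 'a \<Rightarrow>\<^sub>L 'a. \<phi> (D x) y z + \<phi> x (D y) z + \<phi> x y (D z))) (at id_blinfun)" for x y z
      by (rule has_derivative_eq_rhs[OF blinfun.FDERIV[OF blinfun.FDERIV[OF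
            bounded_linear.has_derivative[OF blinfun.bounded_linear_right ev] ev] ev]])
        (simp add: fun_eq_iff blinfun.bilinear_simps)
    then show ?thesis
      unfolding F_def[abs_def] F'_def[abs_def] by (intro has_derivative_vec_lambda)
  qed
  have contF: "continuous_on S F" for S
    unfolding F_def[abs_def]
    by (intro continuous_on_vec_lambda blinfun.continuous_on continuous_on_id continuous_on_const)
  have FW: "F A \<in> ?W" for A
  proof -
    obtain \<psi> :: "'a trilin" where \<psi>: "\<And>x y z. \<psi> x y z = \<phi> (A x) (A y) (A z)"
      by (rule trilin_exists[of "\<lambda>x y z. \<phi> (blinfun_apply A x) (A y) (A z)"])
        (auto intro!: linearI simp: blinfun.bilinear_simps)
    then have "\<psi> \<in> forms3" by (simp add: forms3_def phi_alt(3-5))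
    moreover have "?c \<psi> = F A" by (simp add: trilin_coords_def F_def \<psi>)
    ultimately show ?thesis by (metis imageI)
  qed
  \<comment> \<open>The orbit map takes values in the proper subspace of alternating forms. The
    extra variable \<open>s\<close> fills its orthogonal complement, so that the derivative reaches
    the whole coordinate space.\<close>
  define f where "f = (\<lambda>(A, s). F A + (s - P s))"
  define f' where "f' = (\<lambda>(D, s). F' D + (s - P s))"
  define g' where "g' t = (infinitesimal_inverse (inv_into UNIV ?c (P t)), t - P t)" for t
  have bP: "bounded_linear P" using P(1) by (simp add: linear_conv_bounded_linear)
  have df: "(f has_derivative f') (at (id_blinfun, 0))"
  proof -
    have 1: "((\<lambda>p. F (fst p)) has_derivative (\<lambda>p. F' (fst p))) (at (id_blinfun :: 'a \<Rightarrow>\<^sub>L 'a, 0 :: real ^ 'a basis_index ^ 'a basis_index ^ 'a basis_index))"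
      by (rule has_derivative_compose[OF has_derivative_fst[OF has_derivative_ident]]) (simp add: dF)
    have 2: "bounded_linear (\<lambda>p :: ('a \<Rightarrow>\<^sub>L 'a) \<times> (real ^ 'a basis_index ^ 'a basis_index ^ 'a basis_index). snd p - P (snd p))"
      by (intro bounded_linear_sub bounded_linear_snd bounded_linear_compose[OF bP])
    show ?thesis
      using has_derivative_add[OF 1 bounded_linear_imp_has_derivative[OF 2]]
      by (simp add: f_def f'_def case_prod_unfold)
  qed
  have lg: "bounded_linear g'"
  proof -
    have "linear (\<lambda>t. infinitesimal_inverse (inv_into UNIV ?c (P t)))"
      using linear_compose[OF linear_compose[OF P(1) c(7)] linear_infinitesimal_inverse] by (simp add: o_def)
    then have "bounded_linear (\<lambda>t. infinitesimal_inverse (inv_into UNIV ?c (P t)))"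
      by (simp add: linear_conv_bounded_linear)
    then show ?thesis
      unfolding g'_def[abs_def]
      by (rule bounded_linear_Pair[OF _ bounded_linear_sub[OF bounded_linear_ident bP]])
  qed
  have fg: "f' (g' t) = t" for t
  proof -
    obtain \<psi> where \<psi>: "\<psi> \<in> forms3" "P t = ?c \<psi>" using P(2)[of t] by blast
    have "F' (infinitesimal_inverse \<psi>) = P t"
      by (simp add: F'_def infinitesimal_inverse[OF \<psi>(1)] \<psi>(2) trilin_coords_def)
    moreover have "P (t - P t) = 0" using PW[OF P(2)[of t]] by (simp add: linear_diff[OF P(1)])
    ultimately show ?thesis by (simp add: f'_def g'_def \<psi>(2) c(5))
  qed
  \<comment> \<open>Radius 1 keeps every \<open>A\<close> invertible, by
    \<open>bij_near_id_blinfun\<close>.\<close>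
  define T where "T = ball (id_blinfun :: 'a \<Rightarrow>\<^sub>L 'a) 1 \<times> (UNIV :: (real ^ 'a basis_index ^ 'a basis_index ^ 'a basis_index) set)"
  have openT: "open T" unfolding T_def by (intro open_Times) auto
  have fst_T: "(id_blinfun, 0) \<in> T" by (simp add: T_def)
  have "f (id_blinfun, 0) \<in> interior (f ` T)"
  proof (rule sussmann_open_mapping[OF open_UNIV _ UNIV_I df lg])
    show "continuous_on UNIV f"
      unfolding f_def case_prod_unfold
      by (rule continuous_on_add[OF continuous_on_compose2[OF contF continuous_on_fst[OF continuous_on_id] subset_UNIV]
            continuous_on_diff[OF continuous_on_snd[OF continuous_on_id]
              bounded_linear.continuous_on[OF bP continuous_on_snd[OF continuous_on_id]]]])
    show "f' \<circ> g' = id" by (simp add: fun_eq_iff fg)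
    show "(id_blinfun, 0) \<in> interior T" using openT fst_T by (simp add: interior_open)
  qed simp
  moreover have "f (id_blinfun, 0) = ?c \<phi>"
    by (simp add: f_def F_def trilin_coords_def linear_0[OF P(1)])
  ultimately have "?c \<phi> \<in> interior (f ` T)" by simp
  define Q where "Q = ?c -` interior (f ` T)"
  have "open Q" unfolding Q_def by (rule open_vimage[OF open_interior c(3)])
  moreover have "\<phi> \<in> Q" using \<open>?c \<phi> \<in> _\<close> by (simp add: Q_def)
  moreover have "G2_structure \<psi>" if \<psi>: "\<psi> \<in> Q" "\<psi> \<in> forms3" for \<psi>
  proof -
    have "?c \<psi> \<in> f ` T" using \<psi>(1) interior_subset by (auto simp: Q_def)
    then obtain A s where As: "?c \<psi> = F A + (s - P s)" "norm (A - id_blinfun) < 1"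
      by (auto simp: f_def T_def dist_norm norm_minus_commute)
    \<comment> \<open>For an alternating form the projection is the identity, so the complementary
      summand disappears and a pull-back of \<open>\<phi>\<close> remains.\<close>
    have "P (?c \<psi>) = F A + (P s - P (P s))"
      unfolding As(1) by (simp add: linear_add[OF P(1)] linear_diff[OF P(1)] PW[OF FW])
    then have "?c \<psi> = F A" using PW[OF P(2)[of s]] PW[of "?c \<psi>"] \<psi>(2) by simp
    moreover obtain \<psi>' :: "'a trilin" where \<psi>': "\<And>x y z. \<psi>' x y z = \<phi> (A x) (A y) (A z)"
      by (rule trilin_exists[of "\<lambda>x y z. \<phi> (blinfun_apply A x) (A y) (A z)"])
        (auto intro!: linearI simp: blinfun.bilinear_simps)
    moreover have "?c \<psi>' = F A" by (simp add: trilin_coords_def F_def \<psi>')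
    ultimately have "\<psi> = \<psi>'" using c(2) by (metis injD)
    then show ?thesis using G2_structure_pullback[OF bij_near_id_blinfun[OF As(2)] \<psi>'] by simp
  qed
  ultimately show ?thesis by blast
qed

lemma d3_linear: "d3 br (\<phi> + \<psi>) x y z w = d3 br \<phi> x y z w + d3 br \<psi> x y z w"
    "d3 br (a *\<^sub>R \<phi>) x y z w = a * d3 br \<phi> x y z w" "d3 br 0 x y z w = 0"
  by (simp_all add: d3_def blinfun.add_left blinfun.scaleR_left algebra_simps)

lemma subspace_closed_forms3: "subspace (closed_forms3 br)"
  using subspace_forms3 unfolding subspace_def closed_forms3_def by (auto simp: d3_linear)

lemma manifold_dim_closed_G2:
  assumes "closed_G2 br \<noteq> {}"
  shows "manifold_dim (closed_G2 br) = dim (closed_forms3 br)"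
proof (rule manifold_dim_eq[OF locally_Euclidean_openin_subspace[OF euclidean_iso_trilin_coords subspace_closed_forms3] assms])
  show "openin (top_of_set (closed_forms3 br)) (closed_G2 br)"
    unfolding openin_subopen[of _ "closed_G2 br"]
  proof
    fix \<phi> assume \<phi>: "\<phi> \<in> closed_G2 br"
    then obtain T where T: "open T" "\<phi> \<in> T" "\<forall>\<psi>\<in>T \<inter> forms3. G2_structure \<psi>"
      using G2_structure_openin_forms3 unfolding closed_G2_def by blast
    have "closed_forms3 br \<inter> T \<subseteq> closed_G2 br" using T(3) by (auto simp: closed_G2_def closed_forms3_def)
    moreover have "openin (top_of_set (closed_forms3 br)) (closed_forms3 br \<inter> T)" using T(1) by (rule openin_open_Int)
    moreover have "\<phi> \<in> closed_forms3 br \<inter> T" using \<phi> T(2) by (simp add: closed_G2_def)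
    ultimately show "\<exists>T. openin (top_of_set (closed_forms3 br)) T \<and> \<phi> \<in> T \<and> T \<subseteq> closed_G2 br" by blast
  qed
qed

section \<open>The moduli dimension and the third Betti number\<close>

lemma dim_mono_iso:
  fixes c :: "'b::real_normed_vector \<Rightarrow> 'e::euclidean_space" and S T :: "'b set"
  assumes "euclidean_iso c" "S \<subseteq> T"
  shows "dim S \<le> dim T"
proof -
  have "dim (c ` S) \<le> dim (c ` T)" using assms(2) by (intro dim_subset image_mono)
  then show ?thesis by (simp add: dim_euclidean_iso[OF assms(1)])
qed

lemma dim_independent_subspaces_le:
  fixes c :: "'b::real_normed_vector \<Rightarrow> 'e::euclidean_space" and S T U :: "'b set"
  assumes c: "euclidean_iso c" and S: "subspace S" and T: "subspace T" and U: "subspace U"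
    and sub: "S \<subseteq> U" "T \<subseteq> U" and int: "S \<inter> T \<subseteq> {0}"
  shows "dim S + dim T \<le> dim U"
proof -
  note lc = euclidean_isoD(1)[OF c]
  have "c ` S \<inter> c ` T \<subseteq> {0}"
    using int euclidean_isoD(2)[OF c] linear_0[OF lc] by (auto dest: injD)
  then have z: "dim (c ` S \<inter> c ` T) = 0" by simp
  have sc: "subspace (c ` S)" "subspace (c ` T)" "subspace (c ` U)"
    using lc S T U by (simp_all add: linear_subspace_image)
  have "dim (c ` S) + dim (c ` T) = dim {x + y |x y. x \<in> c ` S \<and> y \<in> c ` T}"
    using dim_sums_Int[OF sc(1,2)] z by linarith
  also have "\<dots> \<le> dim (c ` U)"
    using sub sc(3) by (intro dim_subset) (auto intro: subspace_add)
  finally show ?thesis by (simp add: dim_euclidean_iso[OF c])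
qed

lemma dim_le_DIM:
  fixes f :: "'b::real_vector \<Rightarrow> 'e::euclidean_space"
  assumes "linear f" "subspace B" "\<And>x. x \<in> B \<Longrightarrow> f x = 0 \<Longrightarrow> x = 0"
  shows "dim B \<le> DIM('e)"
proof -
  have "inj_on f B"
    using assms by (simp add: linear_inj_on_iff_eq_0)
  then have "dim (f ` B) = dim B"
    using assms(1,2) by (intro dim_injective_linear_image) (simp_all add: span_eq_iff[THEN iffD2])
  then show ?thesis by (metis dim_subset_UNIV)
qed

lemma DIM_le_dim:
  fixes f :: "'e::euclidean_space \<Rightarrow> 'b::real_normed_vector" and c :: "'b \<Rightarrow> 'd::euclidean_space"
  assumes c: "euclidean_iso c" and "linear f" "\<And>x. f x = 0 \<Longrightarrow> x = 0" "range f \<subseteq> B"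
  shows "DIM('e) \<le> dim B"
proof -
  have "inj f" using assms(2,3) by (simp add: linear_injective_0)
  then have "dim (range f) = DIM('e)"
    using assms(2) by (subst dim_injective_linear_image) auto
  then show ?thesis using dim_mono_iso[OF c assms(4)] by simp
qed

lemma d2_linear: "d2 br (\<omega> + \<omega>') x y z = d2 br \<omega> x y z + d2 br \<omega>' x y z"
    "d2 br (a *\<^sub>R \<omega>) x y z = a * d2 br \<omega> x y z" "d2 br 0 x y z = 0"
  by (simp_all add: d2_def blinfun.add_left blinfun.scaleR_left algebra_simps)

lemma subspace_forms2: "subspace forms2"
  unfolding subspace_def forms2_def by (auto simp: blinfun.bilinear_simps)

lemma subspace_exact_forms3: "subspace (exact_forms3 br)"
proof (rule subspaceI)
  show "0 \<in> exact_forms3 br"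
    unfolding exact_forms3_def
    by (auto simp: subspace_0 subspace_forms3 subspace_forms2 d2_linear intro!: bexI[of _ 0])
next
  fix \<phi> \<psi> assume "\<phi> \<in> exact_forms3 br" "\<psi> \<in> exact_forms3 br"
  then obtain \<omega> \<omega>' where "\<phi> \<in> forms3" "\<psi> \<in> forms3" "\<omega> \<in> forms2" "\<omega>' \<in> forms2"
    "\<forall>x y z. \<phi> x y z = d2 br \<omega> x y z" "\<forall>x y z. \<psi> x y z = d2 br \<omega>' x y z"
    unfolding exact_forms3_def by blast
  then show "\<phi> + \<psi> \<in> exact_forms3 br"
    unfolding exact_forms3_def
    by (auto simp: d2_linear blinfun.add_left subspace_add[OF subspace_forms3] subspace_add[OF subspace_forms2]
        intro!: bexI[of _ "\<omega> + \<omega>'"])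
next
  fix a \<phi> assume "\<phi> \<in> exact_forms3 br"
  then obtain \<omega> where "\<phi> \<in> forms3" "\<omega> \<in> forms2" "\<forall>x y z. \<phi> x y z = d2 br \<omega> x y z"
    unfolding exact_forms3_def by blast
  then show "a *\<^sub>R \<phi> \<in> exact_forms3 br"
    unfolding exact_forms3_def
    by (auto simp: d2_linear blinfun.scaleR_left subspace_scale[OF subspace_forms3] subspace_scale[OF subspace_forms2]
        intro!: bexI[of _ "a *\<^sub>R \<omega>"])
qed

locale lie =
  fixes br :: "'a::euclidean_space \<Rightarrow> 'a \<Rightarrow> 'a"
  assumes lie_algebra: "lie_algebra br"
begin

lemma bilinear: "bilinear br" and br_self [simp]: "br x x = 0"
  and jacobi: "br x (br y z) + br y (br z x) + br z (br x y) = 0"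
  using lie_algebra by (auto simp: lie_algebra_def)

lemmas br_simps =
  bilinear_ladd[OF bilinear] bilinear_radd[OF bilinear] bilinear_lmul[OF bilinear] bilinear_rmul[OF bilinear]
  bilinear_lneg[OF bilinear] bilinear_rneg[OF bilinear] bilinear_lsub[OF bilinear] bilinear_rsub[OF bilinear]
  bilinear_lzero[OF bilinear] bilinear_rzero[OF bilinear]

lemma linear_br: "linear (br x)" "linear (\<lambda>x. br x y)"
  using bilinear by (auto simp: bilinear_def)

lemma br_antisym: "br x y = - br y x"
proof -
  have "br (x + y) (x + y) = 0" by (rule br_self)
  then show ?thesis unfolding br_simps by (simp add: eq_neg_iff_add_eq_0 add.commute)
qed

text \<open>This is \<open>d \<circ> d = 0\<close>. Terms with a double bracket cancel by the Jacobi
  identity for the four triples of arguments, and terms with two separate brackets cancel in pairs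
  by antisymmetry of \<open>\<omega>\<close>.\<close>

lemma exact_forms3_subset_closed: "exact_forms3 br \<subseteq> closed_forms3 br"
proof
  fix \<phi> assume "\<phi> \<in> exact_forms3 br"
  then obtain \<omega> where \<phi>: "\<phi> \<in> forms3" "\<omega> \<in> forms2" "\<And>x y z. \<phi> x y z = d2 br \<omega> x y z"
    unfolding exact_forms3_def by blast
  have \<omega>: "\<omega> a b = - \<omega> b a" for a b
  proof -
    have "\<omega> (a + b) (a + b) = 0" "\<omega> a a = 0" "\<omega> b b = 0" using \<phi>(2) by (auto simp: forms2_def)
    then show ?thesis by (simp add: blinfun.bilinear_simps)
  qed
  have "d3 br \<phi> x y z w = 0" for x y z w
  proof -
    have j: "\<omega> (br (br a b) c) e + \<omega> (br (br b c) a) e + \<omega> (br (br c a) b) e = 0" for a b c e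
    proof -
      have "br (br a b) c + br (br b c) a + br (br c a) b = - (br a (br b c) + br b (br c a) + br c (br a b))"
        unfolding br_antisym[of "br a b" c] br_antisym[of "br b c" a] br_antisym[of "br c a" b] by simp
      then have "br (br a b) c + br (br b c) a + br (br c a) b = 0" by (simp only: jacobi minus_zero)
      from arg_cong[OF this, of "\<lambda>v. \<omega> v e"] show ?thesis by (simp add: blinfun.bilinear_simps)
    qed
    have n: "\<omega> (br (br a b) c) e = - \<omega> (br (br b a) c) e" for a b c e
      using br_antisym[of a b] by (simp add: br_simps blinfun.bilinear_simps)
    show ?thesis
      unfolding d3_def \<phi>(3) d2_def
      using j[of x y z w] j[of x y w z] j[of x z w y] j[of y z w x]
        n[of x z y w] n[of x w y z] n[of x w z y] n[of y w z x]
        \<omega>[of "br x y" "br z w"] \<omega>[of "br x z" "br y w"] \<omega>[of "br x w" "br y z"]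
      by linarith
  qed
  then show "\<phi> \<in> closed_forms3 br" using \<phi>(1) by (simp add: closed_forms3_def)
qed

lemma orbit_dim_eq:
  "orbit_dim br \<phi> = int (dim (derivations br)) - int (dim (derivations br \<inter> annihilator3 \<phi>))"
  by (simp add: orbit_dim_def manifold_dim_Aut[OF bilinear] manifold_dim_stabilizer[OF bilinear])

lemma orbit_dim_bounds: "0 \<le> orbit_dim br \<phi>" "orbit_dim br \<phi> \<le> int (dim (derivations br))"
  using dim_mono_iso[OF euclidean_iso_endomorphism, of "derivations br \<inter> annihilator3 \<phi>" "derivations br"]
  by (simp_all add: orbit_dim_eq)

text \<open>Orbit dimensions are integers between 0 and the dimension of the derivation algebra, so
  the maximum over infinitely many forms is attained.\<close>

lemma finite_orbit_dims: "finite (orbit_dim br ` A)"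
  by (rule finite_subset[of _ "{0..int (dim (derivations br))}"]) (use orbit_dim_bounds in auto)

text \<open>The space \<open>T\<close> acts freely to first order at \<open>\<phi>\<close>, so the
  orbit of \<open>\<phi>\<close> has at least its dimension. One such form suffices, because the
  largest orbit decides the moduli dimension.\<close>

lemma moduli_dim_less_betti3:
  assumes \<phi>: "\<phi> \<in> closed_G2 br" and T: "subspace T" "T \<subseteq> derivations br" "T \<inter> annihilator3 \<phi> \<subseteq> {0}"
    and less: "dim (exact_forms3 br) < dim T"
  shows "moduli_dim br < int (betti3 br)"
proof -
  have "dim T + dim (derivations br \<inter> annihilator3 \<phi>) \<le> dim (derivations br)"
    using T by (intro dim_independent_subspaces_le[OF euclidean_iso_endomorphism] subspace_inter
        subspace_derivations[OF bilinear] subspace_annihilator3) auto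
  then have "int (dim T) \<le> orbit_dim br \<phi>" by (simp add: orbit_dim_eq)
  also have "\<dots> \<le> (MAX \<phi>\<in>closed_G2 br. orbit_dim br \<phi>)"
    using \<phi> by (intro Max_ge finite_orbit_dims) auto
  finally show ?thesis
    using less manifold_dim_closed_G2[of br] \<phi> by (force simp: moduli_dim_def betti3_def)
qed

text \<open>No orbit can exceed the dimension of the derivation algebra, so if there are more exact
  forms than that, too little of the closed forms is divided out.\<close>

lemma betti3_less_moduli_dim:
  assumes ne: "closed_G2 br \<noteq> {}" and less: "dim (derivations br) < dim (exact_forms3 br)"
  shows "int (betti3 br) < moduli_dim br"
proof -
  have "(MAX \<phi>\<in>closed_G2 br. orbit_dim br \<phi>) \<le> int (dim (derivations br))"
    using ne orbit_dim_bounds(2) by (subst Max_le_iff[OF finite_orbit_dims]) auto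
  moreover have "dim (exact_forms3 br) \<le> dim (closed_forms3 br)"
    by (rule dim_mono_iso[OF euclidean_iso_trilin_coords exact_forms3_subset_closed])
  ultimately show ?thesis
    using less by (simp add: moduli_dim_def betti3_def manifold_dim_closed_G2[OF ne] of_nat_diff)
qed

end

section \<open>Decomposable nilpotent Lie algebras with a closed G2-structure\<close>

context lie
begin

lemma lower_central_Suc_subset: "lower_central br (Suc n) \<subseteq> lower_central br n"
proof (induction n)
  case (Suc n)
  then have "{br x y |x y. y \<in> lower_central br (Suc n)} \<subseteq> {br x y |x y. y \<in> lower_central br n}" by blast
  then show ?case unfolding lower_central.simps(2) by (rule span_mono)
qed simp

lemma br_lower_central: "y \<in> lower_central br n \<Longrightarrow> br x y \<in> lower_central br (Suc n)"
  by (auto intro: span_base)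

text \<open>Take \<open>v\<close> in the last term of the lower central series that meets \<open>I - J\<close>.\<close>

lemma nilpotent_ideal_meets_center:
  assumes nil: "nilpotent br" and I: "\<And>x v. v \<in> I \<Longrightarrow> br x v \<in> I" and "v0 \<in> I" "v0 \<notin> J" "0 \<in> J"
  obtains v where "v \<in> I" "v \<notin> J" "\<And>x. br x v \<in> J"
proof -
  obtain N where N: "lower_central br N = {0}" using nil by (auto simp: nilpotent_def)
  define P where "P n \<longleftrightarrow> (\<exists>v\<in>I. v \<notin> J \<and> v \<in> lower_central br n)" for n
  have "P 0" using assms by (auto simp: P_def)
  moreover have "\<not> P N" using N assms(5) by (auto simp: P_def)
  ultimately obtain n where n: "P n" "\<not> P (Suc n)"
    by (metis nat_induct)
  then obtain v where v: "v \<in> I" "v \<notin> J" "v \<in> lower_central br n" by (auto simp: P_def)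
  have "br x v \<in> J" for x
    using n(2) I[OF v(1)] br_lower_central[OF v(3)] unfolding P_def by blast
  then show thesis using that v by blast
qed

text \<open>Each application of \<open>T\<close> descends in the lower central series, so the
  iterates on \<open>w\<close> reach 0, whereas \<open>f\<close> picks up a factor
  \<open>\<kappa>\<close> each time. On the invariant set \<open>S\<close>, \<open>f\<close> is an
  eigenvector of the transpose of \<open>T\<close>.\<close>

lemma nilpotent_eigenvalue_zero:
  assumes nil: "nilpotent br" and T: "\<And>n x. x \<in> lower_central br n \<Longrightarrow> T x \<in> lower_central br (Suc n)"
    and S: "\<And>x. x \<in> S \<Longrightarrow> T x \<in> S \<and> f (T x) = \<kappa> * f x" and f0: "f 0 = (0::real)" and w: "w \<in> S" "f w \<noteq> 0"
  shows "\<kappa> = 0"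
proof -
  have "(T ^^ n) w \<in> S \<and> (T ^^ n) w \<in> lower_central br n \<and> f ((T ^^ n) w) = \<kappa> ^ n * f w" for n
  proof (induction n)
    case (Suc n)
    then show ?case using S[of "(T ^^ n) w"] T[of "(T ^^ n) w" n] by (auto simp del: lower_central.simps)
  qed (use w in auto)
  then have "\<kappa> ^ n * f w = 0" if "lower_central br n = {0}" for n
    using that f0 by (metis singletonD)
  then show ?thesis using nil w by (auto simp: nilpotent_def)
qed

end

section \<open>Splittings into two commuting subalgebras\<close>

definition commutator :: "('a::euclidean_space \<Rightarrow> 'a \<Rightarrow> 'a) \<Rightarrow> 'a set \<Rightarrow> 'a set" where
  "commutator br h = span {br x y |x y. x \<in> h \<and> y \<in> h}"

locale lie_sum = lie br for br :: "'a::euclidean_space \<Rightarrow> 'a \<Rightarrow> 'a" +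
  fixes h k :: "'a set"
  assumes h: "subspace h" and k: "subspace k" and int: "h \<inter> k = {0}"
    and sum: "{x + y | x y. x \<in> h \<and> y \<in> k} = UNIV"
    and br_h: "\<And>x y. x \<in> h \<Longrightarrow> y \<in> h \<Longrightarrow> br x y \<in> h" and br_k: "\<And>x y. x \<in> k \<Longrightarrow> y \<in> k \<Longrightarrow> br x y \<in> k"
    and br_hk: "\<And>x y. x \<in> h \<Longrightarrow> y \<in> k \<Longrightarrow> br x y = 0"
begin

lemma br_kh: "x \<in> k \<Longrightarrow> y \<in> h \<Longrightarrow> br x y = 0"
  using br_hk[of y x] br_antisym[of x y] by simp

lemma decompose: obtains x y where "x \<in> h" "y \<in> k" "v = x + y"
  using sum by blast

lemma commutator_subset: "commutator br h \<subseteq> h"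
  unfolding commutator_def by (rule span_minimal[OF _ h]) (use br_h in auto)

text \<open>The commutator of one summand is an ideal of the whole algebra, as the other summand
  acts trivially on it, and a nonzero ideal of a nilpotent Lie algebra meets the centre.\<close>

lemma nilpotent_center_commutator:
  assumes "nilpotent br" and "\<exists>x\<in>h. \<exists>y\<in>h. br x y \<noteq> 0"
  obtains z where "z \<in> commutator br h" "z \<noteq> 0" "\<And>x. br z x = 0"
proof -
  obtain x y where xy: "x \<in> h" "y \<in> h" "br x y \<noteq> 0" using assms(2) by blast
  have "br v w \<in> commutator br h" if w: "w \<in> commutator br h" for v w
  proof -
    obtain v1 v2 where v: "v1 \<in> h" "v2 \<in> k" "v = v1 + v2" by (rule decompose)
    have wh: "w \<in> h" using w commutator_subset by blast
    then have "br v w = br v1 w" using v br_kh by (simp add: br_simps)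
    then show ?thesis using v(1) wh unfolding commutator_def by (auto intro: span_base)
  qed
  moreover have "br x y \<in> commutator br h" using xy unfolding commutator_def by (auto intro: span_base)
  ultimately obtain z where "z \<in> commutator br h" "z \<notin> {0}" "\<And>x. br x z \<in> {0}"
    using nilpotent_ideal_meets_center[OF assms(1), of "commutator br h" "br x y" "{0}"] xy(3) by blast
  moreover from this(3) have "br z x = 0" for x using br_antisym[of z x] by simp
  ultimately show thesis using that by blast
qed

text \<open>In \<open>d \<phi>(a, b, z, x)\<close> with \<open>a\<close>, \<open>b\<close> in
  \<open>h\<close> and \<open>z\<close>, \<open>x\<close> in \<open>k\<close>, only the term with
  the bracket of \<open>a\<close> and \<open>b\<close> survives, since \<open>z\<close> is central
  and the summands commute.\<close>

lemma closed_form_vanishes: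
  assumes \<phi>: "\<phi> \<in> closed_forms3 br" and v: "v \<in> commutator br h" and z: "z \<in> k" "\<And>x. br z x = 0" and x: "x \<in> k"
  shows "\<phi> v z x = 0"
proof -
  have "commutator br h \<subseteq> {v. \<phi> v z x = 0}"
    unfolding commutator_def
  proof (rule span_minimal)
    show "subspace {v. \<phi> v z x = 0}" by (auto simp: subspace_def blinfun.bilinear_simps)
    have "\<phi> (br a b) z x = 0" if "a \<in> h" "b \<in> h" for a b
    proof -
      have "d3 br \<phi> a b z x = 0" using \<phi> by (simp add: closed_forms3_def)
      then show ?thesis
        using that z x by (simp add: d3_def br_hk blinfun.bilinear_simps)
    qed
    then show "{br x y |x y. x \<in> h \<and> y \<in> h} \<subseteq> {v. \<phi> v z x = 0}" by blast
  qed
  then show ?thesis using v by blast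
qed

lemma central_functional:
  assumes nil: "nilpotent br" and ab: "\<And>x y. x \<in> k \<Longrightarrow> y \<in> k \<Longrightarrow> br x y = 0" and "k \<noteq> {0}"
    and "\<exists>x\<in>h. \<exists>y\<in>h. br x y \<noteq> 0"
  obtains X Y \<nu> where "linear \<nu>" "\<And>x y. \<nu> (br x y) = (0::real)" "\<nu> X = 1" "\<nu> Y = 0" "Y \<noteq> 0"
    "\<And>x. br X x = 0" "\<And>x. br Y x = 0"
proof -
  obtain Y where Y: "Y \<in> commutator br h" "Y \<noteq> 0" "\<And>x. br Y x = 0"
    using nilpotent_center_commutator[OF nil assms(4)] by blast
  obtain X where X: "X \<in> k" "X \<noteq> 0" using assms(3) subspace_0[OF k] by auto
  obtain P where P: "linear P" "\<And>x. P x \<in> h" "\<And>x v. v \<in> h \<Longrightarrow> v \<bullet> (x - P x) = 0"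
    using orthogonal_projection_exists[OF h] by metis
  \<comment> \<open>The part of \<open>X\<close> normal to \<open>h\<close>; the inner product with
    it vanishes on \<open>h\<close>, which contains all brackets because \<open>k\<close> is
    abelian.\<close>
  define n where "n = X - P X"
  have "X \<notin> h" using X int by blast
  then have "n \<noteq> 0" unfolding n_def by (metis P(2) right_minus_eq)
  define \<nu> where "\<nu> v = (v \<bullet> n) / (n \<bullet> n)" for v
  have \<nu>h: "\<nu> v = 0" if "v \<in> h" for v using P(3)[OF that, of X] by (simp add: \<nu>_def n_def)
  show thesis
  proof (rule that[of \<nu> X Y])
    show "linear \<nu>" by (rule linearI) (simp_all add: \<nu>_def inner_add_left add_divide_distrib)
    show "\<nu> (br x y) = 0" for x y
    proof -
      obtain x1 x2 where x: "x1 \<in> h" "x2 \<in> k" "x = x1 + x2" by (rule decompose)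
      obtain y1 y2 where y: "y1 \<in> h" "y2 \<in> k" "y = y1 + y2" by (rule decompose)
      have "br x y = br x1 y1" using x y by (simp add: br_simps br_hk br_kh ab)
      then show ?thesis using \<nu>h br_h x y by simp
    qed
    have "X \<bullet> n = n \<bullet> n"
      using P(3)[OF P(2)[of X], of X] by (simp add: n_def inner_diff_left)
    then show "\<nu> X = 1" using \<open>n \<noteq> 0\<close> by (simp add: \<nu>_def)
    show "\<nu> Y = 0" using Y(1) commutator_subset \<nu>h by blast
    show "br X x = 0" for x
    proof -
      obtain x1 x2 where x: "x1 \<in> h" "x2 \<in> k" "x = x1 + x2" by (rule decompose)
      then show ?thesis using X by (simp add: br_simps br_kh ab)
    qed
  qed (fact Y(2), fact Y(3))
qed

end

text \<open>The hypothesis says that the cross product of \<open>x\<close> and \<open>y\<close> is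
  zero; multiplying once more by \<open>x\<close> expresses \<open>y\<close> through
  \<open>x\<close>.\<close>

lemma (in G2_frame) phi_nondegenerate:
  assumes "\<And>z. \<phi> x y z = 0" "x \<noteq> 0"
  obtains a where "y = a *\<^sub>R x"
proof -
  have "cross x y = 0" using assms(1) by (intro frame_eqI) (simp add: eta_cross)
  moreover have "cross x 0 = 0" by (rule frame_eqI) (simp add: eta_cross)
  ultimately have "metric x y *\<^sub>R x - metric x x *\<^sub>R y = 0" by (simp flip: cross_cross_self)
  then have eq: "metric x x *\<^sub>R y = metric x y *\<^sub>R x" by simp
  have "metric x x \<noteq> 0" using assms(2) by simp
  then have "y = (1 / metric x x) *\<^sub>R (metric x x *\<^sub>R y)" by simp
  also have "\<dots> = (metric x y / metric x x) *\<^sub>R x" unfolding eq by simp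
  finally have "y = (metric x y / metric x x) *\<^sub>R x" .
  then show thesis by (rule that)
qed

text \<open>If both summands are nonabelian, each has a central vector in its commutator, and
  closedness makes \<open>\<phi>\<close> vanish on this pair with any third vector. The two vectors
  are then parallel although the summands meet in zero. So exactly one summand is abelian, and
  \<open>central_functional\<close> applies.\<close>

lemma decomposable_central_functional:
  fixes br :: "'a::euclidean_space \<Rightarrow> 'a \<Rightarrow> 'a"
  assumes lie: "lie_algebra br" and nil: "nilpotent br" and "\<not> abelian br" and dec: "decomposable br"
    and \<phi>: "\<phi> \<in> closed_G2 br"
  obtains X Y \<nu> where "linear \<nu>" "\<And>x y. \<nu> (br x y) = (0::real)" "\<nu> X = 1" "\<nu> Y = 0" "Y \<noteq> 0"
    "\<And>x. br X x = 0" "\<And>x. br Y x = 0"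
proof -
  obtain h k where hk: "subspace h" "subspace k" "h \<noteq> {0}" "k \<noteq> {0}" "h \<inter> k = {0}"
    "{x + y | x y. x \<in> h \<and> y \<in> k} = UNIV" "\<forall>x\<in>h. \<forall>y\<in>h. br x y \<in> h" "\<forall>x\<in>k. \<forall>y\<in>k. br x y \<in> k"
    "\<forall>x\<in>h. \<forall>y\<in>k. br x y = 0"
    using dec unfolding decomposable_def by blast
  interpret lie br by unfold_locales (rule lie)
  interpret hk: lie_sum br h k using hk by unfold_locales auto
  have "{y + x | y x. y \<in> k \<and> x \<in> h} = UNIV" using hk(6) by (force simp: add.commute)
  then interpret kh: lie_sum br k h using hk hk.br_kh by unfold_locales auto
  have clos: "\<phi> \<in> closed_forms3 br" and "G2_structure \<phi>" using \<phi> by (auto simp: closed_G2_def)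
  then obtain u \<eta> where "G2_frame \<phi> u \<eta>" using G2_structure_iff_frame by blast
  then interpret G2_frame \<phi> u \<eta> .
  consider "\<exists>x\<in>h. \<exists>y\<in>h. br x y \<noteq> 0" "\<exists>x\<in>k. \<exists>y\<in>k. br x y \<noteq> 0"
    | "\<exists>x\<in>h. \<exists>y\<in>h. br x y \<noteq> 0" "\<forall>x\<in>k. \<forall>y\<in>k. br x y = 0"
    | "\<forall>x\<in>h. \<forall>y\<in>h. br x y = 0" "\<exists>x\<in>k. \<exists>y\<in>k. br x y \<noteq> 0"
    | "\<forall>x\<in>h. \<forall>y\<in>h. br x y = 0" "\<forall>x\<in>k. \<forall>y\<in>k. br x y = 0" by blast
  then show thesis
  proof cases
    case 1
    obtain z where z: "z \<in> commutator br h" "z \<noteq> 0" "\<And>x. br z x = 0"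
      using hk.nilpotent_center_commutator[OF nil 1(1)] by blast
    obtain w where w: "w \<in> commutator br k" "w \<noteq> 0" "\<And>x. br w x = 0"
      using kh.nilpotent_center_commutator[OF nil 1(2)] by blast
    have zh: "z \<in> h" and wk: "w \<in> k" using z w hk.commutator_subset kh.commutator_subset by auto
    have "\<phi> z w x = 0" for x
    proof -
      obtain x1 x2 where x: "x1 \<in> h" "x2 \<in> k" "x = x1 + x2" by (rule hk.decompose)
      have "\<phi> z w x2 = 0" using hk.closed_form_vanishes[OF clos z(1) wk w(3) x(2)] .
      moreover have "\<phi> w z x1 = 0" using kh.closed_form_vanishes[OF clos w(1) zh z(3) x(1)] .
      ultimately show ?thesis using phi_alt(1)[of z w x1] by (simp add: x(3) blinfun.bilinear_simps)
    qed
    then obtain a where "w = a *\<^sub>R z" using phi_nondegenerate z(2) by blast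
    then have "w \<in> h" using zh hk(1) by (simp add: subspace_scale)
    then show ?thesis using wk w(2) hk(5) by blast
  next
    case 2
    show ?thesis
    proof (rule hk.central_functional[OF nil _ hk(4) 2(1)], goal_cases)
      case 1 then show ?case using 2(2) by blast
    next
      case *: 2 show ?case by (rule that[OF *])
    qed
  next
    case 3
    show ?thesis
    proof (rule kh.central_functional[OF nil _ hk(3) 3(2)], goal_cases)
      case 1 then show ?case using 3(1) by blast
    next
      case *: 2 show ?case by (rule that[OF *])
    qed
  next
    case 4
    have "br x y = 0" for x y
    proof -
      obtain x1 x2 where x: "x1 \<in> h" "x2 \<in> k" "x = x1 + x2" by (rule hk.decompose)
      obtain y1 y2 where y: "y1 \<in> h" "y2 \<in> k" "y = y1 + y2" by (rule hk.decompose)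
      show ?thesis using 4 x y by (simp add: br_simps hk.br_hk hk.br_kh)
    qed
    then show ?thesis using assms(3) by (simp add: abelian_def)
  qed
qed

text \<open>The frame vectors 1 and 2 are central and told apart by \<open>\<nu>\<close>. The
  condition \<open>u3\<close> places every bracket with \<open>u 3\<close> in the plane of
  \<open>u 1\<close> and \<open>u 2\<close>: a third vector that is central modulo that
  plane.\<close>

locale central_frame = lie br + G2_frame \<phi> u \<eta>
  for br :: "'a::euclidean_space \<Rightarrow> 'a \<Rightarrow> 'a" and \<phi> :: "'a trilin" and u :: "nat \<Rightarrow> 'a" and \<eta> :: "nat \<Rightarrow> 'a \<Rightarrow>\<^sub>L real" +
  fixes \<nu> :: "'a \<Rightarrow> real"
  assumes nil: "nilpotent br" and closed: "\<phi> \<in> closed_forms3 br"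
    and central: "br (u 1) x = 0" "br (u 2) x = 0"
    and nu: "linear \<nu>" "\<nu> (br x y) = 0" "\<nu> (u 1) = 1" "\<nu> (u 2) = 0"
    and u3: "i \<in> {3..7} \<Longrightarrow> \<eta> i (br (u 3) x) = 0"
begin

lemma dphi:
  fixes i j k l :: nat
  shows "- \<phi> (u k) (u l) (br (u i) (u j)) + \<phi> (u j) (u l) (br (u i) (u k)) - \<phi> (u j) (u k) (br (u i) (u l))
    - \<phi> (u i) (u l) (br (u j) (u k)) + \<phi> (u i) (u k) (br (u j) (u l)) - \<phi> (u i) (u j) (br (u k) (u l)) = 0"
proof -
  have "d3 br \<phi> (u i) (u j) (u k) (u l) = 0" using closed by (simp add: closed_forms3_def)
  then show ?thesis unfolding d3_def phi_cyclic[of "br _ _"] .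
qed

lemma central_right: "br x (u 1) = 0" "br x (u 2) = 0"
  using br_antisym[of x "u 1"] br_antisym[of x "u 2"] by (simp_all add: central)

text \<open>With \<open>u 1\<close> and \<open>u 2\<close> central, the only term left in
  \<open>d \<phi>(u 1, u 2, x, y)\<close> is the value of \<open>\<phi>\<close> on the bracket of
  \<open>x\<close> and \<open>y\<close>, \<open>u 1\<close> and \<open>u 2\<close>.\<close>

lemma eta7_br [simp]: "\<eta> 7 (br x y) = 0"
proof -
  have "d3 br \<phi> (u 1) (u 2) x y = 0" using closed by (simp add: closed_forms3_def)
  then show ?thesis by (simp add: d3_def central phi_cyclic[of "br _ _"] phi_uu blinfun.bilinear_simps)
qed

lemma nu_expand: "\<nu> v = \<eta> 1 v + \<eta> 3 v * \<nu> (u 3) + \<eta> 4 v * \<nu> (u 4) + \<eta> 5 v * \<nu> (u 5) + \<eta> 6 v * \<nu> (u 6) + \<eta> 7 v * \<nu> (u 7)"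
  using arg_cong[OF expand[of v], of \<nu>]
  by (simp only: linear_add[OF nu(1)] linear_scale[OF nu(1)] nu real_scaleR_def)

text \<open>Decomposability enters the computation here: \<open>\<nu>\<close> kills brackets but not
  \<open>u 1\<close>, so the first component of a bracket is determined by the others.\<close>

lemma eta1_br: "\<eta> 1 (br x y) = - (\<eta> 3 (br x y) * \<nu> (u 3) + \<eta> 4 (br x y) * \<nu> (u 4)
    + \<eta> 5 (br x y) * \<nu> (u 5) + \<eta> 6 (br x y) * \<nu> (u 6))"
  using nu_expand[of "br x y"] by (simp add: nu)

lemma u3': "\<eta> 1 (br (u 3) x) = 0" "\<eta> 3 (br (u 3) x) = 0" "\<eta> 4 (br (u 3) x) = 0" "\<eta> 5 (br (u 3) x) = 0" "\<eta> 6 (br (u 3) x) = 0"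
  using u3 by (simp_all add: eta1_br)

section \<open>Structure constants in the adapted frame\<close>

definition c :: "nat \<Rightarrow> nat \<Rightarrow> nat \<Rightarrow> real" where
  "c i j k = \<eta> k (br (u i) (u j))"

lemma c_antisym: "c i j k = - c j i k"
  unfolding c_def using br_antisym[of "u i" "u j"] by (simp add: blinfun.bilinear_simps)

lemma c3: "c 3 j 1 = 0" "c 3 j 3 = 0" "c 3 j 4 = 0" "c 3 j 5 = 0" "c 3 j 6 = 0"
  by (simp_all add: c_def u3')

lemma c7: "c i j 7 = 0" by (simp add: c_def)

text \<open>The 25 components of \<open>d \<phi> = 0\<close> whose index set does not contain both 1
  and 2; the other ten were spent on \<open>eta7_br\<close>.\<close>

lemma closedness:
  "c 4 5 5 = 0" "c 4 6 5 = 0" "c 3 4 2 - c 4 7 5 = 0" "c 5 6 5 = 0" "c 3 5 2 - c 5 7 5 = 0"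
  "c 3 6 2 - c 6 7 5 = 0" "- c 4 5 4 - c 4 6 3 + c 5 6 6 = 0" "c 4 5 2 - c 4 7 3 + c 5 7 6 = 0"
  "c 4 6 2 + c 4 7 4 + c 6 7 6 = 0" "c 5 6 2 + c 5 7 4 + c 6 7 3 = 0" "c 4 5 6 = 0" "c 4 6 6 = 0"
  "c 4 7 6 = 0" "c 5 6 6 = 0" "c 5 7 6 = 0" "c 6 7 6 = 0" "- c 4 5 3 + c 4 6 4 + c 5 6 5 = 0"
  "- c 4 5 1 + c 4 7 4 + c 5 7 5 = 0" "- c 4 6 1 + c 4 7 3 + c 6 7 5 = 0"
  "- c 5 6 1 + c 5 7 3 - c 6 7 4 = 0" "c 3 6 2 + c 4 5 2 + c 4 6 1 = 0" "c 3 7 2 + c 4 5 4 + c 4 7 1 = 0"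
  "c 4 6 4 - c 4 7 2 = 0" "c 5 6 4 - c 5 7 2 - c 6 7 1 = 0"
  "- c 4 5 5 - c 4 6 6 - c 5 6 3 - c 5 7 1 + c 6 7 2 = 0"
proof -
  note d =
    dphi[of 4 5 1 3] dphi[of 4 6 1 3] dphi[of 4 7 1 3] dphi[of 5 6 1 3] dphi[of 5 7 1 3] dphi[of 6 7 1 3]
    dphi[of 5 6 1 4] dphi[of 5 7 1 4] dphi[of 6 7 1 4] dphi[of 6 7 1 5] dphi[of 4 5 2 3] dphi[of 4 6 2 3]
    dphi[of 4 7 2 3] dphi[of 5 6 2 3] dphi[of 5 7 2 3] dphi[of 6 7 2 3] dphi[of 5 6 2 4] dphi[of 5 7 2 4]
    dphi[of 6 7 2 4] dphi[of 6 7 2 5] dphi[of 5 6 3 4] dphi[of 5 7 3 4] dphi[of 6 7 3 4] dphi[of 6 7 3 5]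
    dphi[of 6 7 4 5]
  note e = d[unfolded phi_uu central central_right blinfun.zero_right c_def[symmetric] c3 c7]
  show
    "c 4 5 5 = 0" "c 4 6 5 = 0" "c 3 4 2 - c 4 7 5 = 0" "c 5 6 5 = 0" "c 3 5 2 - c 5 7 5 = 0"
    "c 3 6 2 - c 6 7 5 = 0" "- c 4 5 4 - c 4 6 3 + c 5 6 6 = 0" "c 4 5 2 - c 4 7 3 + c 5 7 6 = 0"
    "c 4 6 2 + c 4 7 4 + c 6 7 6 = 0" "c 5 6 2 + c 5 7 4 + c 6 7 3 = 0" "c 4 5 6 = 0" "c 4 6 6 = 0"
    "c 4 7 6 = 0" "c 5 6 6 = 0" "c 5 7 6 = 0" "c 6 7 6 = 0" "- c 4 5 3 + c 4 6 4 + c 5 6 5 = 0"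
    "- c 4 5 1 + c 4 7 4 + c 5 7 5 = 0" "- c 4 6 1 + c 4 7 3 + c 6 7 5 = 0"
    "- c 5 6 1 + c 5 7 3 - c 6 7 4 = 0" "c 3 6 2 + c 4 5 2 + c 4 6 1 = 0" "c 3 7 2 + c 4 5 4 + c 4 7 1 = 0"
    "c 4 6 4 - c 4 7 2 = 0" "c 5 6 4 - c 5 7 2 - c 6 7 1 = 0"
    "- c 4 5 5 - c 4 6 6 - c 5 6 3 - c 5 7 1 + c 6 7 2 = 0"
    using e by linarith+
qed

lemma c1: "c i j 1 = - (c i j 3 * \<nu> (u 3) + c i j 4 * \<nu> (u 4) + c i j 5 * \<nu> (u 5) + c i j 6 * \<nu> (u 6))"
  unfolding c_def by (rule eta1_br)

lemma eta_br: "\<eta> k (br (u i) v) = c i 3 k * \<eta> 3 v + c i 4 k * \<eta> 4 v + c i 5 k * \<eta> 5 v + c i 6 k * \<eta> 6 v + c i 7 k * \<eta> 7 v"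
  unfolding c_def
  using arg_cong[OF arg_cong[OF expand[of v], of "br (u i)"], of "\<eta> k"]
  by (simp add: br_simps central_right blinfun.bilinear_simps)

lemma central_if:
  assumes "br w (u 3) = 0" "br w (u 4) = 0" "br w (u 5) = 0" "br w (u 6) = 0" "br w (u 7) = 0"
  shows "br w x = 0"
  by (subst expand[of x]) (simp add: br_simps central_right assms)

lemma c_self: "c i i k = 0" by (simp add: c_def)

text \<open>On the invariant subspace where \<open>\<eta> 6\<close> and \<open>\<eta> 7\<close>
  vanish, bracketing with \<open>u 5\<close> multiplies \<open>\<eta> 4\<close> by
  \<open>c 5 4 4\<close>, an eigenvalue of a nilpotent map. The second constant follows in the same
  way from \<open>u 6\<close>, with \<open>\<eta> 5\<close> in place of
  \<open>\<eta> 6\<close>.\<close>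

lemma nilpotent_zero:
  "c 4 5 4 = 0" "c 4 6 4 = 0"
proof -
  have "c 5 4 4 = 0"
  proof (rule nilpotent_eigenvalue_zero[OF nil, of "br (u 5)" "{x. \<eta> 6 x = 0 \<and> \<eta> 7 x = 0}" "\<eta> 4" _ "u 4"])
    show "br (u 5) x \<in> lower_central br (Suc n)" if "x \<in> lower_central br n" for n x
      using that by (rule br_lower_central)
  qed (use closedness c_antisym[of 5 3 4] c_antisym[of 5 3 6] c_antisym[of 5 4 6] in \<open>auto simp: eta_br c7 c3 c_self\<close>)
  then show "c 4 5 4 = 0" using c_antisym[of 4 5 4] by simp
  have "c 6 4 4 = 0"
  proof (rule nilpotent_eigenvalue_zero[OF nil, of "br (u 6)" "{x. \<eta> 5 x = 0 \<and> \<eta> 7 x = 0}" "\<eta> 4" _ "u 4"])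
    show "br (u 6) x \<in> lower_central br (Suc n)" if "x \<in> lower_central br n" for n x
      using that by (rule br_lower_central)
  qed (use closedness c_antisym[of 6 3 4] c_antisym[of 6 3 5] c_antisym[of 6 4 5] in \<open>auto simp: eta_br c7 c3 c_self\<close>)
  then show "c 4 6 4 = 0" using c_antisym[of 4 6 4] by simp
qed

lemma jacobi_c:
  "(c i 3 n * c j k 3 + c i 4 n * c j k 4 + c i 5 n * c j k 5 + c i 6 n * c j k 6)
    + (c j 3 n * c k i 3 + c j 4 n * c k i 4 + c j 5 n * c k i 5 + c j 6 n * c k i 6)
    + (c k 3 n * c i j 3 + c k 4 n * c i j 4 + c k 5 n * c i j 5 + c k 6 n * c i j 6) = 0"
proof -
  have "\<eta> n (br (u i) (br (u j) (u k)) + br (u j) (br (u k) (u i)) + br (u k) (br (u i) (u j))) = 0"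
    by (simp add: jacobi)
  then show ?thesis by (simp add: blinfun.add_right eta_br[where v = "br _ _"] c7 flip: c_def)
qed

text \<open>After the closedness of \<open>\<phi>\<close> and nilpotency only few structure constants are left.\<close>

lemma c_relations:
  "c 4 5 1 = 0" "c 4 5 2 = - c 6 7 5" "c 4 5 3 = 0" "c 4 6 1 = 0" "c 4 6 2 = c 5 7 5" "c 4 6 3 = 0"
  "c 4 7 2 = 0" "c 4 7 3 = - c 6 7 5" "c 4 7 4 = - c 5 7 5" "c 3 4 2 = c 4 7 5" "c 3 5 2 = c 5 7 5" "c 3 6 2 = c 6 7 5"
  "c 3 7 2 = - c 4 7 1" "c 4 5 4 = 0" "c 4 6 4 = 0"
  "c 4 5 5 = 0" "c 4 6 5 = 0" "c 5 6 5 = 0" "c 4 5 6 = 0" "c 4 6 6 = 0" "c 5 6 6 = 0" "c 4 7 6 = 0" "c 5 7 6 = 0" "c 6 7 6 = 0"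
proof -
  note z = closedness nilpotent_zero c1[of 4 5] c1[of 4 6]
  show *: "c 4 5 1 = 0" "c 4 6 1 = 0" using z by simp_all
  show "c 4 5 2 = - c 6 7 5" "c 4 5 3 = 0" "c 4 6 2 = c 5 7 5" "c 4 6 3 = 0"
    "c 4 7 2 = 0" "c 4 7 3 = - c 6 7 5" "c 4 7 4 = - c 5 7 5" "c 3 4 2 = c 4 7 5" "c 3 5 2 = c 5 7 5" "c 3 6 2 = c 6 7 5"
    "c 3 7 2 = - c 4 7 1" "c 4 5 5 = 0" "c 4 6 5 = 0" "c 5 6 5 = 0" "c 4 5 6 = 0" "c 4 6 6 = 0" "c 5 6 6 = 0"
    "c 4 7 6 = 0" "c 5 7 6 = 0" "c 6 7 6 = 0"
    using * closedness nilpotent_zero by linarith+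
qed (fact nilpotent_zero)+

lemma c_relations':
  "c 5 4 1 = 0" "c 5 4 2 = c 6 7 5" "c 5 4 3 = 0" "c 6 4 1 = 0" "c 6 4 2 = - c 5 7 5" "c 6 4 3 = 0"
  "c 7 4 2 = 0" "c 7 4 3 = c 6 7 5" "c 7 4 4 = c 5 7 5" "c 4 3 2 = - c 4 7 5" "c 5 3 2 = - c 5 7 5" "c 6 3 2 = - c 6 7 5"
  "c 5 4 4 = 0" "c 6 4 4 = 0" "c 5 4 5 = 0" "c 6 4 5 = 0" "c 6 5 5 = 0" "c 5 4 6 = 0" "c 6 4 6 = 0" "c 6 5 6 = 0"
  "c 7 4 6 = 0" "c 7 5 6 = 0" "c 7 6 6 = 0" "c 7 4 5 = - c 4 7 5" "c 7 5 5 = - c 5 7 5" "c 7 6 5 = - c 6 7 5"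
  "c 7 5 4 = - c 5 7 4" "c 6 5 n = - c 5 6 n"
  "c j 3 1 = 0" "c j 3 3 = 0" "c j 3 4 = 0" "c j 3 5 = 0" "c j 3 6 = 0"
  using c_antisym[of 5 4] c_antisym[of 6 4] c_antisym[of 7 4] c_antisym[of 4 3] c_antisym[of 5 3] c_antisym[of 6 3]
    c_antisym[of 6 5] c_antisym[of 7 5] c_antisym[of 7 6] c_antisym[of j 3]
  by (simp_all only: c_relations c3 minus_minus minus_zero)

text \<open>Where \<open>\<eta> 6\<close> and \<open>\<eta> 7\<close> vanish, bracketing with
  \<open>u 7\<close> acts on the coordinates \<open>\<eta> 4\<close>, \<open>\<eta> 5\<close> by a
  traceless 2 by 2 matrix. Its square is scalar, the scalar being the left-hand side, and nilpotency
  makes it zero.\<close>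

lemma nilpotent_block: "(c 5 7 5)\<^sup>2 + c 4 7 5 * c 5 7 4 = 0"
proof (rule nilpotent_eigenvalue_zero[OF nil, of "\<lambda>v. br (u 7) (br (u 7) v)" "{x. \<eta> 6 x = 0 \<and> \<eta> 7 x = 0}" "\<eta> 5" _ "u 5"])
  show "br (u 7) (br (u 7) x) \<in> lower_central br (Suc n)" if "x \<in> lower_central br n" for n x
    using br_lower_central[OF br_lower_central[OF that]] lower_central_Suc_subset by blast
qed (auto simp: eta_br c_relations c_relations' c_self c7 power2_eq_square algebra_simps)

text \<open>Jacobi identities for \<open>u 4, u 6, u 7\<close> and \<open>u 4, u 5, u 7\<close>.
  They serve a case distinction on \<open>c 4 7 5\<close>: if it vanishes, the first relation
  becomes a vanishing sum of squares; otherwise it can be cancelled from the others.\<close>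

lemma jacobi_relations:
  "c 4 7 5 * c 5 6 2 = c 4 7 5 * c 6 7 3 + 2 * (c 6 7 5)\<^sup>2 + (c 5 7 5)\<^sup>2"
  "c 4 7 5 * c 5 6 1 = 0" "c 4 7 5 * c 5 6 3 = 0" "c 4 7 5 * c 5 6 4 = 0"
  "c 4 7 5 * c 5 7 3 = - (c 5 7 5 * c 6 7 5)"
  using jacobi_c[of 4 2 6 7] jacobi_c[of 4 1 6 7] jacobi_c[of 4 3 6 7] jacobi_c[of 4 4 6 7] jacobi_c[of 4 2 5 7]
  by (simp_all add: c_relations c_relations' c_self power2_eq_square algebra_simps)

lemma br_eq_0I:
  assumes "\<eta> 2 (br x y) = 0" "\<eta> 3 (br x y) = 0" "\<eta> 4 (br x y) = 0" "\<eta> 5 (br x y) = 0" "\<eta> 6 (br x y) = 0"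
  shows "br x y = 0"
  by (subst expand[of "br x y"]) (simp add: assms eta1_br)

text \<open>The sum of squares in the first Jacobi relation forces \<open>c 6 7 5\<close> and
  \<open>c 5 7 5\<close> to vanish, and every bracket of \<open>u 3\<close> or \<open>u 4\<close> is
  expressed by these constants.\<close>

lemma central_u3_u4:
  assumes "c 4 7 5 = 0"
  shows "br (u 3) x = 0" "br (u 4) x = 0"
proof -
  have "2 * (c 6 7 5)\<^sup>2 + (c 5 7 5)\<^sup>2 = 0" using jacobi_relations(1) assms by simp
  then have z: "c 6 7 5 = 0" "c 5 7 5 = 0"
    by (metis add_nonneg_eq_0_iff mult_eq_0_iff zero_le_power2 zero_neq_numeral power_eq_0_iff mult_nonneg_nonneg zero_le_numeral)+
  have "c 4 7 1 = 0" unfolding c1 by (simp add: c_relations z assms)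
  note z' = z this assms
  show "br (u 3) x = 0"
    by (rule central_if; rule br_eq_0I; simp add: c_relations c_relations' c3 c_self z' flip: c_def)
  show "br (u 4) x = 0"
    by (rule central_if; rule br_eq_0I; simp add: c_relations c_relations' c3 c_self z' flip: c_def)
qed

text \<open>Supplies a better third frame vector. Orthogonality to \<open>u 1\<close>,
  \<open>u 2\<close> and \<open>u 7\<close> is what allows it to be completed to an adapted frame
  with the same first two vectors.\<close>

lemma central_vector_exists:
  obtains w where "w \<noteq> 0" "\<eta> 1 w = 0" "\<eta> 2 w = 0" "\<eta> 7 w = 0" "\<And>x. br w x = 0"
proof (cases "c 4 7 5 = 0")
  case True
  have "\<eta> 3 (u 3) = 1" by simp
  then have "u 3 \<noteq> 0" by (metis blinfun.zero_right zero_neq_one)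
  then show thesis using that[of "u 3"] central_u3_u4(1)[OF True] by simp
next
  case False
  define m x y where "m = c 4 7 5" and "x = c 5 7 5" and "y = c 6 7 5"
  \<comment> \<open>The coefficient of \<open>u 4\<close> is forced by component 5 of the bracket
    with \<open>u 7\<close>, that of \<open>u 3\<close> by component 2 of the bracket with
    \<open>u 4\<close>. The remaining components vanish by the Jacobi relations and
    \<open>nilpotent_block\<close>.\<close>
  define w where "w = m *\<^sub>R u 5 - x *\<^sub>R u 4 - y *\<^sub>R u 3"
  have m: "m \<noteq> 0" using False by (simp add: m_def)
  have z: "c 5 6 1 = 0" "c 5 6 3 = 0" "c 5 6 4 = 0" using jacobi_relations(2-4) False by simp_all
  have e562: "c 5 6 2 = - c 5 7 4 - c 6 7 3" using closedness by linarith
  have block: "x\<^sup>2 + m * c 5 7 4 = 0" using nilpotent_block by (simp add: m_def x_def)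
  have j2: "m * c 5 6 2 = m * c 6 7 3 + 2 * y\<^sup>2 + x\<^sup>2" using jacobi_relations(1) by (simp add: m_def x_def y_def)
  have m573: "m * c 5 7 3 = - (x * y)" using jacobi_relations(5) by (simp add: m_def x_def y_def)
  have m673: "m * c 6 7 3 = - y\<^sup>2"
    using j2 block unfolding e562 by (simp add: algebra_simps)
  have "c 6 7 4 = c 5 7 3" using closedness z(1) by linarith
  then have m674: "m * c 6 7 4 = - (x * y)" using m573 by simp
  have e572: "c 5 7 2 = - c 6 7 1" using closedness z(3) by linarith
  have br_w: "\<eta> k (br w v) = m * \<eta> k (br (u 5) v) - x * \<eta> k (br (u 4) v) - y * \<eta> k (br (u 3) v)" for k v
    by (simp add: w_def br_simps blinfun.bilinear_simps)
  note simps = br_w c_def[symmetric] c_relations c_relations' c3 c_self z m_def[symmetric] x_def[symmetric] y_def[symmetric]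
  have "br w v = 0" for v
  proof (rule central_if)
    show "br w (u 3) = 0" "br w (u 4) = 0" "br w (u 5) = 0"
      by (rule br_eq_0I; simp add: simps)+
    show "br w (u 6) = 0"
    proof (rule br_eq_0I)
      show "\<eta> 2 (br w (u 6)) = 0"
        using j2 m673 by (simp add: simps power2_eq_square)
    qed (simp_all add: simps)
    show "br w (u 7) = 0"
    proof (rule br_eq_0I)
      have m671: "m * c 6 7 1 = - (m * c 6 7 3 * \<nu> (u 3) + m * c 6 7 4 * \<nu> (u 4) + m * y * \<nu> (u 5))"
        unfolding c1[of 6 7] by (simp add: c_relations y_def algebra_simps)
      have e471: "c 4 7 1 = y * \<nu> (u 3) + x * \<nu> (u 4) - m * \<nu> (u 5)"
        unfolding c1[of 4 7] by (simp add: c_relations x_def y_def m_def)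
      have "m * c 5 7 2 + y * c 4 7 1 = y * c 4 7 1 - m * c 6 7 1" by (simp add: e572)
      also have "\<dots> = 0" unfolding m671 m673 m674 e471 by (simp add: power2_eq_square algebra_simps)
      finally have "m * c 5 7 2 + y * c 4 7 1 = 0" .
      then show "\<eta> 2 (br w (u 7)) = 0" by (simp add: simps)
      show "\<eta> 3 (br w (u 7)) = 0" using m573 by (simp add: simps)
      show "\<eta> 4 (br w (u 7)) = 0" using block by (simp add: simps power2_eq_square)
    qed (simp_all add: simps)
  qed
  moreover have "\<eta> 5 w = m" by (simp add: w_def blinfun.bilinear_simps)
  then have "w \<noteq> 0" using m by (metis blinfun.zero_right)
  ultimately show thesis using that[of w] by (simp add: w_def blinfun.bilinear_simps)
qed

end

section \<open>Existence of frames with two and with four central vectors\<close>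

lemma (in lie) central_frame_exists:
  fixes \<phi> :: "'a trilin" and \<nu> :: "'a \<Rightarrow> real"
  assumes DIM: "DIM('a) = 7" and nil: "nilpotent br" and \<phi>: "\<phi> \<in> closed_G2 br"
    and nu: "linear \<nu>" "\<And>x y. \<nu> (br x y) = 0" "\<nu> X = 1" "\<nu> Y = 0" "Y \<noteq> 0"
    and central: "\<And>x. br X x = 0" "\<And>x. br Y x = 0"
  obtains u \<eta> \<mu> where "central_frame br \<phi> u \<eta> \<mu>"
proof -
  have closed: "\<phi> \<in> closed_forms3 br" and "G2_structure \<phi>" using \<phi> by (auto simp: closed_G2_def)
  then obtain u \<eta> where "G2_frame \<phi> u \<eta>" using G2_structure_iff_frame by blast
  then interpret G2_frame \<phi> u \<eta> .
  have unit: "metric (w /\<^sub>R sqrt (metric w w)) (w /\<^sub>R sqrt (metric w w)) = 1" if "w \<noteq> 0" for w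
    using metric_pos[OF that] that by (simp add: metric_simps field_simps)
  \<comment> \<open>Orthonormalisation starts from \<open>Y\<close>: subtracting a multiple of
    \<open>b\<close> from \<open>X\<close> then leaves the value of \<open>\<nu>\<close>
    unchanged.\<close>
  define b where "b = Y /\<^sub>R sqrt (metric Y Y)"
  define X' where "X' = X - metric X b *\<^sub>R b"
  have b: "metric b b = 1" using unit[OF nu(5)] by (simp add: b_def)
  have nub: "\<nu> b = 0" by (simp add: b_def linear_scale[OF nu(1)] nu)
  have nuX': "\<nu> X' = 1" by (simp add: X'_def linear_diff[OF nu(1)] linear_scale[OF nu(1)] nu nub)
  have "X' \<noteq> 0" using nuX' linear_0[OF nu(1)] by auto
  define s where "s = sqrt (metric X' X')"
  have s: "s > 0" using metric_pos[OF \<open>X' \<noteq> 0\<close>] by (simp add: s_def)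
  define a where "a = X' /\<^sub>R s"
  have a: "metric a a = 1" using unit[OF \<open>X' \<noteq> 0\<close>] by (simp add: a_def s_def)
  have ab: "metric a b = 0" by (simp add: a_def X'_def metric_simps b)
  have cb: "br b x = 0" for x by (simp add: b_def br_simps central)
  have ca: "br a x = 0" for x by (simp add: a_def X'_def br_simps central cb)
  have cb': "br x b = 0" and ca': "br x a = 0" for x
    using br_antisym[of x b] br_antisym[of x a] by (simp_all add: cb ca)
  \<comment> \<open>A vector orthogonal to \<open>a\<close>, \<open>b\<close> and \<open>a \<times> b\<close> that is central modulo \<open>a\<close> and \<open>b\<close>.\<close>
  define J where "J = {v. \<exists>p q. v = p *\<^sub>R a + q *\<^sub>R b}"
  \<comment> \<open>Three linear conditions on a space of dimension 7.\<close>
  have "\<exists>v0. v0 \<noteq> 0 \<and> metric a v0 = 0 \<and> metric b v0 = 0 \<and> \<phi> a b v0 = 0"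
  proof (rule ccontr)
    assume neg: "\<not> ?thesis"
    define f where "f x = (metric a x, metric b x, \<phi> a b x)" for x
    have "linear f" by (rule linearI) (simp_all add: f_def metric_simps blinfun.bilinear_simps)
    moreover have "x = 0" if "f x = 0" for x using that neg by (auto simp: f_def zero_prod_def)
    ultimately have "dim (UNIV :: 'a set) \<le> DIM(real \<times> real \<times> real)" by (intro dim_le_DIM) auto
    then show False using DIM by simp
  qed
  then obtain v0 where v0: "v0 \<noteq> 0" "metric a v0 = 0" "metric b v0 = 0" "\<phi> a b v0 = 0" by blast
  have "v0 \<notin> J"
  proof
    assume "v0 \<in> J"
    then obtain p q where pq: "v0 = p *\<^sub>R a + q *\<^sub>R b" by (auto simp: J_def)
    then have "p = 0" "q = 0" using v0(2,3) a b ab metric_commute[of a b] by (simp_all add: metric_simps)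
    then show False using pq v0(1) by simp
  qed
  \<comment> \<open>By closedness the kernel of \<open>\<phi>(a, b, _)\<close> contains all
    brackets. It is therefore an ideal, which allows descent along the lower central series within
    it.\<close>
  moreover have "\<phi> a b (br x v) = 0" for x v
  proof -
    have "d3 br \<phi> a b x v = 0" using closed by (simp add: closed_forms3_def)
    then show ?thesis by (simp add: d3_def ca cb phi_cyclic[of "br _ _"] blinfun.bilinear_simps)
  qed
  moreover have "0 \<in> J" by (auto simp: J_def intro!: exI[of _ 0])
  ultimately obtain v where v: "\<phi> a b v = 0" "v \<notin> J" "\<And>x. br x v \<in> J"
    using nilpotent_ideal_meets_center[OF nil, of "{v. \<phi> a b v = 0}" v0 J] v0(4) by blast
  \<comment> \<open>Removing the components along the central vectors \<open>a\<close> and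
    \<open>b\<close> does not change any bracket with \<open>v\<close>.\<close>
  define v' where "v' = v - metric v a *\<^sub>R a - metric v b *\<^sub>R b"
  have "v' \<noteq> 0"
  proof
    assume "v' = 0"
    then have "v = metric v a *\<^sub>R a + metric v b *\<^sub>R b" by (simp add: v'_def algebra_simps)
    then show False using v(2) unfolding J_def by blast
  qed
  define e where "e = v' /\<^sub>R sqrt (metric v' v')"
  have e: "metric e e = 1" using unit[OF \<open>v' \<noteq> 0\<close>] by (simp add: e_def)
  have ae: "metric a e = 0" "metric b e = 0" "\<phi> a b e = 0"
    using a b ab metric_commute[of b a] metric_commute[of v a] metric_commute[of v b]
    by (simp_all add: e_def v'_def metric_simps blinfun.bilinear_simps v(1) phi_alt(3-5))
  obtain u' \<eta>' where "G2_frame \<phi> u' \<eta>'" and u': "u' 1 = a" "u' 2 = b" "u' 3 = e"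
    using adapted_frame_exists[OF a b e ab ae] by blast
  then interpret F: G2_frame \<phi> u' \<eta>' by simp
  \<comment> \<open>Normalising \<open>X'\<close> divided the value of the functional by
    \<open>s\<close>; the factor restores the value 1 on the first frame vector.\<close>
  have "central_frame br \<phi> u' \<eta>' (\<lambda>x. s * \<nu> x)"
  proof (rule central_frame.intro[OF lie_axioms F.G2_frame_axioms central_frame_axioms.intro])
    show "nilpotent br" by (rule nil)
    show "\<phi> \<in> closed_forms3 br" by (rule closed)
    show "br (u' 1) x = 0" "br (u' 2) x = 0" for x by (simp_all add: u' ca cb)
    show "linear (\<lambda>x. s * \<nu> x)" by (rule linearI) (simp_all add: linear_add[OF nu(1)] linear_scale[OF nu(1)] algebra_simps)
    show "s * \<nu> (br x y) = 0" for x y by (simp add: nu)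
    show "s * \<nu> (u' 1) = 1" using s by (simp add: u' a_def linear_scale[OF nu(1)] nuX')
    show "s * \<nu> (u' 2) = 0" by (simp add: u' nub)
    show "\<eta>' i (br (u' 3) x) = 0" if i: "i \<in> {3..7}" for i x
    proof -
      obtain p q where "br x v = p *\<^sub>R a + q *\<^sub>R b" using v(3)[of x] by (auto simp: J_def)
      moreover have "br e x = - (br x v /\<^sub>R sqrt (metric v' v'))"
        using br_antisym[of e x] by (simp add: e_def v'_def br_simps ca' cb')
      ultimately show ?thesis using i F.eta_u[of i 1] F.eta_u[of i 2] by (simp add: blinfun.bilinear_simps u')
    qed
  qed
  then show thesis by (rule that)
qed

lemma (in central_frame) central_frame_u3_u4:
  obtains u' \<eta>' where "central_frame br \<phi> u' \<eta>' \<nu>" "\<And>i x. i \<in> {1..4} \<Longrightarrow> br (u' i) x = 0"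
proof -
  obtain w where w: "w \<noteq> 0" "\<eta> 1 w = 0" "\<eta> 2 w = 0" "\<eta> 7 w = 0" "\<And>x. br w x = 0"
    using central_vector_exists by metis
  define e where "e = w /\<^sub>R sqrt (metric w w)"
  have m: "metric (u 1) (u 1) = 1" "metric (u 2) (u 2) = 1" "metric (u 1) (u 2) = 0"
    by (simp_all add: metric_def sum_1_7)
  have e: "metric e e = 1" "metric (u 1) e = 0" "metric (u 2) e = 0" "\<phi> (u 1) (u 2) e = 0" "br e x = 0" for x
    using metric_pos[OF w(1)] w by (simp_all add: e_def metric_simps field_simps phi_uu blinfun.bilinear_simps br_simps)
      (simp_all add: metric_def sum_1_7 w)
  obtain u' \<eta>' where "G2_frame \<phi> u' \<eta>'" and u': "u' 1 = u 1" "u' 2 = u 2" "u' 3 = e"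
    using adapted_frame_exists[OF m(1,2) e(1) m(3) e(2-4)] by blast
  then interpret F: G2_frame \<phi> u' \<eta>' by simp
  interpret C: central_frame br \<phi> u' \<eta>' \<nu>
  proof (rule central_frame.intro[OF lie_axioms F.G2_frame_axioms central_frame_axioms.intro])
    show "nilpotent br" by (rule nil)
    show "\<phi> \<in> closed_forms3 br" by (rule closed)
    show "br (u' 1) x = 0" "br (u' 2) x = 0" for x by (simp_all add: u' central)
    show "linear \<nu>" "\<nu> (br x y) = 0" "\<nu> (u' 1) = 1" "\<nu> (u' 2) = 0" for x y by (simp_all add: u' nu)
    show "\<eta>' i (br (u' 3) x) = 0" for i x by (simp add: u' e)
  qed
  \<comment> \<open>Closedness equates this constant with \<open>c 3 4 2\<close>, which is zero once
    the third frame vector is central. Thus the bad case cannot recur.\<close>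
  have "C.c 4 7 5 = 0" using C.c_relations(10) by (simp add: C.c_def u' e)
  note C.central_u3_u4[OF this]
  then have "br (u' i) x = 0" if "i \<in> {1..4}" for i x
  proof -
    have "i = 1 \<or> i = 2 \<or> i = 3 \<or> i = 4" using that by auto
    then show ?thesis using C.central C.central_u3_u4[OF \<open>C.c 4 7 5 = 0\<close>] by auto
  qed
  then show thesis using that C.central_frame_axioms by blast
qed

section \<open>Frames with four central vectors: derivations and exact forms\<close>

locale four_central_frame = central_frame +
  assumes four_central: "i \<in> {1..4} \<Longrightarrow> br (u i) x = 0"
begin

lemma br_central [simp]: "br (u 1) x = 0" "br (u 2) x = 0" "br (u 3) x = 0" "br (u 4) x = 0"
  "br x (u 1) = 0" "br x (u 2) = 0" "br x (u 3) = 0" "br x (u 4) = 0"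
  using four_central br_antisym[of x "u 1"] br_antisym[of x "u 2"] br_antisym[of x "u 3"] br_antisym[of x "u 4"]
  by simp_all

text \<open>Closedness had expressed the constants with target 5 by brackets of \<open>u 3\<close>,
  which are zero now; those with target 6 vanished before.\<close>

lemma eta_br_0: "\<eta> 5 (br x y) = 0" "\<eta> 6 (br x y) = 0"
proof -
  have "c 4 7 5 = 0" "c 5 7 5 = 0" "c 6 7 5 = 0"
    using c_relations(10-12) by (simp_all add: c_def)
  moreover have "c 5 4 n = 0" "c 6 4 n = 0" "c 7 4 n = 0" for n by (simp_all add: c_def)
  ultimately have "\<eta> 5 (br (u i) y) = 0 \<and> \<eta> 6 (br (u i) y) = 0" if "i \<in> {5, 6, 7}" for i
    using that by (auto simp: eta_br c_relations c_relations' c_self)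
  then show "\<eta> 5 (br x y) = 0" "\<eta> 6 (br x y) = 0"
    by (subst expand[of x], simp add: br_simps blinfun.bilinear_simps)+
qed

text \<open>Derivations that map \<open>\<gg>\<close> to the centre and vanish on a hyperplane of the central \<open>span {u 1, u 2, u 3, u 4}\<close>.\<close>

definition dual_central :: "4 \<Rightarrow> 'a \<Rightarrow>\<^sub>L real" where
  "dual_central j = (if j = 1 then Blinfun \<nu> else if j = 2 then \<eta> 5 else if j = 3 then \<eta> 6 else \<eta> 7)"

definition basis_central :: "4 \<Rightarrow> 'a" where
  "basis_central j = (if j = 1 then u 1 else if j = 2 then u 2 else if j = 3 then u 3 else u 4)"

definition central_derivation :: "real ^ 4 ^ 4 \<Rightarrow> 'a \<Rightarrow>\<^sub>L 'a" where
  "central_derivation t = (\<Sum>i\<in>UNIV. \<Sum>j\<in>UNIV. t $ i $ j *\<^sub>R (blinfun_scaleR_left (basis_central i) o\<^sub>L dual_central j))"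

lemma linear_central_derivation: "linear central_derivation"
  by (rule linearI) (simp_all add: central_derivation_def scaleR_add_left sum.distrib scaleR_sum_right)

lemma central_derivation_apply:
  "central_derivation t x =
    (t $ 1 $ 1 * \<nu> x + t $ 1 $ 2 * \<eta> 5 x + t $ 1 $ 3 * \<eta> 6 x + t $ 1 $ 4 * \<eta> 7 x) *\<^sub>R u 1 +
    (t $ 2 $ 1 * \<nu> x + t $ 2 $ 2 * \<eta> 5 x + t $ 2 $ 3 * \<eta> 6 x + t $ 2 $ 4 * \<eta> 7 x) *\<^sub>R u 2 +
    (t $ 3 $ 1 * \<nu> x + t $ 3 $ 2 * \<eta> 5 x + t $ 3 $ 3 * \<eta> 6 x + t $ 3 $ 4 * \<eta> 7 x) *\<^sub>R u 3 +
    (t $ 4 $ 1 * \<nu> x + t $ 4 $ 2 * \<eta> 5 x + t $ 4 $ 3 * \<eta> 6 x + t $ 4 $ 4 * \<eta> 7 x) *\<^sub>R u 4"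
proof -
  have "blinfun_apply (Blinfun \<nu>) = \<nu>"
    using nu(1) by (simp add: bounded_linear_Blinfun_apply linear_conv_bounded_linear)
  then show ?thesis
    by (simp add: central_derivation_def sum_4 basis_central_def dual_central_def blinfun.bilinear_simps scaleR_add_left)
qed

text \<open>Both sides of the derivation rule vanish: \<open>\<nu>\<close>, \<open>\<eta> 5\<close>,
  \<open>\<eta> 6\<close>, \<open>\<eta> 7\<close> kill all brackets, and the values are
  central.\<close>

lemma range_central_derivation: "range central_derivation \<subseteq> derivations br"
  unfolding derivations_def
  by (auto simp: central_derivation_apply nu eta_br_0 br_simps)

lemma central_derivation_annihilator3:
  assumes "central_derivation t \<in> annihilator3 \<phi>"
  shows "t = 0"
proof -
  let ?D = "central_derivation t"
  have D: "\<eta> 1 (?D x) = t $ 1 $ 1 * \<nu> x + t $ 1 $ 2 * \<eta> 5 x + t $ 1 $ 3 * \<eta> 6 x + t $ 1 $ 4 * \<eta> 7 x"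
    "\<eta> 2 (?D x) = t $ 2 $ 1 * \<nu> x + t $ 2 $ 2 * \<eta> 5 x + t $ 2 $ 3 * \<eta> 6 x + t $ 2 $ 4 * \<eta> 7 x"
    "\<eta> 3 (?D x) = t $ 3 $ 1 * \<nu> x + t $ 3 $ 2 * \<eta> 5 x + t $ 3 $ 3 * \<eta> 6 x + t $ 3 $ 4 * \<eta> 7 x"
    "\<eta> 4 (?D x) = t $ 4 $ 1 * \<nu> x + t $ 4 $ 2 * \<eta> 5 x + t $ 4 $ 3 * \<eta> 6 x + t $ 4 $ 4 * \<eta> 7 x"
    "\<eta> 5 (?D x) = 0" "\<eta> 6 (?D x) = 0" "\<eta> 7 (?D x) = 0" for x
    by (simp_all add: central_derivation_apply blinfun.bilinear_simps)
  note skew = annihilator3_skew[OF assms]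
  \<comment> \<open>\<open>\<nu>\<close> may be nonzero on \<open>u 3\<close> to \<open>u 7\<close>,
    so the column of coefficients of \<open>\<nu>\<close> is cleared before the other three.\<close>
  have 11: "t $ 1 $ 1 = 0" using skew[of 1 1] by (simp add: D nu)
  have 1: "t $ 2 $ 1 = 0" "t $ 3 $ 1 = 0" "t $ 4 $ 1 = 0"
    using skew[of 1 2] skew[of 1 3] skew[of 1 4] by (simp_all add: D nu 11)
  have 2: "t $ 1 $ 2 = 0" "t $ 2 $ 2 = 0" "t $ 3 $ 2 = 0" "t $ 4 $ 2 = 0"
    using skew[of 1 5] skew[of 2 5] skew[of 3 5] skew[of 4 5] by (simp_all add: D 11 1)
  have 3: "t $ 1 $ 3 = 0" "t $ 2 $ 3 = 0" "t $ 3 $ 3 = 0" "t $ 4 $ 3 = 0"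
    using skew[of 1 6] skew[of 2 6] skew[of 3 6] skew[of 4 6] by (simp_all add: D 11 1)
  have 4: "t $ 1 $ 4 = 0" "t $ 2 $ 4 = 0" "t $ 3 $ 4 = 0" "t $ 4 $ 4 = 0"
    using skew[of 1 7] skew[of 2 7] skew[of 3 7] skew[of 4 7] by (simp_all add: D 11 1)
  show ?thesis by (simp add: vec_eq_iff forall_4 11 1 2 3 4)
qed

text \<open>An exact form vanishes on two central arguments. What remains is one of four central
  vectors with one of three pairs from \<open>u 5, u 6, u 7\<close>, and these three
  together.\<close>

lemma dim_exact_forms3_le: "dim (exact_forms3 br) \<le> 13"
proof -
  define F where "F \<psi> = ((\<chi> i. \<psi> (basis_central i) (u 5) (u 6)) :: real ^ 4, (\<chi> i. \<psi> (basis_central i) (u 5) (u 7)) :: real ^ 4,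
    (\<chi> i. \<psi> (basis_central i) (u 6) (u 7)) :: real ^ 4, \<psi> (u 5) (u 6) (u 7))" for \<psi> :: "'a trilin"
  have "dim (exact_forms3 br) \<le> DIM((real ^ 4) \<times> (real ^ 4) \<times> (real ^ 4) \<times> real)"
  proof (rule dim_le_DIM[of F])
    show "linear F"
      by (rule linearI) (simp_all add: F_def blinfun.bilinear_simps vec_eq_iff)
    show "subspace (exact_forms3 br)" by (rule subspace_exact_forms3)
    fix \<psi> assume \<psi>: "\<psi> \<in> exact_forms3 br" and F0: "F \<psi> = 0"
    obtain \<omega> where \<omega>: "\<psi> \<in> forms3" "\<And>x y z. \<psi> x y z = d2 br \<omega> x y z"
      using \<psi> unfolding exact_forms3_def by blast
    have "\<psi> (u i) v w = 0" if z: "(\<chi> i. \<psi> (basis_central i) v w :: real ^ 4) = 0" and i: "i \<in> {1..4}" for v w i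
    proof -
      have "\<psi> (basis_central j) v w = 0" for j using z by (simp add: vec_eq_iff)
      from this[of 1] this[of 2] this[of 3] this[of 4]
      have "\<psi> (u 1) v w = 0" "\<psi> (u 2) v w = 0" "\<psi> (u 3) v w = 0" "\<psi> (u 4) v w = 0"
        by (simp_all add: basis_central_def)
      moreover have "i = 1 \<or> i = 2 \<or> i = 3 \<or> i = 4" using i by auto
      ultimately show ?thesis by auto
    qed
    then have one: "\<psi> (u i) (u 5) (u 6) = 0" "\<psi> (u i) (u 5) (u 7) = 0" "\<psi> (u i) (u 6) (u 7) = 0" if "i \<in> {1..4}" for i
      using F0 that by (simp_all add: F_def zero_prod_def)
    have two: "\<psi> (u i) (u j) v = 0" if "i \<in> {1..4}" "j \<in> {1..4}" for i j v
      using that by (simp add: \<omega>(2) d2_def four_central blinfun.bilinear_simps)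
    show "\<psi> = 0"
    proof (rule forms3_frame_eqI[OF \<omega>(1) subspace_0[OF subspace_forms3]])
      fix i j k :: nat assume ijk: "1 \<le> i" "i < j" "j < k" "k \<le> 7"
      show "\<psi> (u i) (u j) (u k) = blinfun_apply (blinfun_apply (blinfun_apply 0 (u i)) (u j)) (u k)"
      proof (cases "j \<le> 4")
        case True
        then show ?thesis using two[of i j] ijk by simp
      next
        case False
        then consider "i \<le> 4" "j = 5" "k = 6" | "i \<le> 4" "j = 5" "k = 7" | "i \<le> 4" "j = 6" "k = 7" | "i = 5" "j = 6" "k = 7"
          using ijk by linarith
        then show ?thesis using one[of i] ijk(1) F0 by cases (auto simp: F_def zero_prod_def)
      qed
    qed
  qed
  then show ?thesis by simp
qed

lemma moduli_dim_less:
  assumes "G2_structure \<phi>"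
  shows "moduli_dim br < int (betti3 br)"
proof (rule moduli_dim_less_betti3[of \<phi> "range central_derivation"])
  show "\<phi> \<in> closed_G2 br" using closed assms by (simp add: closed_G2_def)
  show "subspace (range central_derivation)"
    using linear_central_derivation by (simp add: linear_subspace_image)
  show "range central_derivation \<subseteq> derivations br" by (rule range_central_derivation)
  show "range central_derivation \<inter> annihilator3 \<phi> \<subseteq> {0}"
    using central_derivation_annihilator3 linear_0[OF linear_central_derivation] by auto
  have "DIM(real ^ 4 ^ 4) \<le> dim (range central_derivation)"
  proof (rule DIM_le_dim[OF euclidean_iso_endomorphism linear_central_derivation _ order_refl])
    fix t assume "central_derivation t = 0"
    then show "t = 0"
      using central_derivation_annihilator3 subspace_0[OF subspace_annihilator3] by metis
  qed
  then show "dim (exact_forms3 br) < dim (range central_derivation)"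
    using dim_exact_forms3_le by simp
qed

lemma dim_center_ge: "4 \<le> dim {z. \<forall>x. br z x = 0}"
proof -
  define f where "f v = (\<Sum>i\<in>UNIV. v $ i *\<^sub>R basis_central i)" for v :: "real ^ 4"
  have f: "f v = v $ 1 *\<^sub>R u 1 + v $ 2 *\<^sub>R u 2 + v $ 3 *\<^sub>R u 3 + v $ 4 *\<^sub>R u 4" for v
    by (simp add: f_def sum_4 basis_central_def)
  have "DIM(real ^ 4) \<le> dim {z. \<forall>x. br z x = 0}"
  proof (rule DIM_le_dim[OF euclidean_iso_id])
    show "linear f" by (rule linearI) (simp_all add: f algebra_simps)
    show "v = 0" if "f v = 0" for v
    proof -
      have "\<eta> i (f v) = 0" for i using that by simp
      from this[of 1] this[of 2] this[of 3] this[of 4] show ?thesis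
        by (simp add: f blinfun.bilinear_simps vec_eq_iff forall_4)
    qed
    show "range f \<subseteq> {z. \<forall>x. br z x = 0}" by (auto simp: f br_simps)
  qed
  then show ?thesis by simp
qed

end

lemma decomposable_four_central_frame:
  fixes br :: "'a::euclidean_space \<Rightarrow> 'a \<Rightarrow> 'a"
  assumes "DIM('a) = 7" "lie_algebra br" "nilpotent br" "\<not> abelian br" "decomposable br" "\<phi> \<in> closed_G2 br"
  obtains u \<eta> \<nu> where "four_central_frame br \<phi> u \<eta> \<nu>"
proof -
  interpret lie br by unfold_locales (rule assms(2))
  obtain X Y \<mu> where XY: "linear \<mu>" "\<And>x y. \<mu> (br x y) = (0::real)" "\<mu> X = 1" "\<mu> Y = 0" "Y \<noteq> 0"
    "\<And>x. br X x = 0" "\<And>x. br Y x = 0"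
    by (rule decomposable_central_functional[OF assms(2-6)]) blast
  obtain u \<eta> \<nu> where "central_frame br \<phi> u \<eta> \<nu>"
    by (rule central_frame_exists[OF assms(1,3,6) XY]) blast
  then interpret central_frame br \<phi> u \<eta> \<nu> .
  obtain u' \<eta>' where "central_frame br \<phi> u' \<eta>' \<nu>" "\<And>i x. i \<in> {1..4} \<Longrightarrow> br (u' i) x = 0"
    by (rule central_frame_u3_u4) blast
  then have "four_central_frame br \<phi> u' \<eta>' \<nu>"
    by (simp add: four_central_frame_def four_central_frame_axioms_def)
  then show thesis by (rule that)
qed

lemma decomposable_moduli_dim_less_betti3:
  fixes br :: "'a::euclidean_space \<Rightarrow> 'a \<Rightarrow> 'a"
  assumes "DIM('a) = 7" "lie_algebra br" "nilpotent br" "\<not> abelian br" "decomposable br" "closed_G2 br \<noteq> {}"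
  shows "moduli_dim br < int (betti3 br)"
proof -
  obtain \<phi> where \<phi>: "\<phi> \<in> closed_G2 br" using assms(6) by blast
  obtain u \<eta> \<nu> where "four_central_frame br \<phi> u \<eta> \<nu>"
    by (rule decomposable_four_central_frame[OF assms(1-5) \<phi>])
  then show ?thesis using \<phi> by (intro four_central_frame.moduli_dim_less) (auto simp: closed_G2_def)
qed

lemma indecomposable_if_small_center:
  fixes br :: "'a::euclidean_space \<Rightarrow> 'a \<Rightarrow> 'a"
  assumes "DIM('a) = 7" "lie_algebra br" "nilpotent br" "closed_G2 br \<noteq> {}"
    and small: "dim {z. \<forall>x. br z x = 0} < 4"
  shows "\<not> decomposable br"
proof
  assume dec: "decomposable br"
  have "\<not> abelian br"
  proof
    assume "abelian br"
    then have "{z. \<forall>x. br z x = 0} = UNIV" by (auto simp: abelian_def)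
    then show False using small assms(1) by simp
  qed
  moreover obtain \<phi> where "\<phi> \<in> closed_G2 br" using assms(4) by blast
  ultimately obtain u \<eta> \<nu> where "four_central_frame br \<phi> u \<eta> \<nu>"
    using decomposable_four_central_frame[OF assms(1-3) _ dec] by metis
  then show False using four_central_frame.dim_center_ge small by fastforce
qed

section \<open>Two indecomposable examples\<close>

lemma exhaust_7: "x = 1 \<or> x = 2 \<or> x = 3 \<or> x = 4 \<or> x = 5 \<or> x = 6 \<or> x = 7" for x :: 7
proof (induct x)
  case (of_int z)
  then have "z = 0 \<or> z = 1 \<or> z = 2 \<or> z = 3 \<or> z = 4 \<or> z = 5 \<or> z = 6" by auto
  then show ?case by auto
qed

lemma forall_7: "(\<forall>i::7. P i) \<longleftrightarrow> P 1 \<and> P 2 \<and> P 3 \<and> P 4 \<and> P 5 \<and> P 6 \<and> P 7"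
  by (metis exhaust_7)

definition vec7 :: "real \<Rightarrow> real \<Rightarrow> real \<Rightarrow> real \<Rightarrow> real \<Rightarrow> real \<Rightarrow> real \<Rightarrow> real ^ 7" where
  "vec7 a1 a2 a3 a4 a5 a6 a7 = (\<chi> i. if i = 1 then a1 else if i = 2 then a2 else if i = 3 then a3
    else if i = 4 then a4 else if i = 5 then a5 else if i = 6 then a6 else a7)"

lemma vec7_nth [simp]:
  "vec7 a1 a2 a3 a4 a5 a6 a7 $ 1 = a1" "vec7 a1 a2 a3 a4 a5 a6 a7 $ 2 = a2" "vec7 a1 a2 a3 a4 a5 a6 a7 $ 3 = a3"
  "vec7 a1 a2 a3 a4 a5 a6 a7 $ 4 = a4" "vec7 a1 a2 a3 a4 a5 a6 a7 $ 5 = a5" "vec7 a1 a2 a3 a4 a5 a6 a7 $ 6 = a6"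
  "vec7 a1 a2 a3 a4 a5 a6 a7 $ 7 = a7"
  by (simp_all add: vec7_def)

lemma vec7_eqI:
  fixes x y :: "real ^ 7"
  assumes "x $ 1 = y $ 1" "x $ 2 = y $ 2" "x $ 3 = y $ 3" "x $ 4 = y $ 4" "x $ 5 = y $ 5" "x $ 6 = y $ 6" "x $ 7 = y $ 7"
  shows "x = y"
  using assms by (simp add: vec_eq_iff forall_7)

lemma G2_frame_form_exists:
  fixes u :: "nat \<Rightarrow> 'a::euclidean_space" and f :: "nat \<Rightarrow> 'a \<Rightarrow> real"
  assumes f: "\<And>i. linear (f i)"
    and dual: "\<And>i j. i \<in> {1..7} \<Longrightarrow> j \<in> {1..7} \<Longrightarrow> f i (u j) = (if i = j then 1 else 0)"
    and expand: "\<And>x. x = f 1 x *\<^sub>R u 1 + f 2 x *\<^sub>R u 2 + f 3 x *\<^sub>R u 3 + f 4 x *\<^sub>R u 4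
      + f 5 x *\<^sub>R u 5 + f 6 x *\<^sub>R u 6 + f 7 x *\<^sub>R u 7"
  obtains \<phi> \<eta> where "G2_frame \<phi> u \<eta>" "\<And>i x. blinfun_apply (\<eta> i) x = f i x"
proof -
  define \<eta> where "\<eta> i = Blinfun (f i)" for i
  have eta: "\<eta> i x = f i x" for i x
    using f[of i] by (simp add: \<eta>_def bounded_linear_Blinfun_apply linear_conv_bounded_linear)
  define g where "g x y z =
      wedge3 (\<eta> 1) (\<eta> 2) (\<eta> 7) x y z + wedge3 (\<eta> 3) (\<eta> 4) (\<eta> 7) x y z + wedge3 (\<eta> 5) (\<eta> 6) (\<eta> 7) x y z
      + wedge3 (\<eta> 1) (\<eta> 3) (\<eta> 5) x y z - wedge3 (\<eta> 2) (\<eta> 3) (\<eta> 6) x y z - wedge3 (\<eta> 1) (\<eta> 4) (\<eta> 6) x y z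
      - wedge3 (\<eta> 2) (\<eta> 4) (\<eta> 5) x y z" for x y z
  have w: "linear (\<lambda>x. wedge3 a b c x y z)" "linear (\<lambda>x. wedge3 a b c y x z)" "linear (\<lambda>x. wedge3 a b c y z x)"
    for a b c :: "'a \<Rightarrow>\<^sub>L real" and y z
    by (rule linearI; simp add: wedge3_def blinfun.bilinear_simps algebra_simps)+
  have lin: "linear (\<lambda>x. g x y z)" "linear (\<lambda>x. g y x z)" "linear (\<lambda>x. g y z x)" for y z
    unfolding g_def by (intro linear_compose_add linear_compose_sub w)+
  obtain \<phi> :: "'a trilin" where \<phi>: "\<And>x y z. \<phi> x y z = g x y z"
    by (rule trilin_exists[OF lin]) blast
  have "G2_frame \<phi> u \<eta>"
  proof
    show "x = \<eta> 1 x *\<^sub>R u 1 + \<eta> 2 x *\<^sub>R u 2 + \<eta> 3 x *\<^sub>R u 3 + \<eta> 4 x *\<^sub>R u 4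
      + \<eta> 5 x *\<^sub>R u 5 + \<eta> 6 x *\<^sub>R u 6 + \<eta> 7 x *\<^sub>R u 7" for x
      unfolding eta by (rule expand)
  qed (simp_all add: eta dual \<phi> g_def)
  then show thesis using that eta by blast
qed

lemma (in lie) lower_central_subset:
  assumes "lower_central br n \<subseteq> V" "subspace W" "\<And>x y. y \<in> V \<Longrightarrow> br x y \<in> W"
  shows "lower_central br (Suc n) \<subseteq> W"
  unfolding lower_central.simps by (rule span_minimal[OF _ assms(2)]) (use assms in blast)

lemma (in lie) nilpotentI: "lower_central br n \<subseteq> {0} \<Longrightarrow> nilpotent br"
proof -
  assume *: "lower_central br n \<subseteq> {0}"
  have "0 \<in> lower_central br n" by (cases n) (auto simp: span_zero)
  then show ?thesis using * by (auto simp: nilpotent_def)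
qed

lemma (in lie) exact_form_exists:
  fixes g :: "'a \<Rightarrow> 'a \<Rightarrow> real"
  assumes g: "\<And>y. linear (\<lambda>x. g x y)" "\<And>x. linear (g x)" "\<And>x. g x x = 0"
  obtains \<psi> where "\<psi> \<in> exact_forms3 br" "\<And>x y z. \<psi> x y z = - g (br x y) z + g (br x z) y - g (br y z) x"
proof -
  obtain \<omega> :: "'a bilin" where \<omega>: "\<And>x y. \<omega> x y = g x y" by (rule bilin_exists[OF g(1,2)]) blast
  have 1: "linear (\<lambda>x. g (br x y) z)" "linear (\<lambda>x. g (br y x) z)" "linear (\<lambda>x. g (br y z) x)" for y z
    using linear_compose[OF linear_br(2) g(1)] linear_compose[OF linear_br(1) g(1)] g(2) by (simp_all add: o_def)
  obtain \<psi> :: "'a trilin" where \<psi>: "\<And>x y z. \<psi> x y z = - g (br x y) z + g (br x z) y - g (br y z) x"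
    by (rule trilin_exists[of "\<lambda>x y z. - g (br x y) z + g (br x z) y - g (br y z) x"])
      (auto intro!: linear_compose_add linear_compose_sub linear_compose_neg 1)
  have "\<psi> x x y = 0 \<and> \<psi> x y x = 0 \<and> \<psi> y x x = 0" for x y
    using br_antisym[of y x] by (simp add: \<psi> linear_0[OF g(1)] linear_neg[OF g(1)])
  then have "\<psi> \<in> forms3" by (simp add: forms3_def)
  moreover have "\<omega> \<in> forms2" by (simp add: forms2_def \<omega> g(3))
  ultimately have "\<psi> \<in> exact_forms3 br"
    unfolding exact_forms3_def by (auto simp: d2_def \<psi> \<omega> intro!: bexI[of _ \<omega>])
  then show thesis using \<psi> that by blast
qed

text \<open>A semidirect product of a line with abelian 6-space: \<open>e7\<close> acts by
  \<open>e1 \<mapsto> e3 \<mapsto> e5\<close> and \<open>e2 \<mapsto> e4 \<mapsto> e6\<close>, two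
  nilpotent Jordan blocks of size 3.\<close>

definition br_n6 :: "real ^ 7 \<Rightarrow> real ^ 7 \<Rightarrow> real ^ 7" where
  "br_n6 x y = vec7 0 0 (x $ 7 * y $ 1 - x $ 1 * y $ 7) (x $ 7 * y $ 2 - x $ 2 * y $ 7)
    (x $ 7 * y $ 3 - x $ 3 * y $ 7) (x $ 7 * y $ 4 - x $ 4 * y $ 7) 0"

text \<open>A 5-step nilpotent algebra generated by \<open>e1\<close> and \<open>e2\<close>, with a
  centre of dimension 1. Two generators keep the number of derivations small.\<close>

definition br_n9 :: "real ^ 7 \<Rightarrow> real ^ 7 \<Rightarrow> real ^ 7" where
  "br_n9 x y = vec7 0 0 (x $ 1 * y $ 2 - x $ 2 * y $ 1) (x $ 1 * y $ 3 - x $ 3 * y $ 1) (x $ 2 * y $ 3 - x $ 3 * y $ 2)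
    ((x $ 1 * y $ 5 - x $ 5 * y $ 1) + (x $ 2 * y $ 4 - x $ 4 * y $ 2))
    ((x $ 1 * y $ 6 - x $ 6 * y $ 1) + (x $ 3 * y $ 4 - x $ 4 * y $ 3) + (x $ 2 * y $ 5 - x $ 5 * y $ 2))"

interpretation n6: lie br_n6
proof
  have "bilinear br_n6"
    by (auto simp: bilinear_def intro!: linearI vec7_eqI) (simp_all add: br_n6_def algebra_simps)
  moreover have "br_n6 x x = 0" for x by (rule vec7_eqI) (simp_all add: br_n6_def)
  moreover have "br_n6 x (br_n6 y z) + br_n6 y (br_n6 z x) + br_n6 z (br_n6 x y) = 0" for x y z
    by (rule vec7_eqI) (simp_all add: br_n6_def algebra_simps)
  ultimately show "lie_algebra br_n6" by (simp add: lie_algebra_def)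
qed

interpretation n9: lie br_n9
proof
  have "bilinear br_n9"
    by (auto simp: bilinear_def intro!: linearI vec7_eqI) (simp_all add: br_n9_def algebra_simps)
  moreover have "br_n9 x x = 0" for x by (rule vec7_eqI) (simp_all add: br_n9_def)
  moreover have "br_n9 x (br_n9 y z) + br_n9 y (br_n9 z x) + br_n9 z (br_n9 x y) = 0" for x y z
    by (rule vec7_eqI) (simp_all add: br_n9_def algebra_simps)
  ultimately show "lie_algebra br_n9" by (simp add: lie_algebra_def)
qed

lemma nilpotent_n6: "nilpotent br_n6"
proof (rule n6.nilpotentI)
  have "lower_central br_n6 (Suc 0) \<subseteq> {v. v $ 1 = 0 \<and> v $ 2 = 0 \<and> v $ 7 = 0}"
    by (rule n6.lower_central_subset[of _ UNIV]) (auto simp: br_n6_def subspace_def)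
  then have "lower_central br_n6 (Suc (Suc 0)) \<subseteq> {v. v $ 1 = 0 \<and> v $ 2 = 0 \<and> v $ 3 = 0 \<and> v $ 4 = 0 \<and> v $ 7 = 0}"
    by (rule n6.lower_central_subset) (auto simp: br_n6_def subspace_def)
  then show "lower_central br_n6 (Suc (Suc (Suc 0))) \<subseteq> {0}"
    by (rule n6.lower_central_subset) (auto simp: br_n6_def intro!: vec7_eqI)
qed

lemma nilpotent_n9: "nilpotent br_n9"
proof (rule n9.nilpotentI)
  have "lower_central br_n9 (Suc 0) \<subseteq> {v. v $ 1 = 0 \<and> v $ 2 = 0}"
    by (rule n9.lower_central_subset[of _ UNIV]) (auto simp: br_n9_def subspace_def)
  then have "lower_central br_n9 (Suc (Suc 0)) \<subseteq> {v. v $ 1 = 0 \<and> v $ 2 = 0 \<and> v $ 3 = 0}"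
    by (rule n9.lower_central_subset) (auto simp: br_n9_def subspace_def)
  then have "lower_central br_n9 (Suc (Suc (Suc 0))) \<subseteq> {v. v $ 1 = 0 \<and> v $ 2 = 0 \<and> v $ 3 = 0 \<and> v $ 4 = 0 \<and> v $ 5 = 0}"
    by (rule n9.lower_central_subset) (auto simp: br_n9_def subspace_def)
  then have "lower_central br_n9 (Suc (Suc (Suc (Suc 0)))) \<subseteq> {v. v $ 1 = 0 \<and> v $ 2 = 0 \<and> v $ 3 = 0 \<and> v $ 4 = 0 \<and> v $ 5 = 0 \<and> v $ 6 = 0}"
    by (rule n9.lower_central_subset) (auto simp: br_n9_def subspace_def)
  then show "lower_central br_n9 (Suc (Suc (Suc (Suc (Suc 0))))) \<subseteq> {0}"
    by (rule n9.lower_central_subset) (auto simp: br_n9_def intro!: vec7_eqI)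
qed

section \<open>The example with the smaller moduli space\<close>

definition n6_frame :: "nat \<Rightarrow> real ^ 7" where "n6_frame i = axis (of_nat i) 1"

lemma n6_G2:
  obtains \<phi> \<eta> where "G2_frame \<phi> n6_frame \<eta>" "\<And>i x. blinfun_apply (\<eta> i) x = x $ of_nat i" "\<phi> \<in> closed_forms3 br_n6"
proof -
  obtain \<phi> \<eta> where fr: "G2_frame \<phi> n6_frame \<eta>" and eta: "\<And>i x. blinfun_apply (\<eta> i) x = x $ of_nat i"
  proof (rule G2_frame_form_exists[of "\<lambda>i x. x $ of_nat i" n6_frame])
    show "linear (\<lambda>x. x $ of_nat i)" for i by (rule linearI) simp_all
    have "\<forall>i\<in>{1..7}. \<forall>j\<in>{1..7}. n6_frame j $ of_nat i = (if i = j then 1 else 0)"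
      unfolding ball_1_7 by (simp add: n6_frame_def axis_def)
    then show "n6_frame j $ of_nat i = (if i = j then 1 else 0)" if "i \<in> {1..7}" "j \<in> {1..7}" for i j
      using that by blast
    show "x = x $ of_nat 1 *\<^sub>R n6_frame 1 + x $ of_nat 2 *\<^sub>R n6_frame 2 + x $ of_nat 3 *\<^sub>R n6_frame 3
      + x $ of_nat 4 *\<^sub>R n6_frame 4 + x $ of_nat 5 *\<^sub>R n6_frame 5 + x $ of_nat 6 *\<^sub>R n6_frame 6
      + x $ of_nat 7 *\<^sub>R n6_frame 7" for x
      by (rule vec7_eqI) (simp_all add: n6_frame_def axis_def)
  qed blast
  interpret G2_frame \<phi> n6_frame \<eta> by (rule fr)
  have "d3 br_n6 \<phi> x y z w = 0" for x y z w
    unfolding d3_def phi wedge3_def eta br_n6_def by simp Groebner_Basis.algebra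
  then show thesis using that fr eta phi_forms3 by (simp add: closed_forms3_def)
qed

text \<open>Exact forms vanish on the abelian ideal spanned by the first six vectors. Of the 15
  triples containing 7, the triple 5, 6, 7 also contributes nothing, as \<open>e5\<close> and
  \<open>e6\<close> are central.\<close>

lemma n6_dim_exact: "dim (exact_forms3 br_n6) \<le> 14"
proof -
  obtain \<phi> \<eta> where "G2_frame \<phi> n6_frame \<eta>" by (rule n6_G2) blast
  then interpret G2_frame \<phi> n6_frame \<eta> .
  let ?u = n6_frame
  define F :: "(real ^ 7) trilin \<Rightarrow> (real ^ 7) \<times> (real ^ 7)" where
    "F \<psi> = (vec7 (\<psi> (?u 1) (?u 2) (?u 7)) (\<psi> (?u 1) (?u 3) (?u 7)) (\<psi> (?u 1) (?u 4) (?u 7)) (\<psi> (?u 1) (?u 5) (?u 7))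
        (\<psi> (?u 1) (?u 6) (?u 7)) (\<psi> (?u 2) (?u 3) (?u 7)) (\<psi> (?u 2) (?u 4) (?u 7)),
      vec7 (\<psi> (?u 2) (?u 5) (?u 7)) (\<psi> (?u 2) (?u 6) (?u 7)) (\<psi> (?u 3) (?u 4) (?u 7)) (\<psi> (?u 3) (?u 5) (?u 7))
        (\<psi> (?u 3) (?u 6) (?u 7)) (\<psi> (?u 4) (?u 5) (?u 7)) (\<psi> (?u 4) (?u 6) (?u 7)))" for \<psi>
  have "dim (exact_forms3 br_n6) \<le> DIM((real ^ 7) \<times> (real ^ 7))"
  proof (rule dim_le_DIM[of F])
    show "linear F"
      by (rule linearI) (simp_all add: F_def blinfun.bilinear_simps vec_eq_iff forall_7)
    show "subspace (exact_forms3 br_n6)" by (rule subspace_exact_forms3)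
    fix \<psi> assume \<psi>: "\<psi> \<in> exact_forms3 br_n6" and F0: "F \<psi> = 0"
    obtain \<omega> where \<omega>: "\<psi> \<in> forms3" "\<And>x y z. \<psi> x y z = d2 br_n6 \<omega> x y z"
      using \<psi> unfolding exact_forms3_def by blast
    have br0: "br_n6 (?u i) (?u j) = 0" if "i \<in> {1..6}" "j \<in> {1..6}" for i j
    proof -
      have "\<forall>i\<in>{1..7}. ?u i $ 7 = (if i = 7 then 1 else 0)"
        unfolding ball_1_7 by (simp add: n6_frame_def axis_def)
      then have "?u i $ 7 = 0" "?u j $ 7 = 0" using that by auto
      then show ?thesis by (intro vec7_eqI) (simp_all add: br_n6_def)
    qed
    have br57: "br_n6 (?u 5) (?u 7) = 0" "br_n6 (?u 6) (?u 7) = 0"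
      by (rule vec7_eqI; simp add: br_n6_def n6_frame_def axis_def)+
    have inner: "\<psi> (?u i) (?u j) (?u k) = 0" if "i \<in> {1..6}" "j \<in> {1..6}" "k \<in> {1..6}" for i j k
      using that by (simp add: \<omega>(2) d2_def br0 blinfun.bilinear_simps)
    have "\<psi> (?u 5) (?u 6) (?u 7) = 0"
      by (simp add: \<omega>(2) d2_def br0 br57 blinfun.bilinear_simps)
    note last = this F0[unfolded F_def zero_prod_def prod.inject vec_eq_iff forall_7 vec7_nth zero_index]
    show "\<psi> = 0"
    proof (rule forms3_frame_eqI[OF \<omega>(1) subspace_0[OF subspace_forms3]])
      fix i j k :: nat assume ijk: "1 \<le> i" "i < j" "j < k" "k \<le> 7"
      show "\<psi> (?u i) (?u j) (?u k) = blinfun_apply (blinfun_apply (blinfun_apply 0 (?u i)) (?u j)) (?u k)"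
      proof (cases "k = 7")
        case True
        have "\<forall>j\<in>{1..7}. \<forall>i\<in>{1..7}. i < j \<longrightarrow> j < 7 \<longrightarrow> \<psi> (?u i) (?u j) (?u 7) = 0"
          unfolding ball_1_7 using last by simp
        then show ?thesis using True ijk by simp
      qed (use inner ijk in simp)
    qed
  qed
  then show ?thesis by simp
qed

lemma n6_center: "dim {z. \<forall>x. br_n6 z x = 0} < 4"
proof -
  have "dim {z. \<forall>x. br_n6 z x = 0} \<le> DIM(real \<times> real)"
  proof (rule dim_le_DIM[of "\<lambda>z. (z $ 5, z $ 6)"])
    show "linear (\<lambda>z :: real ^ 7. (z $ 5, z $ 6))" by (rule linearI) simp_all
    show "subspace {z. \<forall>x. br_n6 z x = 0}" by (auto simp: subspace_def n6.br_simps)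
    fix z assume "z \<in> {z. \<forall>x. br_n6 z x = 0}" and z: "(z $ 5, z $ 6) = 0"
    then have "br_n6 z (axis 7 1) = 0" "br_n6 z (axis 1 1) = 0" by auto
    then have "br_n6 z (axis 7 1) $ i = 0" "br_n6 z (axis 1 1) $ i = 0" for i by simp_all
    from this(1)[of 3] this(1)[of 4] this(1)[of 5] this(1)[of 6] this(2)[of 3]
    show "z = 0" using z by (intro vec7_eqI) (simp_all add: br_n6_def axis_def zero_prod_def)
  qed
  then show ?thesis by simp
qed

type_synonym n6_parameter = "(real ^ 4) \<times> (real ^ 4) \<times> (real ^ 4) \<times> real \<times> real \<times> real"

text \<open>\<open>a\<close>, \<open>a5\<close>, \<open>a6\<close> give an arbitrary image of
  \<open>e7\<close> in the abelian ideal; \<open>s\<close>, \<open>m\<close>, \<open>n\<close> give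
  an endomorphism of the ideal that commutes with the action of \<open>e7\<close>. At order zero
  only the entry \<open>s\<close> is kept, which makes the matrix strictly triangular in the order
  7, 1, 2, 3, 4, 5, 6.\<close>

definition n6_derivation :: "n6_parameter \<Rightarrow> real ^ 7 \<Rightarrow> real ^ 7" where
  "n6_derivation = (\<lambda>(a, m, n, a5, a6, s) x. vec7
     (a $ 1 * x $ 7)
     (a $ 2 * x $ 7 + s * x $ 1)
     (a $ 3 * x $ 7 + m $ 1 * x $ 1 + m $ 2 * x $ 2)
     (a $ 4 * x $ 7 + m $ 3 * x $ 1 + m $ 4 * x $ 2 + s * x $ 3)
     (a5 * x $ 7 + m $ 1 * x $ 3 + m $ 2 * x $ 4 + n $ 1 * x $ 1 + n $ 2 * x $ 2)
     (a6 * x $ 7 + m $ 3 * x $ 3 + m $ 4 * x $ 4 + n $ 3 * x $ 1 + n $ 4 * x $ 2 + s * x $ 5)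
     0)"

lemma n6_moduli_dim: "moduli_dim br_n6 < int (betti3 br_n6)" "closed_G2 br_n6 \<noteq> {}"
proof -
  obtain \<phi> \<eta> where fr: "G2_frame \<phi> n6_frame \<eta>" and eta: "\<And>i x. blinfun_apply (\<eta> i) x = x $ of_nat i"
    and closed: "\<phi> \<in> closed_forms3 br_n6" by (rule n6_G2) blast
  interpret G2_frame \<phi> n6_frame \<eta> by (rule fr)
  have \<phi>: "\<phi> \<in> closed_G2 br_n6" using closed G2_structure by (simp add: closed_G2_def)
  then show "closed_G2 br_n6 \<noteq> {}" by blast
  define D where "D t = Blinfun (n6_derivation t)" for t
  have "linear (n6_derivation t)" for t
    unfolding n6_derivation_def case_prod_unfold
    by (rule linearI; rule vec7_eqI) (simp_all add: algebra_simps)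
  then have D: "D t x = n6_derivation t x" for t x
    unfolding D_def by (simp add: bounded_linear_Blinfun_apply linear_conv_bounded_linear)
  have lin: "linear D"
    by (rule linearI; rule blinfun_eqI; rule vec7_eqI)
      (simp_all add: D blinfun.bilinear_simps n6_derivation_def case_prod_unfold algebra_simps)
  have der: "range D \<subseteq> derivations br_n6"
  proof -
    have "D t (br_n6 x y) = br_n6 (D t x) y + br_n6 x (D t y)" for t x y
      by (rule vec7_eqI) (simp_all add: D n6_derivation_def br_n6_def case_prod_unfold algebra_simps)
    then show ?thesis by (auto simp: derivations_def)
  qed
  \<comment> \<open>A strictly triangular skew matrix is zero; each parameter is an entry whose
    transposed entry vanishes.\<close>
  have zero: "t = 0" if "D t \<in> annihilator3 \<phi>" for t
  proof -
    obtain a m n a5 a6 s where t: "t = (a, m, n, a5, a6, s)" by (cases t)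
    note skew = annihilator3_skew[OF that, unfolded eta D t n6_derivation_def n6_frame_def]
    have "a $ 1 = 0" "a $ 2 = 0" "a $ 3 = 0" "a $ 4 = 0" "a5 = 0" "a6 = 0"
      using skew[of 1 7] skew[of 2 7] skew[of 3 7] skew[of 4 7] skew[of 5 7] skew[of 6 7] by (simp_all add: axis_def)
    moreover have "s = 0" using skew[of 2 1] by (simp add: axis_def)
    moreover have "m $ 1 = 0" "m $ 2 = 0" "m $ 3 = 0" "m $ 4 = 0"
      using skew[of 3 1] skew[of 3 2] skew[of 4 1] skew[of 4 2] by (simp_all add: axis_def)
    moreover have "n $ 1 = 0" "n $ 2 = 0" "n $ 3 = 0" "n $ 4 = 0"
      using skew[of 5 1] skew[of 5 2] skew[of 6 1] skew[of 6 2] by (simp_all add: axis_def)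
    ultimately show ?thesis by (simp add: t zero_prod_def vec_eq_iff forall_4)
  qed
  show "moduli_dim br_n6 < int (betti3 br_n6)"
  proof (rule n6.moduli_dim_less_betti3[OF \<phi>, of "range D"])
    show "subspace (range D)" using lin by (simp add: linear_subspace_image)
    show "range D \<subseteq> derivations br_n6" by (rule der)
    show "range D \<inter> annihilator3 \<phi> \<subseteq> {0}"
    proof
      fix E assume "E \<in> range D \<inter> annihilator3 \<phi>"
      then obtain t where "E = D t" "D t \<in> annihilator3 \<phi>" by blast
      then show "E \<in> {0}" using zero[of t] linear_0[OF lin] by simp
    qed
    have "DIM(n6_parameter) \<le> dim (range D)"
    proof (rule DIM_le_dim[OF euclidean_iso_endomorphism lin _ order_refl])
      have "0 \<in> annihilator3 \<phi>" by (rule subspace_0[OF subspace_annihilator3])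
      then show "t = 0" if "D t = 0" for t using zero[of t] that by simp
    qed
    then show "dim (exact_forms3 br_n6) < dim (range D)" using n6_dim_exact by simp
  qed
qed

section \<open>The example with the larger moduli space\<close>

lemma n9_center: "dim {z. \<forall>x. br_n9 z x = 0} < 4"
proof -
  have "dim {z. \<forall>x. br_n9 z x = 0} \<le> DIM(real)"
  proof (rule dim_le_DIM[of "\<lambda>z. z $ 7"])
    show "linear (\<lambda>z :: real ^ 7. z $ 7)" by (rule linearI) simp_all
    show "subspace {z. \<forall>x. br_n9 z x = 0}" by (auto simp: subspace_def n9.br_simps)
    fix z assume "z \<in> {z. \<forall>x. br_n9 z x = 0}" and z: "z $ 7 = 0"
    then have "br_n9 z (axis 1 1) = 0" "br_n9 z (axis 2 1) = 0" by auto
    then have "br_n9 z (axis 1 1) $ i = 0" "br_n9 z (axis 2 1) $ i = 0" for i by simp_all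
    from this(1)[of 3] this(1)[of 4] this(1)[of 6] this(1)[of 7] this(2)[of 3] this(2)[of 5] this(2)[of 6] this(2)[of 7]
    show "z = 0" using z by (intro vec7_eqI) (simp_all add: br_n9_def axis_def)
  qed
  then show ?thesis by simp
qed

text \<open>Brings to standard form the closed 3-form that is written out in coordinates as
  \<open>phi'\<close> in the proof of \<open>n9_G2\<close>; \<open>n9_frame\<close> is the dual
  basis.\<close>

definition n9_coframe :: "nat \<Rightarrow> real ^ 7 \<Rightarrow> real" where
  "n9_coframe i x =
    (if i = 1 then 2 * x $ 1
     else if i = 2 then x $ 3 - x $ 1
     else if i = 3 then x $ 7 + x $ 4 + x $ 5 / 2
     else if i = 4 then x $ 2
     else if i = 5 then x $ 5 / 2 - x $ 2 - x $ 4
     else if i = 6 then x $ 2 - x $ 5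
     else x $ 6 + x $ 3 - x $ 1)"

definition n9_frame :: "nat \<Rightarrow> real ^ 7" where
  "n9_frame i =
    (if i = 1 then vec7 (1/2) 0 (1/2) 0 0 0 0
     else if i = 2 then vec7 0 0 1 0 0 (-1) 0
     else if i = 3 then vec7 0 0 0 0 0 0 1
     else if i = 4 then vec7 0 1 0 (-1/2) 1 0 0
     else if i = 5 then vec7 0 0 0 (-1) 0 0 1
     else if i = 6 then vec7 0 0 0 (-1/2) (-1) 0 1
     else vec7 0 0 0 0 0 1 0)"

lemma n9_G2: "closed_G2 br_n9 \<noteq> {}"
proof -
  obtain \<phi> \<eta> where fr: "G2_frame \<phi> n9_frame \<eta>" and eta: "\<And>i x. blinfun_apply (\<eta> i) x = n9_coframe i x"
  proof (rule G2_frame_form_exists[of n9_coframe n9_frame])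
    show "linear (n9_coframe i)" for i
      by (rule linearI) (simp_all add: n9_coframe_def algebra_simps)
    have "\<forall>i\<in>{1..7}. \<forall>j\<in>{1..7}. n9_coframe i (n9_frame j) = (if i = j then 1 else 0)"
      unfolding ball_1_7 by (simp add: n9_frame_def n9_coframe_def)
    then show "n9_coframe i (n9_frame j) = (if i = j then 1 else 0)" if "i \<in> {1..7}" "j \<in> {1..7}" for i j
      using that by blast
    show "x = n9_coframe 1 x *\<^sub>R n9_frame 1 + n9_coframe 2 x *\<^sub>R n9_frame 2 + n9_coframe 3 x *\<^sub>R n9_frame 3
      + n9_coframe 4 x *\<^sub>R n9_frame 4 + n9_coframe 5 x *\<^sub>R n9_frame 5 + n9_coframe 6 x *\<^sub>R n9_frame 6
      + n9_coframe 7 x *\<^sub>R n9_frame 7" for x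
      by (rule vec7_eqI) (simp_all add: n9_frame_def n9_coframe_def algebra_simps)
  qed blast
  interpret G2_frame \<phi> n9_frame \<eta> by (rule fr)
  define e where "e i j k x y z = x $ i * (y $ j * z $ k - z $ j * y $ k) - y $ i * (x $ j * z $ k - z $ j * x $ k)
    + z $ i * (x $ j * y $ k - y $ j * x $ k)" for i j k and x y z :: "real ^ 7"
  have phi': "\<phi> x y z = 3 * e 1 2 5 x y z + 2 * e 1 2 7 x y z + 2 * e 1 3 6 x y z + 2 * e 1 4 7 x y z
      - 2 * e 2 3 4 x y z + e 2 6 7 x y z + 2 * e 3 4 5 x y z - e 3 5 7 x y z + e 4 5 6 x y z" for x y z
    unfolding phi wedge3_def eta n9_coframe_def e_def by (simp add: field_simps)
  have "d3 br_n9 \<phi> x y z w = 0" for x y z w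
    unfolding d3_def phi' e_def br_n9_def vec7_nth by Groebner_Basis.algebra
  then have "\<phi> \<in> closed_G2 br_n9"
    using phi_forms3 G2_structure by (simp add: closed_G2_def closed_forms3_def)
  then show ?thesis by blast
qed

text \<open>A derivation is determined by its values on the generators \<open>e1\<close> and
  \<open>e2\<close>, which have 14 components. Two of these are forced to vanish.\<close>

lemma n9_dim_derivations: "dim (derivations br_n9) \<le> 12"
proof -
  define F :: "((real ^ 7) \<Rightarrow>\<^sub>L (real ^ 7)) \<Rightarrow> real \<times> real \<times> real \<times> real \<times> real \<times> real \<times> real \<times> real \<times> real \<times> real \<times> real \<times> real"
    where "F D = (D (axis 1 1) $ 1, D (axis 1 1) $ 3, D (axis 1 1) $ 4, D (axis 1 1) $ 5, D (axis 1 1) $ 6, D (axis 1 1) $ 7,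
      D (axis 2 1) $ 2, D (axis 2 1) $ 3, D (axis 2 1) $ 4, D (axis 2 1) $ 5, D (axis 2 1) $ 6, D (axis 2 1) $ 7)" for D
  have "dim (derivations br_n9) \<le> DIM(real \<times> real \<times> real \<times> real \<times> real \<times> real \<times> real \<times> real \<times> real \<times> real \<times> real \<times> real)"
  proof (rule dim_le_DIM[of F])
    show "linear F" by (rule linearI) (simp_all add: F_def blinfun.bilinear_simps)
    show "subspace (derivations br_n9)" by (rule subspace_derivations[OF n9.bilinear])
    fix D assume D: "D \<in> derivations br_n9" and F0: "F D = 0"
    let ?e = "\<lambda>i :: 7. axis i 1 :: real ^ 7"
    have der: "D (br_n9 (?e i) (?e j)) = br_n9 (D (?e i)) (?e j) + br_n9 (?e i) (D (?e j))" for i j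
      using D by (simp add: derivations_def)
    have br: "br_n9 (?e 1) (?e 2) = ?e 3" "br_n9 (?e 1) (?e 3) = ?e 4" "br_n9 (?e 2) (?e 3) = ?e 5"
      "br_n9 (?e 1) (?e 5) = ?e 6" "br_n9 (?e 1) (?e 6) = ?e 7" "br_n9 (?e 1) (?e 4) = 0" "br_n9 (?e 2) (?e 6) = 0"
      by (rule vec7_eqI; simp add: br_n9_def axis_def)+
    have 0: "D 0 = 0" by (simp add: blinfun.bilinear_simps)
    note d = der[of 1 2, unfolded br] der[of 1 3, unfolded br] der[of 2 3, unfolded br] der[of 1 5, unfolded br]
      der[of 1 6, unfolded br] der[of 1 4, unfolded br 0] der[of 2 6, unfolded br 0]
    note c = d[THEN arg_cong[where f = "\<lambda>v. v $ k" for k]]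
    \<comment> \<open>The relations \<open>[e1,e4] = 0\<close> and \<open>[e2,e6] = 0\<close>,
      together with the brackets producing \<open>e4\<close> and \<open>e6\<close>, rule out mixing
      of the two generators.\<close>
    have "D (?e 4) $ 5 = D (?e 2) $ 1" "D (?e 2) $ 1 + D (?e 4) $ 5 = 0"
      "D (?e 6) $ 5 = 0" "D (?e 1) $ 2 + D (?e 6) $ 5 = 0"
      using c(2)[of 5] c(6)[of 6] c(4)[of 5] c(7)[of 7] by (simp_all add: br_n9_def axis_def)
    then have "D (?e 2) $ 1 = 0" "D (?e 1) $ 2 = 0" by simp_all
    then have e12: "D (?e 1) = 0" "D (?e 2) = 0"
      using F0 by (simp_all add: F_def zero_prod_def vec_eq_iff forall_7)
    then have e3: "D (?e 3) = 0" using d(1) by (simp add: n9.br_simps)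
    then have e45: "D (?e 4) = 0" "D (?e 5) = 0" using d(2,3) e12 by (simp_all add: n9.br_simps)
    then have e6: "D (?e 6) = 0" using d(4) e12 by (simp add: n9.br_simps)
    then have e7: "D (?e 7) = 0" using d(5) e12 by (simp add: n9.br_simps)
    show "D = 0"
    proof (rule blinfun_eqI)
      fix x :: "real ^ 7"
      have "x = x $ 1 *\<^sub>R ?e 1 + x $ 2 *\<^sub>R ?e 2 + x $ 3 *\<^sub>R ?e 3 + x $ 4 *\<^sub>R ?e 4
        + x $ 5 *\<^sub>R ?e 5 + x $ 6 *\<^sub>R ?e 6 + x $ 7 *\<^sub>R ?e 7"
        by (rule vec7_eqI) (simp_all add: axis_def)
      then have "D x = D (x $ 1 *\<^sub>R ?e 1 + x $ 2 *\<^sub>R ?e 2 + x $ 3 *\<^sub>R ?e 3 + x $ 4 *\<^sub>R ?e 4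
        + x $ 5 *\<^sub>R ?e 5 + x $ 6 *\<^sub>R ?e 6 + x $ 7 *\<^sub>R ?e 7)" by (rule arg_cong)
      then show "D x = blinfun_apply 0 x" by (simp add: blinfun.bilinear_simps e12 e3 e45 e6 e7)
    qed
  qed
  then show ?thesis by simp
qed

type_synonym n9_parameter = "(real ^ 4) \<times> (real ^ 4) \<times> (real ^ 4) \<times> real"

text \<open>Spanned by 13 of the 21 coordinate 2-forms, with the index pairs 12, 13, 14, 23, 24, 25,
  34, 35 omitted; the differential is injective on this span, as shown in
  \<open>n9_dim_exact\<close>.\<close>

definition n9_form :: "n9_parameter \<Rightarrow> real ^ 7 \<Rightarrow> real ^ 7 \<Rightarrow> real" where
  "n9_form = (\<lambda>(a, b, c, r) x y.
     a $ 1 * (x $ 1 * y $ 5 - x $ 5 * y $ 1) + a $ 2 * (x $ 1 * y $ 6 - x $ 6 * y $ 1)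
     + a $ 3 * (x $ 1 * y $ 7 - x $ 7 * y $ 1) + a $ 4 * (x $ 2 * y $ 6 - x $ 6 * y $ 2)
     + b $ 1 * (x $ 2 * y $ 7 - x $ 7 * y $ 2) + b $ 2 * (x $ 3 * y $ 6 - x $ 6 * y $ 3)
     + b $ 3 * (x $ 3 * y $ 7 - x $ 7 * y $ 3) + b $ 4 * (x $ 4 * y $ 5 - x $ 5 * y $ 4)
     + c $ 1 * (x $ 4 * y $ 6 - x $ 6 * y $ 4) + c $ 2 * (x $ 4 * y $ 7 - x $ 7 * y $ 4)
     + c $ 3 * (x $ 5 * y $ 6 - x $ 6 * y $ 5) + c $ 4 * (x $ 5 * y $ 7 - x $ 7 * y $ 5)
     + r * (x $ 6 * y $ 7 - x $ 7 * y $ 6))"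

lemma n9_dim_exact: "13 \<le> dim (exact_forms3 br_n9)"
proof -
  let ?d = "\<lambda>t x y z. - n9_form t (br_n9 x y) z + n9_form t (br_n9 x z) y - n9_form t (br_n9 y z) x"
  have "\<exists>\<psi> :: (real ^ 7) trilin. \<psi> \<in> exact_forms3 br_n9 \<and> (\<forall>x y z. \<psi> x y z = ?d t x y z)" for t
  proof (rule n9.exact_form_exists[of "n9_form t"])
    show "linear (\<lambda>x. n9_form t x y)" "linear (n9_form t x)" for x y
      unfolding n9_form_def case_prod_unfold
      by (rule linearI; simp add: algebra_simps)+
    show "n9_form t x x = 0" for x by (simp add: n9_form_def case_prod_unfold)
  qed blast
  then obtain f :: "n9_parameter \<Rightarrow> (real ^ 7) trilin"
    where f: "\<And>t. f t \<in> exact_forms3 br_n9" "\<And>t x y z. f t x y z = ?d t x y z" by metis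
  have add: "n9_form (s + t) x y = n9_form s x y + n9_form t x y" for s t x y
    unfolding n9_form_def case_prod_unfold by (simp add: algebra_simps)
  have scale: "n9_form (c *\<^sub>R t) x y = c * n9_form t x y" for c t x y
    unfolding n9_form_def case_prod_unfold by (simp add: algebra_simps)
  have "linear f"
    by (rule linearI; rule blinfun_eqI; rule blinfun_eqI; rule blinfun_eqI)
      (simp_all add: blinfun.bilinear_simps f(2) add scale algebra_simps)
  then have "DIM(n9_parameter) \<le> dim (exact_forms3 br_n9)"
  proof (rule DIM_le_dim[OF euclidean_iso_trilin_coords])
    show "range f \<subseteq> exact_forms3 br_n9" using f(1) by blast
    fix t assume "f t = 0"
    then have *: "?d t (axis i 1) (axis j 1) (axis k 1) = 0" for i j k
      unfolding f(2)[symmetric] by (simp add: blinfun.bilinear_simps)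
    obtain a b c r where t: "t = (a, b, c, r)" by (cases t)
    let ?e = "\<lambda>i :: 7. axis i 1 :: real ^ 7"
    have br: "br_n9 (?e 1) (?e 2) = ?e 3" "br_n9 (?e 1) (?e 3) = ?e 4" "br_n9 (?e 2) (?e 3) = ?e 5"
      "br_n9 (?e 1) (?e 5) = ?e 6" "br_n9 (?e 2) (?e 4) = ?e 6" "br_n9 (?e 1) (?e 6) = ?e 7"
      "br_n9 (?e 3) (?e 4) = ?e 7" "br_n9 (?e 2) (?e 5) = ?e 7" "br_n9 (?e 1) (?e 4) = 0" "br_n9 (?e 1) (?e 7) = 0"
      "br_n9 (?e 2) (?e 6) = 0" "br_n9 (?e 2) (?e 7) = 0" "br_n9 (?e 3) (?e 5) = 0" "br_n9 (?e 3) (?e 6) = 0"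
      "br_n9 (?e 3) (?e 7) = 0" "br_n9 (?e 5) (?e 7) = 0"
      by (rule vec7_eqI; simp add: br_n9_def axis_def)+
    note eval = t n9_form_def axis_def
    \<comment> \<open>On each of these triples all but one coefficient drop out of the
      differential.\<close>
    have "a $ 1 = 0" "a $ 2 = 0" "a $ 3 = 0" "b $ 3 = 0" "c $ 2 = 0" "c $ 3 = 0" "c $ 4 = 0" "r = 0"
      using *[of 1 2 3] *[of 1 2 4] *[of 1 3 4] *[of 2 3 5] *[of 1 3 7] *[of 2 3 6] *[of 2 3 7] *[of 1 5 7]
      unfolding br by (simp_all add: eval)
    moreover have "a $ 3 = a $ 4" using *[of 1 2 5] unfolding br by (simp add: eval)
    moreover have "c $ 1 = - b $ 3" using *[of 1 3 6] unfolding br by (simp add: eval)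
    \<comment> \<open>A nonsingular system: it gives \<open>b $ 1 = b $ 4 = - b $ 2\<close> and then
      \<open>3 * b $ 2 = 0\<close>.\<close>
    moreover have "b $ 1 + b $ 2 = 0" "b $ 1 - b $ 2 + b $ 4 = 0" "b $ 2 + b $ 4 = 0"
      using *[of 1 2 6] *[of 2 3 4] *[of 1 3 5] unfolding br by (simp_all add: eval)
    ultimately show "t = 0" by (simp add: t zero_prod_def vec_eq_iff forall_4)
  qed
  then show ?thesis by simp
qed

theorem theorem2p13:
  shows
    "(\<forall>br :: 'a::euclidean_space \<Rightarrow> 'a \<Rightarrow> 'a.
        DIM('a) = 7 \<and> lie_algebra br \<and> nilpotent br \<and> \<not> abelian br \<and> decomposable br \<and>
        closed_G2 br \<noteq> {} \<longrightarrow>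
        moduli_dim br < int (betti3 br)) \<and>
     (\<exists>br :: real ^ 7 \<Rightarrow> real ^ 7 \<Rightarrow> real ^ 7.
        lie_algebra br \<and> nilpotent br \<and> \<not> decomposable br \<and> closed_G2 br \<noteq> {} \<and>
        moduli_dim br < int (betti3 br)) \<and>
     (\<exists>br :: real ^ 7 \<Rightarrow> real ^ 7 \<Rightarrow> real ^ 7.
        lie_algebra br \<and> nilpotent br \<and> \<not> decomposable br \<and> closed_G2 br \<noteq> {} \<and>
        moduli_dim br > int (betti3 br))"
proof (intro conjI)
  have n6: "\<not> decomposable br_n6"
    by (rule indecomposable_if_small_center[OF _ n6.lie_algebra nilpotent_n6 n6_moduli_dim(2) n6_center]) simp
  have n9: "\<not> decomposable br_n9"
    by (rule indecomposable_if_small_center[OF _ n9.lie_algebra nilpotent_n9 n9_G2 n9_center]) simp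
  have less: "int (betti3 br_n9) < moduli_dim br_n9"
    using n9_dim_derivations n9_dim_exact by (intro n9.betti3_less_moduli_dim[OF n9_G2]) simp
  show "\<forall>br :: 'a \<Rightarrow> 'a \<Rightarrow> 'a.
        DIM('a) = 7 \<and> lie_algebra br \<and> nilpotent br \<and> \<not> abelian br \<and> decomposable br \<and>
        closed_G2 br \<noteq> {} \<longrightarrow> moduli_dim br < int (betti3 br)"
    using decomposable_moduli_dim_less_betti3 by blast
  show "\<exists>br :: real ^ 7 \<Rightarrow> real ^ 7 \<Rightarrow> real ^ 7.
        lie_algebra br \<and> nilpotent br \<and> \<not> decomposable br \<and> closed_G2 br \<noteq> {} \<and>
        moduli_dim br < int (betti3 br)"
    using n6.lie_algebra nilpotent_n6 n6 n6_moduli_dim by blast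
  show "\<exists>br :: real ^ 7 \<Rightarrow> real ^ 7 \<Rightarrow> real ^ 7.
        lie_algebra br \<and> nilpotent br \<and> \<not> decomposable br \<and> closed_G2 br \<noteq> {} \<and>
        moduli_dim br > int (betti3 br)"
    using n9.lie_algebra nilpotent_n9 n9 n9_G2 less by blast
qed

end
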